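(* Let $(M,J,\nabla,\omega)$ be a special symplectic manifold. Then the cotangent bundle $N=T^*M$ carries two natural complex structures (i.e. the following almost complex structures are integrable) $$J_1=J^\nabla=\begin{pmatrix}J&0\\0&J^*\end{pmatrix}\quad\text{and}\quad J_2=J^\omega=\begin{pmatrix}0&-\omega^{-1}\\ \omega&0\end{pmatrix}.$$ The commutator and anticommutator of $J_1$ and $J_2$ are given by $$[J_1,J_2]=2J_1\begin{pmatrix}0&-(\omega^{-1})^{11}\\ \omega^{11}&0\end{pmatrix}=-2\begin{pmatrix}0&-(\omega^{-1})^{11}\\ \omega^{11}&0\end{pmatrix}J_1,$$ $$\{J_1,J_2\}=2J_1\begin{pmatrix}0&-(\omega^{-1})'\\ \omega'&0\end{pmatrix}=2\begin{pmatrix}0&-(\omega^{-1})'\\ \omega'&0\end{pmatrix}J_1,$$ where $\omega'=\omega^{20}+\omega^{02}$.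
   Context: A special symplectic manifold $(M,J,\nabla,\omega)$ is a complex manifold $(M,J)$ together with a flat torsionfree connection $\nabla$ on its real tangent bundle such that $d^\nabla J=0$, i.e. $(\nabla_XJ)Y=(\nabla_YJ)X$ for all $X,Y$, and a $\nabla$-parallel symplectic form $\omega$. $\omega=\omega^{11}+\omega^{20}+\omega^{02}$ is the Hodge decomposition with respect to $J$. Let $\pi:N=T^*M\to M$. The connection $\nabla$ defines a decomposition $T_\xi N=\mathcal{H}^\nabla_\xi\oplus T^v_\xi N\cong T_pM\oplus T^*_pM$, $\xi\in N$, $p=\pi(\xi)$, where $T^v_\xi N$ is the vertical subspace, naturally identified with $T^*_pM$, and $\mathcal{H}^\nabla_\xi$ is the horizontal subspace defined by $\nabla$, identified with $T_pM$ via $d\pi$. All block matrices are with respect to this decomposition. $J^*$ is the dual map, $J^*\xi=\xi\circ J$. Bilinear forms such as $\omega,\omega^{11},\omega'$ are considered as maps $TM\to T^*M$, and $\omega^{-1}:T^*M\to TM$ is the inverse map, regarded also as a bivector; $(\omega^{-1})^{11}$ denotes its $(1,1)$-part and $(\omega^{-1})'$ its $(2,0)+(0,2)$-part with respect to $J$. *)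

theory Defs
  imports "HOL-Analysis.Analysis" "HOL-Library.Function_Algebras"
begin

section \<open>Functions as real vectors\<close>

instantiation "fun" :: (type, scaleR) scaleR
begin
definition "r *\<^sub>R f = (\<lambda>x. r *\<^sub>R f x)"
instance ..
end

lemma scaleR_fun_apply [simp]: "(r *\<^sub>R f) x = r *\<^sub>R f x"
  by (simp add: scaleR_fun_def)

instance "fun" :: (type, real_vector) real_vector
  by standard (simp_all add: fun_eq_iff scaleR_right_distrib scaleR_left_distrib)

definition linear_between :: "'v::real_vector set \<Rightarrow> 'w::real_vector set \<Rightarrow> ('v \<Rightarrow> 'w) \<Rightarrow> bool" where
  "linear_between V W f \<longleftrightarrow>
     (\<forall>v\<in>V. f v \<in> W) \<and>
     (\<forall>v\<in>V. \<forall>w\<in>V. f (v + w) = f v + f w) \<and>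
     (\<forall>r. \<forall>v\<in>V. f (r *\<^sub>R v) = r *\<^sub>R f v)"


section \<open>Smooth manifolds\<close>

primrec Ck_on :: "nat \<Rightarrow> 'e::real_normed_vector set \<Rightarrow> ('e \<Rightarrow> 'f::real_normed_vector) \<Rightarrow> bool" where
  "Ck_on 0 S f \<longleftrightarrow> continuous_on S f"
| "Ck_on (Suc k) S f \<longleftrightarrow>
     (\<forall>x\<in>S. f differentiable (at x)) \<and> (\<forall>v. Ck_on k S (\<lambda>x. frechet_derivative f (at x) v))"

text \<open>Only used for open subsets of finite-dimensional spaces.\<close>
definition smooth_on :: "'e::real_normed_vector set \<Rightarrow> ('e \<Rightarrow> 'f::real_normed_vector) \<Rightarrow> bool" where
  "smooth_on S f \<longleftrightarrow> (\<forall>k. Ck_on k S f)"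

text \<open>A chart is a pair of its domain and its coordinate map; the values of the coordinate map
  outside the domain are irrelevant.\<close>
type_synonym ('a, 'e) chart = "'a set \<times> ('a \<Rightarrow> 'e)"

definition chart_inv :: "('a, 'e) chart \<Rightarrow> 'e \<Rightarrow> 'a" where
  "chart_inv c = inv_into (fst c) (snd c)"

definition is_chart :: "('a, 'e::euclidean_space) chart \<Rightarrow> bool" where
  "is_chart c \<longleftrightarrow> inj_on (snd c) (fst c) \<and> open (snd c ` fst c)"

definition smooth_change :: "('a, 'e::euclidean_space) chart \<Rightarrow> ('a, 'e) chart \<Rightarrow> bool" where
  "smooth_change c d \<longleftrightarrow>
     open (snd c ` (fst c \<inter> fst d)) \<and>
     smooth_on (snd c ` (fst c \<inter> fst d)) (snd d \<circ> chart_inv c)"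

definition compatible :: "('a, 'e::euclidean_space) chart \<Rightarrow> ('a, 'e) chart \<Rightarrow> bool" where
  "compatible c d \<longleftrightarrow> smooth_change c d \<and> smooth_change d c"

definition mcarrier :: "('a, 'e) chart set \<Rightarrow> 'a set" where
  "mcarrier A = \<Union> (fst ` A)"

definition smooth_atlas :: "('a, 'e::euclidean_space) chart set \<Rightarrow> bool" where
  "smooth_atlas A \<longleftrightarrow> (\<forall>c\<in>A. is_chart c) \<and> (\<forall>c\<in>A. \<forall>d\<in>A. compatible c d)"

definition manifold_topology :: "('a, 'e::euclidean_space) chart set \<Rightarrow> 'a topology" where
  "manifold_topology A =
     topology (\<lambda>W. W \<subseteq> mcarrier A \<and> (\<forall>c\<in>A. open (snd c ` (W \<inter> fst c))))"

definition smooth_manifold :: "('a, 'e::euclidean_space) chart set \<Rightarrow> bool" where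
  "smooth_manifold A \<longleftrightarrow>
     smooth_atlas A \<and> Hausdorff_space (manifold_topology A) \<and> second_countable (manifold_topology A)"

definition max_atlas :: "('a, 'e::euclidean_space) chart set \<Rightarrow> ('a, 'e) chart set" where
  "max_atlas A = {c. is_chart c \<and> fst c \<subseteq> mcarrier A \<and> (\<forall>d\<in>A. compatible c d)}"

definition charts_at :: "('a, 'e::euclidean_space) chart set \<Rightarrow> 'a \<Rightarrow> ('a, 'e) chart set" where
  "charts_at A p = {c \<in> max_atlas A. p \<in> fst c}"

text \<open>Used to evaluate expressions that do not depend on the chart.\<close>
definition some_chart :: "('a, 'e::euclidean_space) chart set \<Rightarrow> 'a \<Rightarrow> ('a, 'e) chart" where
  "some_chart A p = (SOME c. c \<in> charts_at A p)"


section \<open>Tangent and cotangent vectors\<close>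

text \<open>A tangent vector at a point is the family of its coordinate vectors with respect to all
  smooth charts around that point, related by the derivatives of the coordinate changes and
  extended by zero to all other charts. Hence \<open>v c\<close> is the value on \<open>v\<close> of the differential of
  the coordinate map of \<open>c\<close>.\<close>
type_synonym ('a, 'e) tvec = "('a, 'e) chart \<Rightarrow> 'e"

definition tangent_space :: "('a, 'e::euclidean_space) chart set \<Rightarrow> 'a \<Rightarrow> ('a, 'e) tvec set" where
  "tangent_space A p = {v.
     (\<forall>c. c \<notin> charts_at A p \<longrightarrow> v c = 0) \<and>
     (\<forall>c\<in>charts_at A p. \<forall>d\<in>charts_at A p.
        v d = frechet_derivative (snd d \<circ> chart_inv c) (at (snd c p)) (v c))}"

text \<open>Linear forms on the tangent space, extended by zero to vectors based elsewhere.\<close>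
type_synonym ('a, 'e) covec = "('a, 'e) tvec \<Rightarrow> real"

definition cotangent_space :: "('a, 'e::euclidean_space) chart set \<Rightarrow> 'a \<Rightarrow> ('a, 'e) covec set" where
  "cotangent_space A p = {\<xi>.
     linear_between (tangent_space A p) UNIV \<xi> \<and> (\<forall>v. v \<notin> tangent_space A p \<longrightarrow> \<xi> v = 0)}"

definition differential ::
  "('a, 'e::euclidean_space) chart set \<Rightarrow> ('b, 'f::euclidean_space) chart set \<Rightarrow>
   ('a \<Rightarrow> 'b) \<Rightarrow> 'a \<Rightarrow> ('a, 'e) tvec \<Rightarrow> ('b, 'f) tvec" where
  "differential A B F p v = (\<lambda>d.
     if d \<in> charts_at B (F p)
     then let c = some_chart A p
          in frechet_derivative (snd d \<circ> F \<circ> chart_inv c) (at (snd c p)) (v c)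
     else 0)"

definition velocity ::
  "('a, 'e::euclidean_space) chart set \<Rightarrow> (real \<Rightarrow> 'a) \<Rightarrow> real \<Rightarrow> ('a, 'e) tvec" where
  "velocity A \<gamma> t = (\<lambda>c.
     if c \<in> charts_at A (\<gamma> t) then vector_derivative (snd c \<circ> \<gamma>) (at t) else 0)"

text \<open>Derivative of a function along a tangent vector.\<close>
definition dir_deriv ::
  "('a, 'e::euclidean_space) chart set \<Rightarrow> 'a \<Rightarrow> ('a, 'e) tvec \<Rightarrow> ('a \<Rightarrow> real) \<Rightarrow> real" where
  "dir_deriv A p v f =
     (let c = some_chart A p in frechet_derivative (f \<circ> chart_inv c) (at (snd c p)) (v c))"

text \<open>The tangent vector at \<open>p\<close> whose coordinate vector in the chart \<open>c\<close> is \<open>a\<close>.\<close>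
definition coord_tvec ::
  "('a, 'e::euclidean_space) chart set \<Rightarrow> ('a, 'e) chart \<Rightarrow> 'a \<Rightarrow> 'e \<Rightarrow> ('a, 'e) tvec" where
  "coord_tvec A c p a = (\<lambda>d.
     if d \<in> charts_at A p then frechet_derivative (snd d \<circ> chart_inv c) (at (snd c p)) a else 0)"

text \<open>Components of a covector with respect to the coordinate differentials of \<open>c\<close>.\<close>
definition covec_coords ::
  "('a, 'e::euclidean_space) chart set \<Rightarrow> ('a, 'e) chart \<Rightarrow> 'a \<Rightarrow> ('a, 'e) covec \<Rightarrow> 'e" where
  "covec_coords A c p \<xi> = (\<Sum>b\<in>Basis. \<xi> (coord_tvec A c p b) *\<^sub>R b)"


section \<open>Smooth fields on open subsets\<close>

text \<open>Fields are total functions of which only the values on an open set \<open>U\<close> matter.\<close>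

definition smooth_fun ::
  "('a, 'e::euclidean_space) chart set \<Rightarrow> 'a set \<Rightarrow> ('a \<Rightarrow> real) \<Rightarrow> bool" where
  "smooth_fun A U f \<longleftrightarrow> (\<forall>c\<in>A. smooth_on (snd c ` (U \<inter> fst c)) (f \<circ> chart_inv c))"

type_synonym ('a, 'e) vfield = "'a \<Rightarrow> ('a, 'e) tvec"

definition smooth_vfield ::
  "('a, 'e::euclidean_space) chart set \<Rightarrow> 'a set \<Rightarrow> ('a, 'e) vfield \<Rightarrow> bool" where
  "smooth_vfield A U X \<longleftrightarrow>
     (\<forall>p\<in>U. X p \<in> tangent_space A p) \<and>
     (\<forall>c\<in>A. smooth_on (snd c ` (U \<inter> fst c)) (\<lambda>x. X (chart_inv c x) c))"

definition smooth_1form ::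
  "('a, 'e::euclidean_space) chart set \<Rightarrow> 'a set \<Rightarrow> ('a \<Rightarrow> ('a, 'e) covec) \<Rightarrow> bool" where
  "smooth_1form A U \<alpha> \<longleftrightarrow>
     (\<forall>p\<in>U. \<alpha> p \<in> cotangent_space A p) \<and>
     (\<forall>c\<in>A. smooth_on (snd c ` (U \<inter> fst c))
               (\<lambda>x. covec_coords A c (chart_inv c x) (\<alpha> (chart_inv c x))))"

definition lie_bracket ::
  "('a, 'e::euclidean_space) chart set \<Rightarrow> ('a, 'e) vfield \<Rightarrow> ('a, 'e) vfield \<Rightarrow> ('a, 'e) vfield" where
  "lie_bracket A X Y p = (\<lambda>c.
     if c \<in> charts_at A p
     then frechet_derivative (\<lambda>x. Y (chart_inv c x) c) (at (snd c p)) (X p c)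
        - frechet_derivative (\<lambda>x. X (chart_inv c x) c) (at (snd c p)) (Y p c)
     else 0)"


section \<open>Complex manifolds\<close>

definition almost_complex ::
  "('a, 'e::euclidean_space) chart set \<Rightarrow> ('a \<Rightarrow> ('a, 'e) tvec \<Rightarrow> ('a, 'e) tvec) \<Rightarrow> bool" where
  "almost_complex A J \<longleftrightarrow>
     (\<forall>p\<in>mcarrier A. linear_between (tangent_space A p) (tangent_space A p) (J p) \<and>
        (\<forall>v\<in>tangent_space A p. J p (J p v) = - v)) \<and>
     (\<forall>U X. openin (manifold_topology A) U \<longrightarrow> smooth_vfield A U X \<longrightarrow>
        smooth_vfield A U (\<lambda>p. J p (X p)))"

text \<open>Existence of holomorphic coordinates around every point. The parameter \<open>\<i>\<^sub>0\<close> is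
  multiplication by the imaginary unit on the model space.\<close>
definition integrable_structure ::
  "('e \<Rightarrow> 'e) \<Rightarrow> ('a, 'e::euclidean_space) chart set \<Rightarrow>
   ('a \<Rightarrow> ('a, 'e) tvec \<Rightarrow> ('a, 'e) tvec) \<Rightarrow> bool" where
  "integrable_structure \<i>\<^sub>0 A J \<longleftrightarrow>
     (\<forall>p\<in>mcarrier A. \<exists>c\<in>charts_at A p.
        \<forall>q\<in>fst c. \<forall>v\<in>tangent_space A q. J q v c = \<i>\<^sub>0 (v c))"

definition complex_manifold ::
  "('e \<Rightarrow> 'e) \<Rightarrow> ('a, 'e::euclidean_space) chart set \<Rightarrow>
   ('a \<Rightarrow> ('a, 'e) tvec \<Rightarrow> ('a, 'e) tvec) \<Rightarrow> bool" where
  "complex_manifold \<i>\<^sub>0 A J \<longleftrightarrow>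
     smooth_manifold A \<and> almost_complex A J \<and> integrable_structure \<i>\<^sub>0 A J"

definition imult :: "complex^'m::finite \<Rightarrow> complex^'m" where
  "imult z = \<i> *s z"

definition imult2 :: "(complex^'m::finite) \<times> (complex^'m) \<Rightarrow> (complex^'m) \<times> (complex^'m)" where
  "imult2 = (\<lambda>(z, w). (\<i> *s z, \<i> *s w))"


section \<open>Connections\<close>

text \<open>\<open>nabla X Y\<close> is the covariant derivative of \<open>Y\<close> along \<open>X\<close>. A connection acts on vector fields
  over arbitrary open subsets, compatibly with restriction (the second condition).\<close>
definition connection ::
  "('a, 'e::euclidean_space) chart set \<Rightarrow>
   (('a, 'e) vfield \<Rightarrow> ('a, 'e) vfield \<Rightarrow> ('a, 'e) vfield) \<Rightarrow> bool" where
  "connection A nabla \<longleftrightarrow>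
     (\<forall>U X Y. openin (manifold_topology A) U \<longrightarrow> smooth_vfield A U X \<longrightarrow> smooth_vfield A U Y \<longrightarrow>
        smooth_vfield A U (nabla X Y) \<and>
        (\<forall>X' Y'. smooth_vfield A U X' \<longrightarrow> smooth_vfield A U Y' \<longrightarrow>
           (\<forall>p\<in>U. X' p = X p \<and> Y' p = Y p) \<longrightarrow> (\<forall>p\<in>U. nabla X' Y' p = nabla X Y p)) \<and>
        (\<forall>X'. smooth_vfield A U X' \<longrightarrow>
           (\<forall>p\<in>U. nabla (\<lambda>q. X q + X' q) Y p = nabla X Y p + nabla X' Y p)) \<and>
        (\<forall>Y'. smooth_vfield A U Y' \<longrightarrow>
           (\<forall>p\<in>U. nabla X (\<lambda>q. Y q + Y' q) p = nabla X Y p + nabla X Y' p)) \<and>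
        (\<forall>f. smooth_fun A U f \<longrightarrow>
           (\<forall>p\<in>U. nabla (\<lambda>q. f q *\<^sub>R X q) Y p = f p *\<^sub>R nabla X Y p \<and>
                  nabla X (\<lambda>q. f q *\<^sub>R Y q) p = dir_deriv A p (X p) f *\<^sub>R Y p + f p *\<^sub>R nabla X Y p)))"

definition torsion_free ::
  "('a, 'e::euclidean_space) chart set \<Rightarrow>
   (('a, 'e) vfield \<Rightarrow> ('a, 'e) vfield \<Rightarrow> ('a, 'e) vfield) \<Rightarrow> bool" where
  "torsion_free A nabla \<longleftrightarrow>
     (\<forall>U X Y. openin (manifold_topology A) U \<longrightarrow> smooth_vfield A U X \<longrightarrow> smooth_vfield A U Y \<longrightarrow>
        (\<forall>p\<in>U. nabla X Y p - nabla Y X p - lie_bracket A X Y p = 0))"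

definition flat ::
  "('a, 'e::euclidean_space) chart set \<Rightarrow>
   (('a, 'e) vfield \<Rightarrow> ('a, 'e) vfield \<Rightarrow> ('a, 'e) vfield) \<Rightarrow> bool" where
  "flat A nabla \<longleftrightarrow>
     (\<forall>U X Y Z. openin (manifold_topology A) U \<longrightarrow>
        smooth_vfield A U X \<longrightarrow> smooth_vfield A U Y \<longrightarrow> smooth_vfield A U Z \<longrightarrow>
        (\<forall>p\<in>U. nabla X (nabla Y Z) p - nabla Y (nabla X Z) p - nabla (lie_bracket A X Y) Z p = 0))"

text \<open>\<open>(\<nabla>\<^sub>X J) Y\<close>\<close>
definition nabla_endo ::
  "(('a, 'e::euclidean_space) vfield \<Rightarrow> ('a, 'e) vfield \<Rightarrow> ('a, 'e) vfield) \<Rightarrow>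
   ('a \<Rightarrow> ('a, 'e) tvec \<Rightarrow> ('a, 'e) tvec) \<Rightarrow> ('a, 'e) vfield \<Rightarrow> ('a, 'e) vfield \<Rightarrow> ('a, 'e) vfield" where
  "nabla_endo nabla J X Y p = nabla X (\<lambda>q. J q (Y q)) p - J p (nabla X Y p)"

definition special_endo ::
  "('a, 'e::euclidean_space) chart set \<Rightarrow>
   (('a, 'e) vfield \<Rightarrow> ('a, 'e) vfield \<Rightarrow> ('a, 'e) vfield) \<Rightarrow>
   ('a \<Rightarrow> ('a, 'e) tvec \<Rightarrow> ('a, 'e) tvec) \<Rightarrow> bool" where
  "special_endo A nabla J \<longleftrightarrow>
     (\<forall>U X Y. openin (manifold_topology A) U \<longrightarrow> smooth_vfield A U X \<longrightarrow> smooth_vfield A U Y \<longrightarrow>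
        (\<forall>p\<in>U. nabla_endo nabla J X Y p = nabla_endo nabla J Y X p))"


section \<open>Symplectic forms and special symplectic manifolds\<close>

definition symplectic_form ::
  "('a, 'e::euclidean_space) chart set \<Rightarrow> ('a \<Rightarrow> ('a, 'e) tvec \<Rightarrow> ('a, 'e) tvec \<Rightarrow> real) \<Rightarrow> bool" where
  "symplectic_form A \<omega> \<longleftrightarrow>
     (\<forall>p\<in>mcarrier A.
        (\<forall>v\<in>tangent_space A p. linear_between (tangent_space A p) UNIV (\<omega> p v)) \<and>
        (\<forall>v\<in>tangent_space A p. \<forall>w\<in>tangent_space A p. \<omega> p v w = - \<omega> p w v) \<and>
        (\<forall>v\<in>tangent_space A p. (\<forall>w\<in>tangent_space A p. \<omega> p v w = 0) \<longrightarrow> v = 0)) \<and>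
     (\<forall>U X Y. openin (manifold_topology A) U \<longrightarrow> smooth_vfield A U X \<longrightarrow> smooth_vfield A U Y \<longrightarrow>
        smooth_fun A U (\<lambda>p. \<omega> p (X p) (Y p))) \<and>
     (\<forall>U X Y Z. openin (manifold_topology A) U \<longrightarrow>
        smooth_vfield A U X \<longrightarrow> smooth_vfield A U Y \<longrightarrow> smooth_vfield A U Z \<longrightarrow>
        (\<forall>p\<in>U. dir_deriv A p (X p) (\<lambda>q. \<omega> q (Y q) (Z q))
              - dir_deriv A p (Y p) (\<lambda>q. \<omega> q (X q) (Z q))
              + dir_deriv A p (Z p) (\<lambda>q. \<omega> q (X q) (Y q))
              - \<omega> p (lie_bracket A X Y p) (Z p)
              + \<omega> p (lie_bracket A X Z p) (Y p)
              - \<omega> p (lie_bracket A Y Z p) (X p) = 0))"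

definition parallel_form ::
  "('a, 'e::euclidean_space) chart set \<Rightarrow>
   (('a, 'e) vfield \<Rightarrow> ('a, 'e) vfield \<Rightarrow> ('a, 'e) vfield) \<Rightarrow>
   ('a \<Rightarrow> ('a, 'e) tvec \<Rightarrow> ('a, 'e) tvec \<Rightarrow> real) \<Rightarrow> bool" where
  "parallel_form A nabla \<omega> \<longleftrightarrow>
     (\<forall>U X Y Z. openin (manifold_topology A) U \<longrightarrow>
        smooth_vfield A U X \<longrightarrow> smooth_vfield A U Y \<longrightarrow> smooth_vfield A U Z \<longrightarrow>
        (\<forall>p\<in>U. dir_deriv A p (X p) (\<lambda>q. \<omega> q (Y q) (Z q))
               - \<omega> p (nabla X Y p) (Z p) - \<omega> p (Y p) (nabla X Z p) = 0))"

definition special_symplectic_manifold ::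
  "('a, complex^'m::finite) chart set \<Rightarrow>
   ('a \<Rightarrow> ('a, complex^'m) tvec \<Rightarrow> ('a, complex^'m) tvec) \<Rightarrow>
   (('a, complex^'m) vfield \<Rightarrow> ('a, complex^'m) vfield \<Rightarrow> ('a, complex^'m) vfield) \<Rightarrow>
   ('a \<Rightarrow> ('a, complex^'m) tvec \<Rightarrow> ('a, complex^'m) tvec \<Rightarrow> real) \<Rightarrow> bool" where
  "special_symplectic_manifold A J nabla \<omega> \<longleftrightarrow>
     complex_manifold imult A J \<and>
     connection A nabla \<and> flat A nabla \<and> torsion_free A nabla \<and>
     special_endo A nabla J \<and>
     symplectic_form A \<omega> \<and> parallel_form A nabla \<omega>"


section \<open>The cotangent bundle and its decomposition\<close>

text \<open>The charts induced by those of the base: \<open>(p, \<xi>)\<close> is mapped to the coordinates of \<open>p\<close> and the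
  components of \<open>\<xi>\<close>.\<close>
definition cotangent_atlas ::
  "('a, 'e::euclidean_space) chart set \<Rightarrow> ('a \<times> ('a, 'e) covec, 'e \<times> 'e) chart set" where
  "cotangent_atlas A =
     (\<lambda>c. ({(p, \<xi>). p \<in> fst c \<and> \<xi> \<in> cotangent_space A p},
          \<lambda>(p, \<xi>). (snd c p, covec_coords A c p \<xi>))) ` A"

text \<open>\<open>(\<nabla>\<^sub>X \<alpha>)\<close> vanishes at \<open>p\<close>, where \<open>(\<nabla>\<^sub>X \<alpha>) Y = X (\<alpha> Y) - \<alpha> (\<nabla>\<^sub>X Y)\<close>.\<close>
definition parallel_at ::
  "('a, 'e::euclidean_space) chart set \<Rightarrow>
   (('a, 'e) vfield \<Rightarrow> ('a, 'e) vfield \<Rightarrow> ('a, 'e) vfield) \<Rightarrow>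
   'a \<Rightarrow> ('a, 'e) vfield \<Rightarrow> ('a \<Rightarrow> ('a, 'e) covec) \<Rightarrow> bool" where
  "parallel_at A nabla p X \<alpha> \<longleftrightarrow>
     (\<forall>U Y. openin (manifold_topology A) U \<longrightarrow> p \<in> U \<longrightarrow> smooth_vfield A U Y \<longrightarrow>
        dir_deriv A p (X p) (\<lambda>q. \<alpha> q (Y q)) - \<alpha> p (nabla X Y p) = 0)"

text \<open>The horizontal subspace at \<open>\<xi>\<close> consists of the derivatives, in directions \<open>X p\<close>, of local
  sections \<open>\<alpha>\<close> of the cotangent bundle through \<open>\<xi>\<close> that are parallel at \<open>p\<close> in that direction.\<close>
definition horizontal_space ::
  "('a, 'e::euclidean_space) chart set \<Rightarrow>
   (('a, 'e) vfield \<Rightarrow> ('a, 'e) vfield \<Rightarrow> ('a, 'e) vfield) \<Rightarrow>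
   'a \<times> ('a, 'e) covec \<Rightarrow> ('a \<times> ('a, 'e) covec, 'e \<times> 'e) tvec set" where
  "horizontal_space A nabla x =
     {differential A (cotangent_atlas A) (\<lambda>q. (q, \<alpha> q)) (fst x) (X (fst x)) | X \<alpha>.
        \<exists>U. openin (manifold_topology A) U \<and> fst x \<in> U \<and> smooth_vfield A U X \<and>
            smooth_1form A U \<alpha> \<and> \<alpha> (fst x) = snd x \<and> parallel_at A nabla (fst x) X \<alpha>}"

abbreviation d_proj ::
  "('a, 'e::euclidean_space) chart set \<Rightarrow> 'a \<times> ('a, 'e) covec \<Rightarrow>
   ('a \<times> ('a, 'e) covec, 'e \<times> 'e) tvec \<Rightarrow> ('a, 'e) tvec" where
  "d_proj A x \<equiv> differential (cotangent_atlas A) A fst x"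

definition horizontal_lift ::
  "('a, 'e::euclidean_space) chart set \<Rightarrow>
   (('a, 'e) vfield \<Rightarrow> ('a, 'e) vfield \<Rightarrow> ('a, 'e) vfield) \<Rightarrow>
   'a \<times> ('a, 'e) covec \<Rightarrow> ('a, 'e) tvec \<Rightarrow> ('a \<times> ('a, 'e) covec, 'e \<times> 'e) tvec" where
  "horizontal_lift A nabla x v = (THE w. w \<in> horizontal_space A nabla x \<and> d_proj A x w = v)"

definition vertical_lift ::
  "('a, 'e::euclidean_space) chart set \<Rightarrow>
   'a \<times> ('a, 'e) covec \<Rightarrow> ('a, 'e) covec \<Rightarrow> ('a \<times> ('a, 'e) covec, 'e \<times> 'e) tvec" where
  "vertical_lift A x \<eta> = velocity (cotangent_atlas A) (\<lambda>t. (fst x, snd x + t *\<^sub>R \<eta>)) 0"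

definition vertical_part ::
  "('a, 'e::euclidean_space) chart set \<Rightarrow>
   (('a, 'e) vfield \<Rightarrow> ('a, 'e) vfield \<Rightarrow> ('a, 'e) vfield) \<Rightarrow>
   'a \<times> ('a, 'e) covec \<Rightarrow> ('a \<times> ('a, 'e) covec, 'e \<times> 'e) tvec \<Rightarrow> ('a, 'e) covec" where
  "vertical_part A nabla x w =
     (THE \<eta>. \<eta> \<in> cotangent_space A (fst x) \<and>
             vertical_lift A x \<eta> = w - horizontal_lift A nabla x (d_proj A x w))"

text \<open>The endomorphism of the tangent space at \<open>x\<close> with block matrix \<open>(a, b; c, d)\<close>.\<close>
definition block_op ::
  "('a, 'e::euclidean_space) chart set \<Rightarrow>
   (('a, 'e) vfield \<Rightarrow> ('a, 'e) vfield \<Rightarrow> ('a, 'e) vfield) \<Rightarrow>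
   'a \<times> ('a, 'e) covec \<Rightarrow>
   (('a, 'e) tvec \<Rightarrow> ('a, 'e) tvec) \<Rightarrow> (('a, 'e) covec \<Rightarrow> ('a, 'e) tvec) \<Rightarrow>
   (('a, 'e) tvec \<Rightarrow> ('a, 'e) covec) \<Rightarrow> (('a, 'e) covec \<Rightarrow> ('a, 'e) covec) \<Rightarrow>
   ('a \<times> ('a, 'e) covec, 'e \<times> 'e) tvec \<Rightarrow> ('a \<times> ('a, 'e) covec, 'e \<times> 'e) tvec" where
  "block_op A nabla x a b c d w =
     (let v = d_proj A x w; \<eta> = vertical_part A nabla x w
      in horizontal_lift A nabla x (a v + b \<eta>) + vertical_lift A x (c v + d \<eta>))"


section \<open>Bilinear forms as maps, and types with respect to a complex structure\<close>

definition dual_map ::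
  "('a, 'e::euclidean_space) chart set \<Rightarrow> 'a \<Rightarrow> (('a, 'e) tvec \<Rightarrow> ('a, 'e) tvec) \<Rightarrow>
   ('a, 'e) covec \<Rightarrow> ('a, 'e) covec" where
  "dual_map A p K \<xi> = (\<lambda>v. if v \<in> tangent_space A p then \<xi> (K v) else 0)"

definition form_map ::
  "('a, 'e::euclidean_space) chart set \<Rightarrow> 'a \<Rightarrow> (('a, 'e) tvec \<Rightarrow> ('a, 'e) tvec \<Rightarrow> real) \<Rightarrow>
   ('a, 'e) tvec \<Rightarrow> ('a, 'e) covec" where
  "form_map A p B v = (\<lambda>w. if w \<in> tangent_space A p then B v w else 0)"

definition form_inverse ::
  "('a, 'e::euclidean_space) chart set \<Rightarrow> 'a \<Rightarrow> (('a, 'e) tvec \<Rightarrow> ('a, 'e) tvec \<Rightarrow> real) \<Rightarrow>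
   ('a, 'e) covec \<Rightarrow> ('a, 'e) tvec" where
  "form_inverse A p B \<xi> = (THE v. v \<in> tangent_space A p \<and> form_map A p B v = \<xi>)"

definition bivector_of_map ::
  "(('a, 'e) covec \<Rightarrow> ('a, 'e) tvec) \<Rightarrow> ('a, 'e) covec \<Rightarrow> ('a, 'e) covec \<Rightarrow> real" where
  "bivector_of_map T \<xi> \<eta> = \<eta> (T \<xi>)"

definition map_of_bivector ::
  "('a, 'e::euclidean_space) chart set \<Rightarrow> 'a \<Rightarrow> (('a, 'e) covec \<Rightarrow> ('a, 'e) covec \<Rightarrow> real) \<Rightarrow>
   ('a, 'e) covec \<Rightarrow> ('a, 'e) tvec" where
  "map_of_bivector A p P \<xi> =
     (THE v. v \<in> tangent_space A p \<and> (\<forall>\<eta>\<in>cotangent_space A p. \<eta> v = P \<xi> \<eta>))"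

text \<open>A pair \<open>(v, w)\<close> stands for the element \<open>v + \<i> w\<close> of the complexification; \<open>complexify B\<close> is the
  complex bilinear extension of \<open>B\<close>, and \<open>type10\<close>, \<open>type01\<close> are the projections of a real vector to
  the eigenspaces of \<open>I\<close> for \<open>\<i>\<close> and \<open>-\<i>\<close>.\<close>
definition complexify :: "('v \<Rightarrow> 'v \<Rightarrow> real) \<Rightarrow> 'v \<times> 'v \<Rightarrow> 'v \<times> 'v \<Rightarrow> complex" where
  "complexify B z w =
     Complex (B (fst z) (fst w) - B (snd z) (snd w)) (B (fst z) (snd w) + B (snd z) (fst w))"

definition type10 :: "('v::real_vector \<Rightarrow> 'v) \<Rightarrow> 'v \<Rightarrow> 'v \<times> 'v" where
  "type10 I v = ((1/2) *\<^sub>R v, - ((1/2) *\<^sub>R I v))"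

definition type01 :: "('v::real_vector \<Rightarrow> 'v) \<Rightarrow> 'v \<Rightarrow> 'v \<times> 'v" where
  "type01 I v = ((1/2) *\<^sub>R v, (1/2) *\<^sub>R I v)"

definition part20 :: "('v::real_vector \<Rightarrow> 'v) \<Rightarrow> ('v \<Rightarrow> 'v \<Rightarrow> real) \<Rightarrow> 'v \<Rightarrow> 'v \<Rightarrow> complex" where
  "part20 I B v w = complexify B (type10 I v) (type10 I w)"

definition part02 :: "('v::real_vector \<Rightarrow> 'v) \<Rightarrow> ('v \<Rightarrow> 'v \<Rightarrow> real) \<Rightarrow> 'v \<Rightarrow> 'v \<Rightarrow> complex" where
  "part02 I B v w = complexify B (type01 I v) (type01 I w)"

definition part11 :: "('v::real_vector \<Rightarrow> 'v) \<Rightarrow> ('v \<Rightarrow> 'v \<Rightarrow> real) \<Rightarrow> 'v \<Rightarrow> 'v \<Rightarrow> complex" where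
  "part11 I B v w =
     complexify B (type10 I v) (type01 I w) + complexify B (type01 I v) (type10 I w)"

text \<open>The \<open>(1,1)\<close>-part and the \<open>(2,0) + (0,2)\<close>-part of a real form take real values on real vectors.\<close>
definition form11 :: "('v::real_vector \<Rightarrow> 'v) \<Rightarrow> ('v \<Rightarrow> 'v \<Rightarrow> real) \<Rightarrow> 'v \<Rightarrow> 'v \<Rightarrow> real" where
  "form11 I B v w = Re (part11 I B v w)"

definition form' :: "('v::real_vector \<Rightarrow> 'v) \<Rightarrow> ('v \<Rightarrow> 'v \<Rightarrow> real) \<Rightarrow> 'v \<Rightarrow> 'v \<Rightarrow> real" where
  "form' I B v w = Re (part20 I B v w + part02 I B v w)"


section \<open>The structures on the cotangent bundle\<close>

definition J_nabla where
  "J_nabla A J nabla x =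
     block_op A nabla x (J (fst x)) (\<lambda>_. 0) (\<lambda>_. 0) (dual_map A (fst x) (J (fst x)))"

definition J_omega where
  "J_omega A nabla \<omega> x =
     block_op A nabla x
       (\<lambda>_. 0) (\<lambda>\<xi>. - form_inverse A (fst x) (\<omega> (fst x)) \<xi>)
       (form_map A (fst x) (\<omega> (fst x))) (\<lambda>_. 0)"

text \<open>The operator \<open>(0, -(\<omega>\<^sup>-\<^sup>1)\<^sup>1\<^sup>1; \<omega>\<^sup>1\<^sup>1, 0)\<close>. Bivectors are bilinear forms on covectors, so their types
  are taken with respect to the dual of \<open>J\<close>.\<close>
definition block_omega11 where
  "block_omega11 A J nabla \<omega> x =
     (let p = fst x in
      block_op A nabla x
        (\<lambda>_. 0)
        (\<lambda>\<xi>. - map_of_bivector A p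
                 (form11 (dual_map A p (J p)) (bivector_of_map (form_inverse A p (\<omega> p)))) \<xi>)
        (form_map A p (form11 (J p) (\<omega> p)))
        (\<lambda>_. 0))"

definition block_omega' where
  "block_omega' A J nabla \<omega> x =
     (let p = fst x in
      block_op A nabla x
        (\<lambda>_. 0)
        (\<lambda>\<xi>. - map_of_bivector A p
                 (form' (dual_map A p (J p)) (bivector_of_map (form_inverse A p (\<omega> p)))) \<xi>)
        (form_map A p (form' (J p) (\<omega> p)))
        (\<lambda>_. 0))"

end

theory Submission
  imports Defs
begin

text \<open>In the chart of \<open>T*M\<close> induced by a chart of \<open>M\<close> with Christoffel symbols \<open>\<Gamma>\<close>, the horizontal lift of
  \<open>v\<close> to \<open>(x, \<xi>)\<close> is \<open>(v, \<xi> \<circ> \<Gamma>(v, -))\<close>. In a holomorphic chart, vanishing torsion and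
  \<open>d\<^sup>\<nabla>J = 0\<close> give \<open>\<Gamma>(\<i>v, w) = \<Gamma>(v, \<i>w)\<close>, which says that \<open>J\<^sub>1\<close> is the standard complex structure of
  the cotangent bundle; so holomorphic charts of \<open>M\<close> induce holomorphic charts of \<open>(T*M, J\<^sub>1)\<close>. In
  \<open>\<nabla>\<close>-affine coordinates \<open>\<Gamma> = 0\<close> and \<open>\<omega>\<close> is constant, so \<open>J\<^sub>2\<close> has constant coefficients and becomes
  multiplication by \<open>\<i>\<close> after a linear change of the induced coordinates. Affine coordinates exist
  because the linear systems for parallel vector fields and for functions with parallel differential are
  flat; such a system is solved by Picard iteration along rays, and flatness shows that the solution
  satisfies the equations in the other directions as well. The commutator relations are identities of
  block matrices.\<close>

section \<open>Calculus of smooth maps\<close>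

text \<open>Both structures are brought to constant coefficients in charts of the maximal atlas of
  the bundle; this single fact yields linearity, square -1, smoothness and integrability together.
  The two structures call for different charts: in a holomorphic chart the matrix of \<omega> varies
  in general, in an affine chart \<open>J\<close> does. So induced charts of the bundle must be
  available for every chart in the maximal atlas of the base. Two linear systems are solved because
  coordinate functions alone leave the inverse coordinate change implicit. A parallel covector and a
  parallel field have constant pairing, so a parallel frame with dual initial values is the inverse
  Jacobian, and the new coordinate fields are parallel by construction. Existence is obtained on a
  ball of radius r with M r \<le> 1/4, where M bounds the coefficients and their derivatives. The
  iterates and their derivatives are then both dominated by geometric series, so the limit is
  continuously differentiable, and the defect in the remaining directions is removed by the same
  contraction. Smoothness of the solution is read off from the equation.\<close>

lemma has_derivative_cong_open:
  assumes "open S" "x \<in> S" "\<And>y. y \<in> S \<Longrightarrow> f y = g y"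
  shows "(f has_derivative D) (at x) \<longleftrightarrow> (g has_derivative D) (at x)"
  using has_derivative_transform_within_open[OF _ assms(1,2)] assms(3) by metis

lemma frechet_derivative_cong_open:
  assumes "open S" "x \<in> S" "\<And>y. y \<in> S \<Longrightarrow> f y = g y"
  shows "frechet_derivative f (at x) = frechet_derivative g (at x)"
  unfolding frechet_derivative_def using has_derivative_cong_open[OF assms] by simp

lemma has_derivative_frechet:
  "f differentiable (at x) \<Longrightarrow> (f has_derivative frechet_derivative f (at x)) (at x)"
  by (simp add: frechet_derivative_works)

lemma frechet_derivative_eqI:
  "(f has_derivative D) (at x) \<Longrightarrow> frechet_derivative f (at x) = D"
  using frechet_derivative_at by force

lemma Ck_on_cong:
  assumes "open S" "\<And>x. x \<in> S \<Longrightarrow> f x = g x"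
  shows "Ck_on k S f \<longleftrightarrow> Ck_on k S g"
  using assms(2)
proof (induction k arbitrary: f g)
  case 0
  then show ?case by (simp cong: continuous_on_cong)
next
  case (Suc k)
  have "f differentiable (at x) \<longleftrightarrow> g differentiable (at x)" if "x \<in> S" for x
    using has_derivative_cong_open[OF assms(1) that, of f g] Suc.prems
    by (auto simp: differentiable_def)
  moreover have "Ck_on k S (\<lambda>x. frechet_derivative f (at x) v) \<longleftrightarrow>
      Ck_on k S (\<lambda>x. frechet_derivative g (at x) v)" for v
    by (rule Suc.IH) (metis Suc.prems frechet_derivative_cong_open[OF assms(1)])
  ultimately show ?case by simp
qed

lemma Ck_on_eqI: "open S \<Longrightarrow> Ck_on k S g \<Longrightarrow> (\<And>x. x \<in> S \<Longrightarrow> f x = g x) \<Longrightarrow> Ck_on k S f"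
  using Ck_on_cong by blast

text \<open>Passes from an explicit formula for the derivative to the choice
  \<open>frechet_derivative\<close> used in \<open>Ck_on\<close>. Openness of \<open>S\<close>
  allows one to be replaced by the other under further differentiation.\<close>

lemma Ck_on_SucI:
  assumes "open S" "\<And>x. x \<in> S \<Longrightarrow> (f has_derivative f' x) (at x)"
    and "\<And>v. Ck_on k S (\<lambda>x. f' x v)"
  shows "Ck_on (Suc k) S f"
proof -
  have "Ck_on k S (\<lambda>x. frechet_derivative f (at x) v)" for v
    using assms(3)[of v] Ck_on_cong[OF assms(1), of "\<lambda>x. frechet_derivative f (at x) v" "\<lambda>x. f' x v" k]
    by (metis assms(2) frechet_derivative_eqI)
  with assms(2) show ?thesis by (auto simp: differentiable_def)
qed

lemma Ck_on_Suc_derivative: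
  assumes "Ck_on (Suc k) S f" "x \<in> S"
  shows "(f has_derivative frechet_derivative f (at x)) (at x)"
  using assms by (auto intro: has_derivative_frechet)

lemma Ck_on_SucD: "Ck_on (Suc k) S f \<Longrightarrow> Ck_on k S f"
proof (induction k arbitrary: f)
  case 0
  then have "f differentiable (at x)" if "x \<in> S" for x using that by simp
  then have "f differentiable_on S"
    using differentiable_at_withinI differentiable_on_def by blast
  then show ?case by (simp add: differentiable_imp_continuous_on)
next
  case (Suc k)
  then show ?case by simp
qed

lemma Ck_on_subset: "Ck_on k S f \<Longrightarrow> T \<subseteq> S \<Longrightarrow> Ck_on k T f"
  by (induction k arbitrary: f) (auto intro: continuous_on_subset)

lemma Ck_on_local:
  assumes "\<And>x. x \<in> S \<Longrightarrow> \<exists>T. open T \<and> x \<in> T \<and> Ck_on k T f"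
  shows "Ck_on k S f"
  using assms
proof (induction k arbitrary: f)
  case 0
  then show ?case
    by (auto intro!: continuous_at_imp_continuous_on) (metis continuous_on_eq_continuous_at)
next
  case (Suc k)
  have "f differentiable (at x)" if "x \<in> S" for x using Suc.prems[OF that] by auto
  moreover have "Ck_on k S (\<lambda>x. frechet_derivative f (at x) v)" for v
    by (rule Suc.IH) (use Suc.prems in fastforce)
  ultimately show ?case by simp
qed

lemma Ck_on_const: "open S \<Longrightarrow> Ck_on k S (\<lambda>x. c)"
proof (induction k arbitrary: c)
  case (Suc k)
  show ?case
    by (rule Ck_on_SucI[where f'="\<lambda>x v. 0"]) (use Suc in \<open>auto intro!: derivative_eq_intros\<close>)
qed simp

lemma Ck_on_add:
  assumes "open S"
  shows "Ck_on k S f \<Longrightarrow> Ck_on k S g \<Longrightarrow> Ck_on k S (\<lambda>x. f x + g x)"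
proof (induction k arbitrary: f g)
  case (Suc k)
  show ?case
    by (rule Ck_on_SucI[OF assms, where
          f'="\<lambda>x v. frechet_derivative f (at x) v + frechet_derivative g (at x) v"])
      (use Suc in \<open>auto intro!: has_derivative_add has_derivative_frechet\<close>)
qed (auto intro: continuous_on_add)

lemma Ck_on_bilinear:
  assumes "open S" "bounded_bilinear B"
  shows "Ck_on k S f \<Longrightarrow> Ck_on k S g \<Longrightarrow> Ck_on k S (\<lambda>x. B (f x) (g x))"
proof (induction k arbitrary: f g)
  case 0
  then show ?case using bounded_bilinear.continuous_on[OF assms(2)] by simp
next
  case (Suc k)
  note D = Ck_on_Suc_derivative[OF Suc.prems(1)] Ck_on_Suc_derivative[OF Suc.prems(2)]
  have "Ck_on k S (\<lambda>x. B (f x) (frechet_derivative g (at x) v) + B (frechet_derivative f (at x) v) (g x))" for v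
    by (intro Ck_on_add Suc.IH Ck_on_SucD[OF Suc.prems(1)] Ck_on_SucD[OF Suc.prems(2)] assms(1))
      (use Suc.prems in simp_all)
  then show ?case
    by (intro Ck_on_SucI[OF assms(1) bounded_bilinear.FDERIV[OF assms(2)]])
      (use D in auto)
qed

lemma Ck_on_linear:
  assumes "open S" "bounded_linear L" "Ck_on k S f"
  shows "Ck_on k S (\<lambda>x. L (f x))"
proof -
  \<comment> \<open>A linear map is the bilinear map (r, y) -> r L y with the first argument frozen
    at 1, so the product rule already covers it.\<close>
  have "bounded_bilinear (\<lambda>(r::real) y. r *\<^sub>R L y)"
    by (rule bounded_bilinear.comp[OF bounded_bilinear_scaleR bounded_linear_ident assms(2)])
  from Ck_on_bilinear[OF assms(1) this, of k "\<lambda>_. 1" f] Ck_on_const[OF assms(1), of k "1::real"] assms(3)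
  show ?thesis by simp
qed

lemma Ck_on_id: "open S \<Longrightarrow> Ck_on k S (\<lambda>x. x)"
proof (cases k)
  case (Suc l)
  assume "open S"
  then show ?thesis unfolding Suc
    by (intro Ck_on_SucI[where f'="\<lambda>x v. v"] Ck_on_const) (auto intro!: derivative_eq_intros)
qed auto

lemma Ck_on_sum:
  assumes "open S"
  shows "(\<And>i. i \<in> I \<Longrightarrow> Ck_on k S (f i)) \<Longrightarrow> Ck_on k S (\<lambda>x. \<Sum>i\<in>I. f i x)"
  by (induction I rule: infinite_finite_induct) (auto intro: Ck_on_const Ck_on_add assms)

lemma linear_expand_Basis:
  fixes L :: "'a::euclidean_space \<Rightarrow> 'b::real_vector"
  assumes "linear L" shows "L v = (\<Sum>b\<in>Basis. (v \<bullet> b) *\<^sub>R L b)"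
proof -
  have "L v = L (\<Sum>b\<in>Basis. (v \<bullet> b) *\<^sub>R b)" by (simp add: euclidean_representation)
  also have "\<dots> = (\<Sum>b\<in>Basis. (v \<bullet> b) *\<^sub>R L b)"
    by (simp add: linear_sum[OF assms] linear_scale[OF assms])
  finally show ?thesis .
qed

lemmas Ck_on_scaleR = Ck_on_bilinear[OF _ bounded_bilinear_scaleR]
  and Ck_on_inner = Ck_on_bilinear[OF _ bounded_bilinear_inner]

text \<open>\<open>Ck_on\<close> controls derivatives only in fixed directions. Expanding the moving
  direction \<open>X x\<close> in a basis leaves finitely many of these, at the cost of one order of
  differentiability of \<open>f\<close>.\<close>

lemma Ck_on_frechet_along:
  fixes f :: "'a::euclidean_space \<Rightarrow> 'b::real_normed_vector"
  assumes "open S" "Ck_on (Suc k) S f" "Ck_on k S X"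
  shows "Ck_on k S (\<lambda>x. frechet_derivative f (at x) (X x))"
proof -
  have "Ck_on k S (\<lambda>x. \<Sum>b\<in>Basis. (X x \<bullet> b) *\<^sub>R frechet_derivative f (at x) b)"
    using assms by (intro Ck_on_sum Ck_on_scaleR Ck_on_inner Ck_on_const) auto
  moreover have "frechet_derivative f (at x) (X x) =
      (\<Sum>b\<in>Basis. (X x \<bullet> b) *\<^sub>R frechet_derivative f (at x) b)" if "x \<in> S" for x
    using Ck_on_Suc_derivative[OF assms(2) that]
    by (intro linear_expand_Basis) (blast dest: has_derivative_linear)
  ultimately show ?thesis by (rule Ck_on_eqI[OF assms(1)])
qed

text \<open>The induction varies \<open>g\<close>. The chain rule is expanded in a basis of the
  middle space, so that the derivative of \<open>g\<close> occurs only in fixed directions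
  \<open>b\<close>, evaluated at \<open>f x\<close>, and the induction hypothesis applies to
  it.\<close>

lemma Ck_on_compose:
  fixes f :: "'a::real_normed_vector \<Rightarrow> 'b::euclidean_space" and g :: "'b \<Rightarrow> 'c::real_normed_vector"
  assumes "open S" "open T" "\<And>x. x \<in> S \<Longrightarrow> f x \<in> T"
  shows "Ck_on k S f \<Longrightarrow> Ck_on k T g \<Longrightarrow> Ck_on k S (\<lambda>x. g (f x))"
proof (induction k arbitrary: g)
  case 0
  then show ?case using assms(3) by (auto intro!: continuous_on_compose2[of T g S f])
next
  case (Suc k)
  let ?f = "\<lambda>x. frechet_derivative f (at x)" and ?g = "\<lambda>x. frechet_derivative g (at x)"
  have g: "(g has_derivative ?g (f x)) (at (f x))" if "x \<in> S" for x
    using that Suc.prems assms(3) by (auto intro: has_derivative_frechet)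
  have D: "((\<lambda>x. g (f x)) has_derivative (\<lambda>v. \<Sum>b\<in>Basis. (?f x v \<bullet> b) *\<^sub>R ?g (f x) b)) (at x)"
    if "x \<in> S" for x
  proof -
    have "((\<lambda>x. g (f x)) has_derivative (\<lambda>v. ?g (f x) (?f x v))) (at x)"
      by (rule has_derivative_compose[OF Ck_on_Suc_derivative[OF Suc.prems(1) that] g[OF that]])
    moreover have "?g (f x) (?f x v) = (\<Sum>b\<in>Basis. (?f x v \<bullet> b) *\<^sub>R ?g (f x) b)" for v
      by (rule linear_expand_Basis[OF has_derivative_linear[OF g[OF that]]])
    ultimately show ?thesis by (simp only:)
  qed
  have f: "Ck_on k S f" by (rule Ck_on_SucD[OF Suc.prems(1)])
  have "Ck_on k S (\<lambda>x. \<Sum>b\<in>Basis. (?f x v \<bullet> b) *\<^sub>R ?g (f x) b)" for v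
  proof (intro Ck_on_sum Ck_on_scaleR Ck_on_inner Ck_on_const assms(1))
    show "Ck_on k S (\<lambda>x. ?f x v)" using Suc.prems(1) by simp
    show "Ck_on k S (\<lambda>x. ?g (f x) b)" for b using Suc.prems(2) by (intro Suc.IH f) simp
  qed
  then show ?case using Ck_on_SucI[OF assms(1)] D by fast
qed

section \<open>Smooth maps\<close>

lemma smooth_on_Ck: "smooth_on S f \<Longrightarrow> Ck_on k S f" by (simp add: smooth_on_def)

lemma smooth_on_cong:
  "open S \<Longrightarrow> (\<And>x. x \<in> S \<Longrightarrow> f x = g x) \<Longrightarrow> smooth_on S f \<longleftrightarrow> smooth_on S g"
  unfolding smooth_on_def using Ck_on_cong by blast

lemma smooth_on_eqI: "open S \<Longrightarrow> smooth_on S g \<Longrightarrow> (\<And>x. x \<in> S \<Longrightarrow> f x = g x) \<Longrightarrow> smooth_on S f"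
  using smooth_on_cong by blast

lemma smooth_on_subset: "smooth_on S f \<Longrightarrow> T \<subseteq> S \<Longrightarrow> smooth_on T f"
  unfolding smooth_on_def using Ck_on_subset by blast

lemma smooth_on_local:
  assumes "\<And>x. x \<in> S \<Longrightarrow> \<exists>T. open T \<and> x \<in> T \<and> smooth_on T f"
  shows "smooth_on S f"
  unfolding smooth_on_def
proof (intro allI Ck_on_local)
  fix k x assume "x \<in> S"
  with assms obtain T where "open T" "x \<in> T" "smooth_on T f" by blast
  then show "\<exists>T. open T \<and> x \<in> T \<and> Ck_on k T f" using smooth_on_Ck by blast
qed

lemma smooth_on_differentiable: "smooth_on S f \<Longrightarrow> x \<in> S \<Longrightarrow> f differentiable (at x)"
  using smooth_on_Ck[of S f "Suc 0"] by simp

lemma smooth_on_derivative: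
  "smooth_on S f \<Longrightarrow> x \<in> S \<Longrightarrow> (f has_derivative frechet_derivative f (at x)) (at x)"
  by (intro has_derivative_frechet smooth_on_differentiable)

lemma smooth_on_continuous: "smooth_on S f \<Longrightarrow> continuous_on S f"
  using smooth_on_Ck[of S f 0] by simp

lemma smooth_on_const: "open S \<Longrightarrow> smooth_on S (\<lambda>x. c)"
  by (simp add: smooth_on_def Ck_on_const)

lemma smooth_on_id: "open S \<Longrightarrow> smooth_on S (\<lambda>x. x)"
  by (simp add: smooth_on_def Ck_on_id)

lemma smooth_on_add: "open S \<Longrightarrow> smooth_on S f \<Longrightarrow> smooth_on S g \<Longrightarrow> smooth_on S (\<lambda>x. f x + g x)"
  by (simp add: smooth_on_def Ck_on_add)

lemma smooth_on_linear: "open S \<Longrightarrow> bounded_linear L \<Longrightarrow> smooth_on S f \<Longrightarrow> smooth_on S (\<lambda>x. L (f x))"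
  by (simp add: smooth_on_def Ck_on_linear)

lemma smooth_on_bilinear:
  "open S \<Longrightarrow> bounded_bilinear B \<Longrightarrow> smooth_on S f \<Longrightarrow> smooth_on S g \<Longrightarrow> smooth_on S (\<lambda>x. B (f x) (g x))"
  by (simp add: smooth_on_def Ck_on_bilinear)

lemma smooth_on_sum:
  "open S \<Longrightarrow> (\<And>i. i \<in> I \<Longrightarrow> smooth_on S (h i)) \<Longrightarrow> smooth_on S (\<lambda>x. \<Sum>i\<in>I. h i x)"
  by (simp add: smooth_on_def Ck_on_sum)

lemma smooth_on_compose:
  fixes f :: "'a::real_normed_vector \<Rightarrow> 'b::euclidean_space" and g :: "'b \<Rightarrow> 'c::real_normed_vector"
  assumes "open S" "open T" "smooth_on S f" "smooth_on T g" "\<And>x. x \<in> S \<Longrightarrow> f x \<in> T"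
  shows "smooth_on S (\<lambda>x. g (f x))"
  using assms Ck_on_compose[of S T f _ g] unfolding smooth_on_def by simp

lemma smooth_on_frechet_along:
  fixes f :: "'a::euclidean_space \<Rightarrow> 'b::real_normed_vector"
  assumes "open S" "smooth_on S f" "smooth_on S X"
  shows "smooth_on S (\<lambda>x. frechet_derivative f (at x) (X x))"
  using Ck_on_frechet_along[OF assms(1), of _ f X] assms(2,3) unfolding smooth_on_def by (simp del: Ck_on.simps)

lemmas smooth_on_scaleR = smooth_on_bilinear[OF _ bounded_bilinear_scaleR]
  and smooth_on_inner = smooth_on_bilinear[OF _ bounded_bilinear_inner]
  and smooth_on_fst = smooth_on_linear[OF _ bounded_linear_fst]
  and smooth_on_snd = smooth_on_linear[OF _ bounded_linear_snd]
  and smooth_on_minus = smooth_on_linear[OF _ bounded_linear_minus[OF bounded_linear_ident]]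

lemma smooth_on_diff:
  "open S \<Longrightarrow> smooth_on S f \<Longrightarrow> smooth_on S g \<Longrightarrow> smooth_on S (\<lambda>x. f x - g x)"
  using smooth_on_add[of S f "\<lambda>x. - g x"] smooth_on_minus[of S g] by simp

lemma smooth_on_Pair:
  assumes "open S" "smooth_on S f" "smooth_on S g"
  shows "smooth_on S (\<lambda>x. (f x, g x))"
proof -
  have "bounded_linear (\<lambda>y::'b. (y, 0::'c))" "bounded_linear (\<lambda>y::'c. (0::'b, y))"
    by (intro bounded_linear_Pair bounded_linear_ident bounded_linear_zero)+
  then have "smooth_on S (\<lambda>x. (f x, 0) + (0, g x))"
    by (intro smooth_on_add assms(1)) (auto intro: smooth_on_linear[OF assms(1)] assms)
  then show ?thesis by simp
qed

text \<open>Bootstrapping: the derivative is expressed through \<open>f\<close> itself, so each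
  order of differentiability of \<open>f\<close> gives the next. It serves solutions of differential
  systems and the inverse of a coordinate change.\<close>

lemma smooth_on_ODE:
  fixes f :: "'a::real_normed_vector \<Rightarrow> 'b::real_normed_vector"
  assumes "open S" "\<And>x. x \<in> S \<Longrightarrow> (f has_derivative F x) (at x)"
    and "\<And>k v. Ck_on k S f \<Longrightarrow> Ck_on k S (\<lambda>x. F x v)"
  shows "smooth_on S f"
proof -
  have "Ck_on k S f" for k
  proof (induction k)
    case 0
    show ?case using assms(2)
      by (auto intro!: continuous_at_imp_continuous_on has_derivative_continuous)
  next
    case (Suc k)
    then show ?case using Ck_on_SucI[OF assms(1), of f F k] assms(2,3) by simp
  qed
  then show ?thesis by (simp add: smooth_on_def)
qed

section \<open>Charts and transition maps\<close>

lemma chart_inv_left: "is_chart c \<Longrightarrow> p \<in> fst c \<Longrightarrow> chart_inv c (snd c p) = p"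
  unfolding chart_inv_def is_chart_def by (simp add: inv_into_f_f)

lemma chart_inv_right: "x \<in> snd c ` S \<Longrightarrow> S \<subseteq> fst c \<Longrightarrow> snd c (chart_inv c x) = x"
  unfolding chart_inv_def by (rule f_inv_into_f) blast

lemma chart_inv_in: "is_chart c \<Longrightarrow> x \<in> snd c ` fst c \<Longrightarrow> chart_inv c x \<in> fst c"
  using chart_inv_left by fastforce

text \<open>The image is the preimage of an open set under the coordinate change from
  \<open>c\<close> to \<open>e\<close>, which is continuous on an open domain.\<close>

lemma open_image_change:
  assumes "is_chart c" "is_chart e" "smooth_change c e" "open (snd e ` (W \<inter> fst e))"
  shows "open (snd c ` (W \<inter> fst e \<inter> fst c))"
proof -
  let ?S = "snd c ` (fst c \<inter> fst e)"
  have "continuous_on ?S (snd e \<circ> chart_inv c)" "open ?S"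
    using assms(3) unfolding smooth_change_def by (blast intro: smooth_on_continuous)+
  then have "open ((snd e \<circ> chart_inv c) -` (snd e ` (W \<inter> fst e)) \<inter> ?S)"
    using assms(4) continuous_on_open_vimage by blast
  moreover have "(snd e \<circ> chart_inv c) -` (snd e ` (W \<inter> fst e)) \<inter> ?S = snd c ` (W \<inter> fst e \<inter> fst c)"
  proof (intro equalityI subsetI)
    fix x assume "x \<in> (snd e \<circ> chart_inv c) -` (snd e ` (W \<inter> fst e)) \<inter> ?S"
    then obtain p q where pq: "p \<in> fst c" "p \<in> fst e" "x = snd c p" "q \<in> W" "q \<in> fst e" "snd e p = snd e q"
      using chart_inv_left[OF assms(1)] by auto
    then have "p = q" using chart_inv_left[OF assms(2)] by metis
    with pq show "x \<in> snd c ` (W \<inter> fst e \<inter> fst c)" by blast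
  qed (use chart_inv_left[OF assms(1)] in auto)
  ultimately show ?thesis by simp
qed

text \<open>Smoothness is local, so the intermediate chart may vary with the point. This makes two
  charts of the maximal atlas compatible although in general no single chart of the atlas covers
  their overlap.\<close>

lemma smooth_change_trans:
  assumes "is_chart c" "is_chart d"
    and "\<And>p. p \<in> fst c \<Longrightarrow> p \<in> fst d \<Longrightarrow>
      \<exists>e. is_chart e \<and> p \<in> fst e \<and> smooth_change c e \<and> smooth_change e d"
  shows "smooth_change c d"
proof -
  have loc: "\<exists>T. open T \<and> snd c p \<in> T \<and> T \<subseteq> snd c ` (fst c \<inter> fst d) \<and> smooth_on T (snd d \<circ> chart_inv c)"
    if p: "p \<in> fst c" "p \<in> fst d" for p
  proof -
    from assms(3)[OF p] obtain e where e: "is_chart e" "p \<in> fst e" "smooth_change c e" "smooth_change e d"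
      by blast
    let ?T = "snd c ` (fst d \<inter> fst e \<inter> fst c)"
    have "open (snd e ` (fst d \<inter> fst e))" using e(4) by (simp add: smooth_change_def Int_commute)
    then have T: "open ?T" by (rule open_image_change[OF assms(1) e(1,3)])
    have sub: "?T \<subseteq> snd c ` (fst c \<inter> fst e)" by blast
    have "smooth_on ?T (\<lambda>x. (snd d \<circ> chart_inv e) ((snd e \<circ> chart_inv c) x))"
    proof (rule smooth_on_compose[OF T, where T="snd e ` (fst e \<inter> fst d)"
          and f="snd e \<circ> chart_inv c" and g="snd d \<circ> chart_inv e"])
      show "open (snd e ` (fst e \<inter> fst d))" "smooth_on (snd e ` (fst e \<inter> fst d)) (snd d \<circ> chart_inv e)"
        using e(4) by (auto simp: smooth_change_def)
      show "smooth_on ?T (snd e \<circ> chart_inv c)"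
        using e(3) sub by (auto simp: smooth_change_def intro: smooth_on_subset)
      show "\<And>x. x \<in> ?T \<Longrightarrow> (snd e \<circ> chart_inv c) x \<in> snd e ` (fst e \<inter> fst d)"
        using assms(1) chart_inv_left by fastforce
    qed
    then have "smooth_on ?T (snd d \<circ> chart_inv c)"
      by (rule smooth_on_eqI[OF T]) (use assms(1) e(1) in \<open>auto simp: chart_inv_left\<close>)
    with T p e(2) show ?thesis by (intro exI[of _ ?T]) blast
  qed
  have "open (snd c ` (fst c \<inter> fst d))" using loc by (subst open_subopen) blast
  moreover have "smooth_on (snd c ` (fst c \<inter> fst d)) (snd d \<circ> chart_inv c)"
    using loc by (intro smooth_on_local) blast
  ultimately show ?thesis by (simp add: smooth_change_def)
qed

text \<open>Only the atlas is fixed, so the cotangent atlas becomes an instance of the same locale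
  and the lemmas on charts apply to it as well.\<close>

locale smooth_atlas_on =
  fixes A :: "('a, 'e::euclidean_space) chart set"
  assumes atlas: "smooth_atlas A"
begin

lemma max_atlas_is_chart: "c \<in> max_atlas A \<Longrightarrow> is_chart c"
  by (simp add: max_atlas_def)

lemma atlas_in_max: "c \<in> A \<Longrightarrow> c \<in> max_atlas A"
  using atlas by (auto simp: max_atlas_def smooth_atlas_def mcarrier_def)

lemma mcarrier_chart: "p \<in> mcarrier A \<Longrightarrow> \<exists>c\<in>A. p \<in> fst c"
  by (auto simp: mcarrier_def)

lemma max_atlas_carrier: "c \<in> max_atlas A \<Longrightarrow> p \<in> fst c \<Longrightarrow> p \<in> mcarrier A"
  by (auto simp: max_atlas_def)

lemma smooth_change_max:
  assumes c: "c \<in> max_atlas A" and d: "d \<in> max_atlas A"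
  shows "smooth_change c d"
proof (rule smooth_change_trans)
  fix p assume "p \<in> fst c"
  then obtain e where "e \<in> A" "p \<in> fst e" using mcarrier_chart max_atlas_carrier[OF c] by blast
  moreover have "smooth_change c e" "smooth_change e d"
    using c d \<open>e \<in> A\<close> by (auto simp: max_atlas_def compatible_def)
  ultimately show "\<exists>e. is_chart e \<and> p \<in> fst e \<and> smooth_change c e \<and> smooth_change e d"
    using max_atlas_is_chart atlas_in_max by blast
qed (use assms max_atlas_is_chart in auto)

text \<open>Testing against one chart of the maximal atlas around each point is enough, because
  \<open>smooth_change_trans\<close> then reaches every chart of \<open>A\<close>.\<close>

lemma max_atlasI:
  assumes "is_chart c" "\<And>p. p \<in> fst c \<Longrightarrow> \<exists>e\<in>max_atlas A. p \<in> fst e \<and> compatible c e"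
  shows "c \<in> max_atlas A"
proof -
  have "compatible c d" if "d \<in> A" for d
  proof -
    have d: "d \<in> max_atlas A" by (rule atlas_in_max[OF that])
    have "smooth_change c d"
      by (rule smooth_change_trans[OF assms(1) max_atlas_is_chart[OF d]])
        (meson assms(2) compatible_def d max_atlas_is_chart smooth_change_max)
    moreover have "smooth_change d c"
      by (rule smooth_change_trans[OF max_atlas_is_chart[OF d] assms(1)])
        (meson assms(2) compatible_def d max_atlas_is_chart smooth_change_max)
    ultimately show ?thesis by (simp add: compatible_def)
  qed
  moreover have "fst c \<subseteq> mcarrier A" using assms(2) max_atlas_carrier by blast
  ultimately show ?thesis using assms(1) by (simp add: max_atlas_def)
qed

lemma charts_at_iff: "c \<in> charts_at A p \<longleftrightarrow> c \<in> max_atlas A \<and> p \<in> fst c"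
  by (simp add: charts_at_def)

lemma some_chart_at: "p \<in> mcarrier A \<Longrightarrow> some_chart A p \<in> charts_at A p"
  unfolding some_chart_def using mcarrier_chart atlas_in_max charts_at_iff by (metis someI_ex)

lemma charts_at_carrier: "c \<in> charts_at A p \<Longrightarrow> p \<in> mcarrier A"
  unfolding charts_at_iff using max_atlas_carrier by blast

lemma open_chart: "c \<in> max_atlas A \<Longrightarrow> open (snd c ` fst c)"
  using max_atlas_is_chart by (auto simp: is_chart_def)

lemma open_overlap: "c \<in> max_atlas A \<Longrightarrow> d \<in> max_atlas A \<Longrightarrow> open (snd c ` (fst c \<inter> fst d))"
  and smooth_transition: "c \<in> max_atlas A \<Longrightarrow> d \<in> max_atlas A \<Longrightarrow>
    smooth_on (snd c ` (fst c \<inter> fst d)) (snd d \<circ> chart_inv c)"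
  using smooth_change_max by (auto simp: smooth_change_def)

lemma chart_left [simp]: "c \<in> max_atlas A \<Longrightarrow> p \<in> fst c \<Longrightarrow> chart_inv c (snd c p) = p"
  by (simp add: chart_inv_left max_atlas_is_chart)

lemma chart_right: "x \<in> snd c ` fst c \<Longrightarrow> snd c (chart_inv c x) = x"
  by (rule chart_inv_right) auto

subsection \<open>The manifold topology\<close>

lemma openin_manifold:
  "openin (manifold_topology A) W \<longleftrightarrow> W \<subseteq> mcarrier A \<and> (\<forall>c\<in>A. open (snd c ` (W \<inter> fst c)))"
proof -
  let ?L = "\<lambda>W. W \<subseteq> mcarrier A \<and> (\<forall>c\<in>A. open (snd c ` (W \<inter> fst c)))"
  have "istopology ?L"
    unfolding istopology_def
  proof (intro conjI allI impI ballI)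
    fix S T c assume "?L S" "?L T" and c: "c \<in> A"
    then have "open (snd c ` (S \<inter> fst c) \<inter> snd c ` (T \<inter> fst c))" by (intro open_Int) auto
    moreover have "snd c ` (S \<inter> fst c) \<inter> snd c ` (T \<inter> fst c) = snd c ` (S \<inter> T \<inter> fst c)"
      using atlas_in_max[OF c] chart_left by fastforce
    ultimately show "open (snd c ` (S \<inter> T \<inter> fst c))" by simp
  next
    fix K c assume K: "\<forall>W\<in>K. ?L W" and c: "c \<in> A"
    then have "open (\<Union>W\<in>K. snd c ` (W \<inter> fst c))" by auto
    moreover have "(\<Union>W\<in>K. snd c ` (W \<inter> fst c)) = snd c ` (\<Union> K \<inter> fst c)" by blast
    ultimately show "open (snd c ` (\<Union> K \<inter> fst c))" by simp
  qed blast+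
  then show ?thesis by (simp add: manifold_topology_def topology_inverse')
qed

lemma open_chart_image:
  assumes W: "openin (manifold_topology A) W" and c: "c \<in> max_atlas A"
  shows "open (snd c ` (W \<inter> fst c))"
proof (subst open_subopen, clarify)
  fix p assume p: "p \<in> W" "p \<in> fst c"
  then obtain e where e: "e \<in> A" "p \<in> fst e" using W mcarrier_chart openin_manifold by blast
  then have "open (snd c ` (W \<inter> fst e \<inter> fst c))"
    using W c by (intro open_image_change smooth_change_max)
      (auto simp: openin_manifold atlas_in_max max_atlas_is_chart)
  with p e show "\<exists>T. open T \<and> snd c p \<in> T \<and> T \<subseteq> snd c ` (W \<inter> fst c)"
    by (intro exI[of _ "snd c ` (W \<inter> fst e \<inter> fst c)"]) blast
qed

lemma openin_chart_preimage:
  assumes c: "c \<in> max_atlas A" and Y: "open Y"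
  shows "openin (manifold_topology A) {p \<in> fst c. snd c p \<in> Y}"
  unfolding openin_manifold
proof (intro conjI ballI)
  show "{p \<in> fst c. snd c p \<in> Y} \<subseteq> mcarrier A" using max_atlas_carrier[OF c] by blast
  fix d assume "d \<in> A"
  then have d: "d \<in> max_atlas A" by (rule atlas_in_max)
  have "open (snd c ` fst c \<inter> Y)" using open_chart[OF c] Y by blast
  moreover have "snd c ` fst c \<inter> Y = snd c ` ({p \<in> fst c. snd c p \<in> Y} \<inter> fst c)" by blast
  ultimately have "open (snd d ` ({p \<in> fst c. snd c p \<in> Y} \<inter> fst c \<inter> fst d))"
    by (intro open_image_change max_atlas_is_chart smooth_change_max c d) simp
  moreover have "{p \<in> fst c. snd c p \<in> Y} \<inter> fst c \<inter> fst d = {p \<in> fst c. snd c p \<in> Y} \<inter> fst d" by blast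
  ultimately show "open (snd d ` ({p \<in> fst c. snd c p \<in> Y} \<inter> fst d))" by simp
qed

lemma openin_chart: "c \<in> max_atlas A \<Longrightarrow> openin (manifold_topology A) (fst c)"
  using openin_chart_preimage[of c UNIV] by simp

lemma topspace_manifold: "topspace (manifold_topology A) = mcarrier A"
proof
  show "topspace (manifold_topology A) \<subseteq> mcarrier A"
    using openin_topspace openin_manifold by blast
  have "mcarrier A = \<Union> (fst ` A)" by (simp add: mcarrier_def)
  also have "openin (manifold_topology A) \<dots>" by (auto intro: openin_chart atlas_in_max)
  finally show "mcarrier A \<subseteq> topspace (manifold_topology A)" by (rule openin_subset)
qed

lemma restrict_chart:
  assumes c: "c \<in> max_atlas A" and W: "openin (manifold_topology A) W" "W \<subseteq> fst c"
  shows "(W, snd c) \<in> max_atlas A"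
proof (rule max_atlasI)
  have o: "open (snd c ` W)" using open_chart_image[OF W(1) c] W(2) by (simp add: Int_absorb2)
  have inj: "inj_on (snd c) W"
    using max_atlas_is_chart[OF c] W(2) by (auto simp: is_chart_def intro: inj_on_subset)
  with o show ch: "is_chart (W, snd c)" by (auto simp: is_chart_def)
  \<comment> \<open>\<open>chart_inv\<close> depends on the domain of the chart, so shrinking the
    domain changes the function; the two inverses are compared on the image of \<open>W\<close>
    only.\<close>
  have inv: "chart_inv (W, snd c) x = chart_inv c x" if x: "x \<in> snd c ` W" for x
  proof -
    from x obtain p where p: "p \<in> W" "x = snd c p" by blast
    with chart_inv_left[OF ch, of p] c W(2) show ?thesis by auto
  qed
  have "smooth_on (snd c ` W) (\<lambda>x. x)" by (rule smooth_on_id[OF o])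
  moreover have "snd c (chart_inv c x) = x" if "x \<in> snd c ` W" for x
    using that W(2) by (intro chart_right) blast
  ultimately have "smooth_on (snd c ` W) (snd c \<circ> chart_inv (W, snd c))"
    "smooth_on (snd c ` W) (snd c \<circ> chart_inv c)"
    by (auto elim!: smooth_on_eqI[OF o] simp: inv)
  then have "compatible (W, snd c) c"
    using W(2) o by (simp add: compatible_def smooth_change_def Int_absorb1 Int_absorb2)
  then show "\<exists>e\<in>max_atlas A. p \<in> fst e \<and> compatible (W, snd c) e" if "p \<in> fst (W, snd c)" for p
    using that c W(2) by (intro bexI[of _ c]) auto
qed

lemma compose_chart:
  fixes \<phi> \<psi> :: "'e \<Rightarrow> 'e"
  assumes c: "c \<in> max_atlas A" and S: "snd c ` fst c \<subseteq> S" "open (\<phi> ` (snd c ` fst c))"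
    and \<phi>: "smooth_on (snd c ` fst c) \<phi>" and \<psi>: "smooth_on (\<phi> ` (snd c ` fst c)) \<psi>"
    and inv: "\<And>x. x \<in> snd c ` fst c \<Longrightarrow> \<psi> (\<phi> x) = x"
  shows "(fst c, \<phi> \<circ> snd c) \<in> max_atlas A"
proof (rule max_atlasI)
  let ?d = "(fst c, \<phi> \<circ> snd c)"
  have "inj_on (snd c) (fst c)" using max_atlas_is_chart[OF c] by (simp add: is_chart_def)
  moreover have "inj_on \<phi> (snd c ` fst c)" using inv by (metis inj_onI)
  ultimately show ch: "is_chart ?d" using S(2) by (simp add: is_chart_def comp_inj_on image_comp)
  have i: "chart_inv ?d (\<phi> (snd c p)) = p" if "p \<in> fst c" for p
    using chart_inv_left[OF ch, of p] that by simp
  have "smooth_on (\<phi> ` snd c ` fst c) (snd c \<circ> chart_inv ?d)"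
    by (rule smooth_on_eqI[OF S(2) \<psi>]) (auto simp: i inv)
  moreover have "smooth_on (snd c ` fst c) ((\<phi> \<circ> snd c) \<circ> chart_inv c)"
    by (rule smooth_on_eqI[OF open_chart[OF c] \<phi>]) (auto simp: c)
  ultimately have "compatible ?d c"
    using S(2) open_chart[OF c] by (simp add: compatible_def smooth_change_def image_comp)
  then show "\<exists>e\<in>max_atlas A. p \<in> fst e \<and> compatible ?d e" if "p \<in> fst ?d" for p
    using that c by (intro bexI[of _ c]) auto
qed

subsection \<open>Tangent vectors in a chart\<close>

lemma transition_derivative:
  assumes "c \<in> charts_at A p" "d \<in> charts_at A p"
  shows "((snd d \<circ> chart_inv c) has_derivative frechet_derivative (snd d \<circ> chart_inv c) (at (snd c p)))
    (at (snd c p))"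
  using assms by (intro smooth_on_derivative[OF smooth_transition]) (auto simp: charts_at_iff)

lemma linear_transition:
  assumes "c \<in> charts_at A p" "d \<in> charts_at A p"
  shows "linear (frechet_derivative (snd d \<circ> chart_inv c) (at (snd c p)))"
  using transition_derivative[OF assms] has_derivative_linear by blast

lemma transition_self:
  assumes "c \<in> charts_at A p"
  shows "frechet_derivative (snd c \<circ> chart_inv c) (at (snd c p)) = (\<lambda>v. v)"
proof -
  have "frechet_derivative (snd c \<circ> chart_inv c) (at (snd c p)) = frechet_derivative (\<lambda>x. x) (at (snd c p))"
    using assms open_chart chart_right
    by (intro frechet_derivative_cong_open[of "snd c ` fst c"]) (auto simp: charts_at_iff)
  then show ?thesis by simp
qed

text \<open>The chain rule for f o c^-1 = (f o d^-1) o (d o c^-1) on the overlap. It gives both the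
  cocycle rule for coordinate vectors and the independence of the choice
  \<open>some_chart\<close>.\<close>

lemma chart_change_derivative:
  assumes c: "c \<in> charts_at A p" and d: "d \<in> charts_at A p"
    and f: "(f \<circ> chart_inv d) differentiable (at (snd d p))"
  shows "((f \<circ> chart_inv c) has_derivative (\<lambda>v. frechet_derivative (f \<circ> chart_inv d) (at (snd d p))
      (frechet_derivative (snd d \<circ> chart_inv c) (at (snd c p)) v))) (at (snd c p))"
proof -
  have p: "(snd d \<circ> chart_inv c) (snd c p) = snd d p" using c by (simp add: charts_at_iff)
  have "((f \<circ> chart_inv d) has_derivative frechet_derivative (f \<circ> chart_inv d) (at (snd d p)))
      (at ((snd d \<circ> chart_inv c) (snd c p)))"
    using f unfolding p by (rule has_derivative_frechet)
  from has_derivative_compose[OF transition_derivative[OF c d] this]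
  have "((\<lambda>x. (f \<circ> chart_inv d) ((snd d \<circ> chart_inv c) x)) has_derivative
     (\<lambda>v. frechet_derivative (f \<circ> chart_inv d) (at (snd d p))
      (frechet_derivative (snd d \<circ> chart_inv c) (at (snd c p)) v))) (at (snd c p))" .
  moreover have "(f \<circ> chart_inv d) ((snd d \<circ> chart_inv c) x) = (f \<circ> chart_inv c) x"
    if "x \<in> snd c ` (fst c \<inter> fst d)" for x
    using that c d by (auto simp: charts_at_iff)
  ultimately show ?thesis
    using has_derivative_cong_open[OF open_overlap[of c d], of "snd c p" "\<lambda>x. (f \<circ> chart_inv d) ((snd d \<circ> chart_inv c) x)" "f \<circ> chart_inv c"] c d
    by (auto simp: charts_at_iff)
qed

lemma coord_tvec_apply:
  "d \<in> charts_at A p \<Longrightarrow> coord_tvec A c p a d = frechet_derivative (snd d \<circ> chart_inv c) (at (snd c p)) a"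
  by (simp add: coord_tvec_def)

lemma coord_tvec_self [simp]: "c \<in> charts_at A p \<Longrightarrow> coord_tvec A c p a c = a"
  by (simp add: coord_tvec_apply transition_self)

lemma coord_tvec_tangent:
  assumes c: "c \<in> charts_at A p" shows "coord_tvec A c p a \<in> tangent_space A p"
  unfolding tangent_space_def
proof (intro CollectI conjI allI impI ballI)
  fix d e assume d: "d \<in> charts_at A p" and e: "e \<in> charts_at A p"
  have "(snd e \<circ> chart_inv d) differentiable at (snd d p)"
    using transition_derivative[OF d e] by (auto simp: differentiable_def)
  from frechet_derivative_eqI[OF chart_change_derivative[OF c d this]]
  show "coord_tvec A c p a e = frechet_derivative (snd e \<circ> chart_inv d) (at (snd d p)) (coord_tvec A c p a d)"
    by (simp add: coord_tvec_apply d e)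
qed (simp add: coord_tvec_def)

lemma tangent_change:
  "v \<in> tangent_space A p \<Longrightarrow> c \<in> charts_at A p \<Longrightarrow> d \<in> charts_at A p \<Longrightarrow>
    v d = frechet_derivative (snd d \<circ> chart_inv c) (at (snd c p)) (v c)"
  unfolding tangent_space_def by blast

lemma tangent_outside: "v \<in> tangent_space A p \<Longrightarrow> c \<notin> charts_at A p \<Longrightarrow> v c = 0"
  unfolding tangent_space_def by blast

lemma tangent_eq_coord_tvec:
  assumes "v \<in> tangent_space A p" "c \<in> charts_at A p"
  shows "v = coord_tvec A c p (v c)"
proof
  fix d
  show "v d = coord_tvec A c p (v c) d"
    unfolding coord_tvec_def using tangent_change[OF assms] tangent_outside[OF assms(1)] by presburger
qed

lemma tangent_eqI:
  "v \<in> tangent_space A p \<Longrightarrow> w \<in> tangent_space A p \<Longrightarrow> c \<in> charts_at A p \<Longrightarrow> v c = w c \<Longrightarrow> v = w"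
  using tangent_eq_coord_tvec[of v p c] tangent_eq_coord_tvec[of w p c] by argo

lemma coord_tvec_add: "c \<in> charts_at A p \<Longrightarrow> coord_tvec A c p (a + b) = coord_tvec A c p a + coord_tvec A c p b"
  and coord_tvec_scaleR: "c \<in> charts_at A p \<Longrightarrow> coord_tvec A c p (r *\<^sub>R a) = r *\<^sub>R coord_tvec A c p a"
  using linear_add[OF linear_transition[of c p]] linear_scale[OF linear_transition[of c p]]
  by (auto simp: fun_eq_iff coord_tvec_def)

lemma linear_coord_tvec: "c \<in> charts_at A p \<Longrightarrow> linear (coord_tvec A c p)"
  by (simp add: linear_iff coord_tvec_add coord_tvec_scaleR)

lemma subspace_tangent: "p \<in> mcarrier A \<Longrightarrow> subspace (tangent_space A p)"
proof -
  assume "p \<in> mcarrier A"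
  then obtain c where c: "c \<in> charts_at A p" using some_chart_at by blast
  have "tangent_space A p = range (coord_tvec A c p)"
    using tangent_eq_coord_tvec[OF _ c] coord_tvec_tangent[OF c] by blast
  then show ?thesis using linear_subspace_image[OF linear_coord_tvec[OF c] subspace_UNIV] by simp
qed

text \<open>\<open>dir_deriv\<close> is evaluated in the arbitrary chart \<open>some_chart\<close>;
  the change of \<open>v\<close> between charts and the chain rule compensate each other, so a
  convenient chart may be used instead.\<close>

lemma dir_deriv_chart:
  assumes c: "c \<in> charts_at A p" and v: "v \<in> tangent_space A p"
    and f: "(f \<circ> chart_inv c) differentiable (at (snd c p))"
  shows "dir_deriv A p v f = frechet_derivative (f \<circ> chart_inv c) (at (snd c p)) (v c)"
proof -
  let ?d = "some_chart A p"
  have d: "?d \<in> charts_at A p" by (rule some_chart_at[OF charts_at_carrier[OF c]])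
  show ?thesis
    using frechet_derivative_eqI[OF chart_change_derivative[OF d c f]] tangent_change[OF v d c]
    by (simp add: dir_deriv_def Let_def)
qed

lemma differential_chart:
  assumes c: "c \<in> charts_at A p" and v: "v \<in> tangent_space A p" and d: "d \<in> charts_at B (F p)"
    and f: "(snd d \<circ> F \<circ> chart_inv c) differentiable (at (snd c p))"
  shows "differential A B F p v d = frechet_derivative (snd d \<circ> F \<circ> chart_inv c) (at (snd c p)) (v c)"
proof -
  let ?d = "some_chart A p"
  have e: "?d \<in> charts_at A p" by (rule some_chart_at[OF charts_at_carrier[OF c]])
  show ?thesis
    using frechet_derivative_eqI[OF chart_change_derivative[OF e c f]] tangent_change[OF v e c] d
    by (simp add: differential_def Let_def)
qed

subsection \<open>Smooth fields in a chart\<close>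

lemma open_image_Int:
  assumes "openin (manifold_topology A) W" "c \<in> max_atlas A" "e \<in> max_atlas A"
  shows "open (snd c ` (W \<inter> fst e \<inter> fst c))"
  using open_chart_image[OF openin_Int[OF assms(1) openin_chart[OF assms(3)]] assms(2)] .

lemma smooth_pullback_change:
  assumes W: "openin (manifold_topology A) W" and c: "c \<in> max_atlas A" and e: "e \<in> max_atlas A"
    and g: "smooth_on (snd e ` (W \<inter> fst e)) g"
  shows "smooth_on (snd c ` (W \<inter> fst e \<inter> fst c)) (\<lambda>x. g ((snd e \<circ> chart_inv c) x))"
proof (rule smooth_on_compose[OF open_image_Int[OF W c e] open_chart_image[OF W e] _ g])
  show "smooth_on (snd c ` (W \<inter> fst e \<inter> fst c)) (snd e \<circ> chart_inv c)"
    by (rule smooth_on_subset[OF smooth_transition[OF c e]]) blast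
qed (use c in auto)

lemma smooth_field_change:
  assumes W: "openin (manifold_topology A) W" and c: "c \<in> max_atlas A" and e: "e \<in> max_atlas A"
    and X: "\<And>p. p \<in> W \<Longrightarrow> X p \<in> tangent_space A p"
    and s: "smooth_on (snd e ` (W \<inter> fst e)) (\<lambda>x. X (chart_inv e x) e)"
  shows "smooth_on (snd c ` (W \<inter> fst e \<inter> fst c)) (\<lambda>x. X (chart_inv c x) c)"
proof -
  let ?W = "W \<inter> fst c"
  let ?g = "\<lambda>y. frechet_derivative (snd c \<circ> chart_inv e) (at y) (X (chart_inv e y) e)"
  have W': "openin (manifold_topology A) ?W" by (rule openin_Int[OF W openin_chart[OF c]])
  have "smooth_on (snd e ` (?W \<inter> fst e)) ?g"
    by (rule smooth_on_frechet_along[OF open_chart_image[OF W' e]])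
      (auto intro: smooth_on_subset[OF smooth_transition[OF e c]] smooth_on_subset[OF s])
  from smooth_pullback_change[OF W' c e this]
  have "smooth_on (snd c ` (W \<inter> fst e \<inter> fst c)) (\<lambda>x. ?g ((snd e \<circ> chart_inv c) x))"
    by (rule smooth_on_subset) blast
  then show ?thesis
  proof (rule smooth_on_eqI[OF open_image_Int[OF W c e]], clarify)
    fix p assume "p \<in> W" "p \<in> fst c" "p \<in> fst e"
    with c e tangent_change[OF X, of p e c]
    show "X (chart_inv c (snd c p)) c = ?g ((snd e \<circ> chart_inv c) (snd c p))"
      by (simp add: charts_at_iff)
  qed
qed

lemma smooth_vfield_tangent: "smooth_vfield A U X \<Longrightarrow> p \<in> U \<Longrightarrow> X p \<in> tangent_space A p"
  by (simp add: smooth_vfield_def)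

lemma smooth_vfieldD:
  assumes U: "openin (manifold_topology A) U" and X: "smooth_vfield A U X" and c: "c \<in> max_atlas A"
  shows "smooth_on (snd c ` (U \<inter> fst c)) (\<lambda>x. X (chart_inv c x) c)"
proof (rule smooth_on_local, clarify)
  fix p assume p: "p \<in> U" "p \<in> fst c"
  then obtain e where e: "e \<in> A" "p \<in> fst e" using max_atlas_carrier[OF c] mcarrier_chart by blast
  have "smooth_on (snd c ` (U \<inter> fst e \<inter> fst c)) (\<lambda>x. X (chart_inv c x) c)"
    using X e(1) by (intro smooth_field_change[OF U c atlas_in_max]) (auto simp: smooth_vfield_def)
  with p e open_image_Int[OF U c atlas_in_max[OF e(1)]]
  show "\<exists>T. open T \<and> snd c p \<in> T \<and> smooth_on T (\<lambda>x. X (chart_inv c x) c)" by blast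
qed

text \<open>The definition tests every chart of \<open>A\<close>; by the transformation rule one
  chart around each point decides, and it may come from the maximal atlas.\<close>

lemma smooth_vfieldI:
  assumes U: "openin (manifold_topology A) U" and X: "\<And>p. p \<in> U \<Longrightarrow> X p \<in> tangent_space A p"
    and s: "\<And>p. p \<in> U \<Longrightarrow>
      \<exists>e\<in>charts_at A p. smooth_on (snd e ` (U \<inter> fst e)) (\<lambda>x. X (chart_inv e x) e)"
  shows "smooth_vfield A U X"
  unfolding smooth_vfield_def
proof (intro conjI ballI X)
  fix c assume "c \<in> A"
  then have c: "c \<in> max_atlas A" by (rule atlas_in_max)
  show "smooth_on (snd c ` (U \<inter> fst c)) (\<lambda>x. X (chart_inv c x) c)"
  proof (rule smooth_on_local, clarify)
    fix p assume p: "p \<in> U" "p \<in> fst c"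
    then obtain e where e: "e \<in> max_atlas A" "p \<in> fst e"
      and se: "smooth_on (snd e ` (U \<inter> fst e)) (\<lambda>x. X (chart_inv e x) e)"
      using s charts_at_iff by blast
    have "smooth_on (snd c ` (U \<inter> fst e \<inter> fst c)) (\<lambda>x. X (chart_inv c x) c)"
      by (rule smooth_field_change[OF U c e(1) X se])
    with p e open_image_Int[OF U c e(1)]
    show "\<exists>T. open T \<and> snd c p \<in> T \<and> smooth_on T (\<lambda>x. X (chart_inv c x) c)" by blast
  qed
qed

lemma smooth_fun_change:
  assumes W: "openin (manifold_topology A) W" and c: "c \<in> max_atlas A" and e: "e \<in> max_atlas A"
    and s: "smooth_on (snd e ` (W \<inter> fst e)) (f \<circ> chart_inv e)"
  shows "smooth_on (snd c ` (W \<inter> fst e \<inter> fst c)) (f \<circ> chart_inv c)"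
  by (rule smooth_on_eqI[OF open_image_Int[OF W c e] smooth_pullback_change[OF W c e s]])
    (use c e in auto)

lemma smooth_funD:
  assumes U: "openin (manifold_topology A) U" and f: "smooth_fun A U f" and c: "c \<in> max_atlas A"
  shows "smooth_on (snd c ` (U \<inter> fst c)) (f \<circ> chart_inv c)"
proof (rule smooth_on_local, clarify)
  fix p assume p: "p \<in> U" "p \<in> fst c"
  then obtain e where e: "e \<in> A" "p \<in> fst e" using max_atlas_carrier[OF c] mcarrier_chart by blast
  have "smooth_on (snd c ` (U \<inter> fst e \<inter> fst c)) (f \<circ> chart_inv c)"
    using f e(1) by (intro smooth_fun_change[OF U c atlas_in_max]) (auto simp: smooth_fun_def)
  with p e open_image_Int[OF U c atlas_in_max[OF e(1)]]
  show "\<exists>T. open T \<and> snd c p \<in> T \<and> smooth_on T (f \<circ> chart_inv c)" by blast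
qed

lemma smooth_funI:
  assumes U: "openin (manifold_topology A) U" and e: "e \<in> max_atlas A" "U \<subseteq> fst e"
    and f: "smooth_on (snd e ` U) (f \<circ> chart_inv e)"
  shows "smooth_fun A U f"
  unfolding smooth_fun_def
proof
  fix c assume "c \<in> A"
  then have "c \<in> max_atlas A" by (rule atlas_in_max)
  from smooth_fun_change[OF U this e(1), of f] f e(2)
  show "smooth_on (snd c ` (U \<inter> fst c)) (f \<circ> chart_inv c)" by (simp add: Int_absorb2)
qed

lemma smooth_coord_tvec:
  assumes c: "c \<in> max_atlas A" and U: "openin (manifold_topology A) U" "U \<subseteq> fst c"
    and a: "smooth_on (snd c ` U) a"
  shows "smooth_vfield A U (\<lambda>q. coord_tvec A c q (a (snd c q)))"
proof (rule smooth_vfieldI[OF U(1)])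
  fix p assume p: "p \<in> U"
  have o: "open (snd c ` (U \<inter> fst c))" by (rule open_chart_image[OF U(1) c])
  show "coord_tvec A c p (a (snd c p)) \<in> tangent_space A p"
    using p U c by (intro coord_tvec_tangent) (auto simp: charts_at_iff)
  have "smooth_on (snd c ` (U \<inter> fst c)) (\<lambda>x. coord_tvec A c (chart_inv c x) (a (snd c (chart_inv c x))) c)"
    by (rule smooth_on_eqI[OF o smooth_on_subset[OF a]]) (use c in \<open>auto simp: charts_at_iff\<close>)
  then show "\<exists>e\<in>charts_at A p. smooth_on (snd e ` (U \<inter> fst e))
       (\<lambda>x. coord_tvec A c (chart_inv e x) (a (snd c (chart_inv e x))) e)"
    using p U c by (intro bexI[of _ c]) (auto simp: charts_at_iff)
qed

end

section \<open>The cotangent bundle as a manifold\<close>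

context smooth_atlas_on
begin

text \<open>The covector with components \<open>e\<close>, inverse to \<open>covec_coords\<close>;
  it is zero off the tangent space as \<open>cotangent_space\<close> demands.\<close>

definition covec :: "('a, 'e) chart \<Rightarrow> 'a \<Rightarrow> 'e \<Rightarrow> ('a, 'e) covec" where
  "covec c p e = (\<lambda>v. if v \<in> tangent_space A p then e \<bullet> v c else 0)"

text \<open>Named for arbitrary \<open>c\<close>: holomorphic and affine charts belong in general
  only to the maximal atlas of the base, but have to induce charts of the bundle too.\<close>

definition cot_chart :: "('a, 'e) chart \<Rightarrow> ('a \<times> ('a, 'e) covec, 'e \<times> 'e) chart" where
  "cot_chart c = ({(p, \<xi>). p \<in> fst c \<and> \<xi> \<in> cotangent_space A p},
     \<lambda>(p, \<xi>). (snd c p, covec_coords A c p \<xi>))"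

lemma cotangent_atlas_eq: "cotangent_atlas A = cot_chart ` A"
  by (simp add: cotangent_atlas_def cot_chart_def)

lemma fst_cot_chart: "fst (cot_chart c) = {x. fst x \<in> fst c \<and> snd x \<in> cotangent_space A (fst x)}"
  and snd_cot_chart: "snd (cot_chart c) x = (snd c (fst x), covec_coords A c (fst x) (snd x))"
  by (auto simp: cot_chart_def split_beta)

lemma mem_cot_chart: "x \<in> fst (cot_chart c) \<longleftrightarrow> fst x \<in> fst c \<and> snd x \<in> cotangent_space A (fst x)"
  by (simp add: fst_cot_chart)

lemma tangent_add: "c \<in> charts_at A p \<Longrightarrow> v \<in> tangent_space A p \<Longrightarrow> w \<in> tangent_space A p \<Longrightarrow> v + w \<in> tangent_space A p"
  and tangent_scaleR: "c \<in> charts_at A p \<Longrightarrow> v \<in> tangent_space A p \<Longrightarrow> r *\<^sub>R v \<in> tangent_space A p"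
  and tangent_zero: "c \<in> charts_at A p \<Longrightarrow> 0 \<in> tangent_space A p"
  and tangent_diff: "c \<in> charts_at A p \<Longrightarrow> v \<in> tangent_space A p \<Longrightarrow> w \<in> tangent_space A p \<Longrightarrow> v - w \<in> tangent_space A p"
  and tangent_minus: "c \<in> charts_at A p \<Longrightarrow> v \<in> tangent_space A p \<Longrightarrow> - v \<in> tangent_space A p"
  using subspace_tangent[OF charts_at_carrier]
  by (blast intro: subspace_add subspace_scale subspace_0 subspace_diff subspace_neg)+

lemma covec_in: "c \<in> charts_at A p \<Longrightarrow> covec c p e \<in> cotangent_space A p"
  by (auto simp: cotangent_space_def covec_def linear_between_def tangent_add tangent_scaleR
    inner_add_right)

lemma covec_coords_covec [simp]:
  assumes "c \<in> charts_at A p" shows "covec_coords A c p (covec c p e) = e"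
proof -
  have "covec_coords A c p (covec c p e) = (\<Sum>b\<in>Basis. (e \<bullet> b) *\<^sub>R b)"
    using assms by (simp add: covec_coords_def covec_def coord_tvec_tangent)
  then show ?thesis by (simp add: euclidean_representation)
qed

lemma cotangent_linear:
  assumes "\<xi> \<in> cotangent_space A p" "c \<in> charts_at A p"
  shows "linear (\<lambda>a. \<xi> (coord_tvec A c p a))"
  using assms by (auto simp: linear_iff cotangent_space_def linear_between_def coord_tvec_add
    coord_tvec_scaleR coord_tvec_tangent)

lemma cotangent_apply:
  assumes \<xi>: "\<xi> \<in> cotangent_space A p" and c: "c \<in> charts_at A p" and v: "v \<in> tangent_space A p"
  shows "\<xi> v = covec_coords A c p \<xi> \<bullet> v c"
proof -
  have "\<xi> v = \<xi> (coord_tvec A c p (v c))" using tangent_eq_coord_tvec[OF v c] by simp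
  also have "\<dots> = (\<Sum>b\<in>Basis. (v c \<bullet> b) *\<^sub>R \<xi> (coord_tvec A c p b))"
    by (rule linear_expand_Basis[OF cotangent_linear[OF \<xi> c]])
  also have "\<dots> = covec_coords A c p \<xi> \<bullet> v c"
    by (simp add: covec_coords_def inner_sum_left inner_sum_right inner_commute[of _ "v c"] mult.commute)
  finally show ?thesis .
qed

lemma cotangent_outside: "\<xi> \<in> cotangent_space A p \<Longrightarrow> v \<notin> tangent_space A p \<Longrightarrow> \<xi> v = 0"
  by (simp add: cotangent_space_def)

lemma cotangent_eqI:
  assumes "\<xi> \<in> cotangent_space A p" "\<eta> \<in> cotangent_space A p" "c \<in> charts_at A p"
    and "covec_coords A c p \<xi> = covec_coords A c p \<eta>"
  shows "\<xi> = \<eta>"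
proof
  fix v show "\<xi> v = \<eta> v"
    using assms cotangent_apply[OF assms(1,3)] cotangent_apply[OF assms(2,3)]
    by (cases "v \<in> tangent_space A p") (simp_all add: cotangent_outside)
qed

lemma covec_covec_coords:
  "\<xi> \<in> cotangent_space A p \<Longrightarrow> c \<in> charts_at A p \<Longrightarrow> covec c p (covec_coords A c p \<xi>) = \<xi>"
  by (rule cotangent_eqI[OF covec_in]) auto

lemma covec_coords_linear: "linear (covec_coords A c p)"
  by (simp add: linear_iff covec_coords_def sum.distrib scaleR_add_left scaleR_sum_right)

lemma subspace_cotangent: "c \<in> charts_at A p \<Longrightarrow> subspace (cotangent_space A p)"
  by (auto simp: subspace_def cotangent_space_def linear_between_def algebra_simps)

text \<open>Components of covectors change by the transposed derivative of the inverse coordinate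
  change, since the pairing with a coordinate vector of \<open>d\<close> can be computed in
  \<open>c\<close>.\<close>

lemma covec_coords_change:
  assumes \<xi>: "\<xi> \<in> cotangent_space A p" and c: "c \<in> charts_at A p" and d: "d \<in> charts_at A p"
  shows "covec_coords A d p \<xi> =
    (\<Sum>b\<in>Basis. (covec_coords A c p \<xi> \<bullet> frechet_derivative (snd c \<circ> chart_inv d) (at (snd d p)) b) *\<^sub>R b)"
  using cotangent_apply[OF \<xi> c coord_tvec_tangent[OF d]]
  by (subst covec_coords_def) (simp add: coord_tvec_apply[OF c])

lemma cot_chart_image:
  assumes c: "c \<in> max_atlas A" and W: "W \<subseteq> fst c"
  shows "snd (cot_chart c) ` {x \<in> fst (cot_chart c). fst x \<in> W} = snd c ` W \<times> (UNIV :: 'e set)"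
proof (intro equalityI subsetI)
  fix y assume "y \<in> snd c ` W \<times> (UNIV :: 'e set)"
  then obtain p e where p: "p \<in> W" "y = (snd c p, e)" by auto
  then have "c \<in> charts_at A p" using c W by (auto simp: charts_at_iff)
  then have "y = snd (cot_chart c) (p, covec c p e)" "(p, covec c p e) \<in> fst (cot_chart c)"
    using p W by (auto simp: snd_cot_chart fst_cot_chart covec_in)
  then show "y \<in> snd (cot_chart c) ` {x \<in> fst (cot_chart c). fst x \<in> W}" using p by force
qed (auto simp: snd_cot_chart)

lemma cot_chart_image_all:
  "c \<in> max_atlas A \<Longrightarrow> snd (cot_chart c) ` fst (cot_chart c) = snd c ` fst c \<times> UNIV"
proof -
  assume c: "c \<in> max_atlas A"
  have "fst (cot_chart c) = {x \<in> fst (cot_chart c). fst x \<in> fst c}" by (auto simp: mem_cot_chart)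
  then show ?thesis using cot_chart_image[OF c subset_refl] by simp
qed

lemma cot_chart_is_chart:
  assumes c: "c \<in> max_atlas A" shows "is_chart (cot_chart c)"
proof -
  have "inj_on (snd (cot_chart c)) (fst (cot_chart c))"
  proof (rule inj_onI)
    fix x y assume xy: "x \<in> fst (cot_chart c)" "y \<in> fst (cot_chart c)" "snd (cot_chart c) x = snd (cot_chart c) y"
    then have "fst x = fst y" using chart_left[OF c] unfolding mem_cot_chart snd_cot_chart by (metis Pair_inject)
    with xy c show "x = y"
      by (auto simp: mem_cot_chart snd_cot_chart prod_eq_iff charts_at_iff intro: cotangent_eqI)
  qed
  then show ?thesis
    using open_chart[OF c] by (simp add: is_chart_def cot_chart_image_all[OF c] open_Times)
qed

lemma chart_inv_cot_chart:
  assumes c: "c \<in> max_atlas A" and x: "x \<in> snd c ` fst c"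
  shows "chart_inv (cot_chart c) (x, e) = (chart_inv c x, covec c (chart_inv c x) e)"
proof -
  have p: "c \<in> charts_at A (chart_inv c x)" using x c by (auto simp: charts_at_iff)
  then have "snd (cot_chart c) (chart_inv c x, covec c (chart_inv c x) e) = (x, e)"
    using chart_right[OF x] by (simp add: snd_cot_chart)
  moreover have "(chart_inv c x, covec c (chart_inv c x) e) \<in> fst (cot_chart c)"
    using p covec_in by (simp add: mem_cot_chart charts_at_iff)
  ultimately show ?thesis using chart_inv_left[OF cot_chart_is_chart[OF c]] by metis
qed

lemma cot_chart_smooth_change:
  assumes c: "c \<in> max_atlas A" and d: "d \<in> max_atlas A"
  shows "smooth_change (cot_chart c) (cot_chart d)"
proof -
  let ?S = "snd c ` (fst c \<inter> fst d)"
  have S: "open ?S" by (rule open_overlap[OF c d])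
  have "fst (cot_chart c) \<inter> fst (cot_chart d) = {x \<in> fst (cot_chart c). fst x \<in> fst c \<inter> fst d}"
    by (auto simp: mem_cot_chart)
  then have im: "snd (cot_chart c) ` (fst (cot_chart c) \<inter> fst (cot_chart d)) = ?S \<times> UNIV"
    by (simp only: cot_chart_image[OF c Int_lower1])
  have o: "open (?S \<times> (UNIV :: 'e set))" by (intro open_Times S open_UNIV)
  let ?\<tau> = "snd d \<circ> chart_inv c"
  \<comment> \<open>The fibre part of the coordinate change is linear in the fibre variable. Its
    coefficients \<open>?g\<close> are the derivative of the inverse change, taken at the new base
    coordinates \<open>?\<tau> x\<close>.\<close>
  let ?g = "\<lambda>b. \<lambda>x. frechet_derivative (snd c \<circ> chart_inv d) (at (?\<tau> x)) b"
  have g: "smooth_on ?S (?g b)" for b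
  proof (rule smooth_on_compose[OF S open_overlap[OF d c] smooth_transition[OF c d], where g="\<lambda>y. frechet_derivative (snd c \<circ> chart_inv d) (at y) b"])
    show "smooth_on (snd d ` (fst d \<inter> fst c)) (\<lambda>y. frechet_derivative (snd c \<circ> chart_inv d) (at y) b)"
      by (rule smooth_on_frechet_along[OF open_overlap[OF d c] smooth_transition[OF d c] smooth_on_const[OF open_overlap[OF d c]]])
  qed (use c d in auto)
  have fst': "smooth_on (?S \<times> (UNIV :: 'e set)) fst" "smooth_on (?S \<times> (UNIV :: 'e set)) snd"
    by (rule smooth_on_fst[OF o smooth_on_id[OF o]], rule smooth_on_snd[OF o smooth_on_id[OF o]])
  have comp: "smooth_on (?S \<times> (UNIV :: 'e set)) (\<lambda>z. h (fst z))" if "smooth_on ?S h" for h :: "'e \<Rightarrow> 'e"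
    by (rule smooth_on_compose[OF o S fst'(1) that]) auto
  have "smooth_on (?S \<times> UNIV) (\<lambda>z. (?\<tau> (fst z), \<Sum>b\<in>Basis. (snd z \<bullet> ?g b (fst z)) *\<^sub>R b))"
    by (intro smooth_on_Pair smooth_on_sum smooth_on_scaleR smooth_on_inner smooth_on_const o fst'
         comp[OF smooth_transition[OF c d]] comp[OF g])
  then have "smooth_on (?S \<times> UNIV) (snd (cot_chart d) \<circ> chart_inv (cot_chart c))"
  proof (rule smooth_on_eqI[OF o])
    fix z :: "'e \<times> 'e" assume z: "z \<in> ?S \<times> UNIV"
    then obtain p where p: "p \<in> fst c" "p \<in> fst d" "fst z = snd c p" by auto
    then have pc: "c \<in> charts_at A p" "d \<in> charts_at A p" using c d by (auto simp: charts_at_iff)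
    have "chart_inv (cot_chart c) z = (p, covec c p (snd z))"
      using chart_inv_cot_chart[OF c, of "fst z" "snd z"] p c by (cases z) simp
    then show "(snd (cot_chart d) \<circ> chart_inv (cot_chart c)) z =
        (?\<tau> (fst z), \<Sum>b\<in>Basis. (snd z \<bullet> ?g b (fst z)) *\<^sub>R b)"
      using covec_coords_change[OF covec_in[OF pc(1), of "snd z"] pc] p pc
      by (simp add: snd_cot_chart charts_at_iff)
  qed
  with o show ?thesis by (simp add: smooth_change_def im)
qed

lemma smooth_atlas_cotangent: "smooth_atlas_on (cotangent_atlas A)"
proof
  show "smooth_atlas (cotangent_atlas A)"
    unfolding smooth_atlas_def cotangent_atlas_eq
    using atlas_in_max by (auto intro: cot_chart_is_chart simp: compatible_def cot_chart_smooth_change)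
qed

interpretation N: smooth_atlas_on "cotangent_atlas A" by (rule smooth_atlas_cotangent)

lemma mcarrier_cotangent: "x \<in> mcarrier (cotangent_atlas A) \<longleftrightarrow>
    fst x \<in> mcarrier A \<and> snd x \<in> cotangent_space A (fst x)"
  by (auto simp: mcarrier_def cotangent_atlas_eq mem_cot_chart)

lemma cot_chart_max:
  assumes c: "c \<in> max_atlas A" shows "cot_chart c \<in> max_atlas (cotangent_atlas A)"
proof -
  have "fst (cot_chart c) \<subseteq> mcarrier (cotangent_atlas A)"
    using max_atlas_carrier[OF c] by (auto simp: mem_cot_chart mcarrier_cotangent)
  moreover have "compatible (cot_chart c) d" if "d \<in> cotangent_atlas A" for d
    using that c atlas_in_max by (auto simp: cotangent_atlas_eq compatible_def cot_chart_smooth_change)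
  ultimately show ?thesis unfolding max_atlas_def using cot_chart_is_chart[OF c] by blast
qed

lemma cot_chart_at:
  "c \<in> charts_at A (fst x) \<Longrightarrow> x \<in> mcarrier (cotangent_atlas A) \<Longrightarrow>
    cot_chart c \<in> charts_at (cotangent_atlas A) x"
  by (simp add: charts_at_iff N.charts_at_iff cot_chart_max mem_cot_chart mcarrier_cotangent)

section \<open>Topology of the cotangent bundle\<close>

lemma openin_over:
  assumes W: "openin (manifold_topology A) W"
  shows "openin (manifold_topology (cotangent_atlas A)) {x \<in> mcarrier (cotangent_atlas A). fst x \<in> W}"
  unfolding N.openin_manifold
proof (intro conjI ballI)
  fix d assume "d \<in> cotangent_atlas A"
  then obtain c where c: "c \<in> A" "d = cot_chart c" by (auto simp: cotangent_atlas_eq)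
  have "{x \<in> mcarrier (cotangent_atlas A). fst x \<in> W} \<inter> fst d = {x \<in> fst (cot_chart c). fst x \<in> W \<inter> fst c}"
    using c(2) max_atlas_carrier[OF atlas_in_max[OF c(1)]] by (auto simp: mem_cot_chart mcarrier_cotangent)
  then have "snd d ` ({x \<in> mcarrier (cotangent_atlas A). fst x \<in> W} \<inter> fst d) = snd c ` (W \<inter> fst c) \<times> UNIV"
    using cot_chart_image[OF atlas_in_max[OF c(1)], of "W \<inter> fst c"] c(2) by simp
  then show "open (snd d ` ({x \<in> mcarrier (cotangent_atlas A). fst x \<in> W} \<inter> fst d))"
    using open_chart_image[OF W atlas_in_max[OF c(1)]] by (simp add: open_Times)
qed auto

text \<open>Points over different base points are separated by the preimages of disjoint base sets.
  Points over the same base point lie in one induced chart, where the model space separates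
  them.\<close>

lemma Hausdorff_cotangent:
  assumes H: "Hausdorff_space (manifold_topology A)"
  shows "Hausdorff_space (manifold_topology (cotangent_atlas A))"
  unfolding Hausdorff_space_def N.topspace_manifold
proof (intro allI impI)
  let ?N = "cotangent_atlas A"
  fix x y assume xy: "x \<in> mcarrier ?N \<and> y \<in> mcarrier ?N \<and> x \<noteq> y"
  show "\<exists>U V. openin (manifold_topology ?N) U \<and> openin (manifold_topology ?N) V \<and> x \<in> U \<and> y \<in> V \<and> disjnt U V"
  proof (cases "fst x = fst y")
    case False
    then obtain U V where UV: "openin (manifold_topology A) U" "openin (manifold_topology A) V"
      "fst x \<in> U" "fst y \<in> V" "disjnt U V"
      using H xy unfolding Hausdorff_space_def topspace_manifold mcarrier_cotangent by meson
    show ?thesis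
      by (rule exI[of _ "{z \<in> mcarrier ?N. fst z \<in> U}"], rule exI[of _ "{z \<in> mcarrier ?N. fst z \<in> V}"])
        (use UV xy openin_over in \<open>auto simp: disjnt_iff\<close>)
  next
    case True
    obtain c where c: "c \<in> A" "fst x \<in> fst c" using xy mcarrier_chart[of "fst x"] unfolding mcarrier_cotangent by blast
    have cx: "x \<in> fst (cot_chart c)" "y \<in> fst (cot_chart c)"
      using xy c True by (auto simp: mem_cot_chart mcarrier_cotangent)
    have ne: "snd (cot_chart c) x \<noteq> snd (cot_chart c) y"
      using xy cx chart_inv_left[OF cot_chart_is_chart[OF atlas_in_max[OF c(1)]]] by metis
    obtain U V where UV: "open U" "open V" "snd (cot_chart c) x \<in> U" "snd (cot_chart c) y \<in> V" "U \<inter> V = {}"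
      using hausdorff[OF ne] by blast
    note o = N.openin_chart_preimage[OF cot_chart_max[OF atlas_in_max[OF c(1)]]]
    show ?thesis
      by (rule exI[of _ "{z \<in> fst (cot_chart c). snd (cot_chart c) z \<in> U}"],
          rule exI[of _ "{z \<in> fst (cot_chart c). snd (cot_chart c) z \<in> V}"],
          intro conjI o[OF UV(1)] o[OF UV(2)])
        (use UV(3-5) cx in \<open>auto simp: disjnt_iff\<close>)
  qed
qed

text \<open>A basic set is cut out by a basic base set \<open>V\<close> inside a chart domain and a
  basic set \<open>Y\<close> of the model space. The atlas may be uncountable, so one chart
  \<open>ch V\<close> is chosen for each \<open>V\<close> to keep the family countable.\<close>

lemma second_countable_cotangent:
  assumes "second_countable (manifold_topology A)"
  shows "second_countable (manifold_topology (cotangent_atlas A))"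
proof -
  let ?N = "cotangent_atlas A"
  obtain \<B> where B: "countable \<B>" "\<And>V. V \<in> \<B> \<Longrightarrow> openin (manifold_topology A) V"
    "\<And>U x. openin (manifold_topology A) U \<Longrightarrow> x \<in> U \<Longrightarrow> \<exists>V\<in>\<B>. x \<in> V \<and> V \<subseteq> U"
    using assms unfolding second_countable_def by metis
  obtain \<O> :: "('e \<times> 'e) set set" where O: "countable \<O>" "\<And>Y. Y \<in> \<O> \<Longrightarrow> open Y"
    "\<And>U x. open U \<Longrightarrow> x \<in> U \<Longrightarrow> \<exists>Y\<in>\<O>. x \<in> Y \<and> Y \<subseteq> U"
    using ex_countable_basis topological_basisE by (metis topological_basis_open)
  define \<B>' where "\<B>' = {V \<in> \<B>. \<exists>c\<in>A. V \<subseteq> fst c}"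
  have "\<forall>V\<in>\<B>'. \<exists>c\<in>A. V \<subseteq> fst c" by (simp add: \<B>'_def)
  then obtain ch where ch: "\<And>V. V \<in> \<B>' \<Longrightarrow> ch V \<in> A" "\<And>V. V \<in> \<B>' \<Longrightarrow> V \<subseteq> fst (ch V)"
    unfolding Bex_def by metis
  define F where "F = (\<lambda>(V, Y). {x \<in> mcarrier ?N. fst x \<in> V} \<inter>
    {x \<in> fst (cot_chart (ch V)). snd (cot_chart (ch V)) x \<in> Y})"
  have "countable (F ` (\<B>' \<times> \<O>))"
    using B(1) O(1) by (auto simp: \<B>'_def intro: countable_subset)
  moreover have "openin (manifold_topology ?N) W" if "W \<in> F ` (\<B>' \<times> \<O>)" for W
    using that O(2) ch B(2)
    by (auto simp: F_def \<B>'_def intro!: openin_Int openin_over N.openin_chart_preimage cot_chart_max atlas_in_max)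
  moreover have "\<exists>W\<in>F ` (\<B>' \<times> \<O>). x \<in> W \<and> W \<subseteq> U" if U: "openin (manifold_topology ?N) U" "x \<in> U" for U x
  proof -
    have x: "x \<in> mcarrier ?N" using U N.openin_manifold by blast
    then obtain c where c: "c \<in> A" "fst x \<in> fst c"
      using mcarrier_chart[of "fst x"] unfolding mcarrier_cotangent by blast
    obtain V where V: "V \<in> \<B>" "fst x \<in> V" "V \<subseteq> fst c"
      using B(3)[OF openin_chart[OF atlas_in_max[OF c(1)]] c(2)] by blast
    then have V': "V \<in> \<B>'" using c(1) by (auto simp: \<B>'_def)
    let ?c = "cot_chart (ch V)"
    have chm: "ch V \<in> max_atlas A" using ch(1)[OF V'] by (rule atlas_in_max)
    have xc: "x \<in> fst ?c" using ch(2)[OF V'] V(2) x by (auto simp: mem_cot_chart mcarrier_cotangent)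
    have "open (snd ?c ` (U \<inter> fst ?c))"
      by (rule N.open_chart_image[OF U(1) cot_chart_max[OF chm]])
    then obtain Y where Y: "Y \<in> \<O>" "snd ?c x \<in> Y" "Y \<subseteq> snd ?c ` (U \<inter> fst ?c)"
      using O(3) U(2) xc by (metis IntI image_eqI)
    have "x \<in> F (V, Y)" using V x xc Y by (simp add: F_def)
    moreover have "F (V, Y) \<subseteq> U"
    proof
      fix y assume "y \<in> F (V, Y)"
      then have y: "y \<in> fst ?c" "snd ?c y \<in> snd ?c ` (U \<inter> fst ?c)" using Y by (auto simp: F_def)
      from y(2) obtain z where "z \<in> U" "z \<in> fst ?c" "snd ?c y = snd ?c z" by blast
      then show "y \<in> U" using chart_inv_left[OF cot_chart_is_chart[OF chm]] y(1) by metis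
    qed
    ultimately show ?thesis using V' Y(1) by (intro bexI[of _ "F (V, Y)"]) auto
  qed
  ultimately show ?thesis
    unfolding second_countable_def by (intro exI[of _ "F ` (\<B>' \<times> \<O>)"]) blast
qed

section \<open>Smooth one-forms in charts\<close>

lemma smooth_1form_change:
  assumes W: "openin (manifold_topology A) W" and c: "c \<in> max_atlas A" and e: "e \<in> max_atlas A"
    and \<alpha>: "\<And>p. p \<in> W \<Longrightarrow> \<alpha> p \<in> cotangent_space A p"
    and s: "smooth_on (snd e ` (W \<inter> fst e)) (\<lambda>x. covec_coords A e (chart_inv e x) (\<alpha> (chart_inv e x)))"
  shows "smooth_on (snd c ` (W \<inter> fst e \<inter> fst c)) (\<lambda>x. covec_coords A c (chart_inv c x) (\<alpha> (chart_inv c x)))"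
proof -
  let ?S = "snd c ` (W \<inter> fst e \<inter> fst c)"
  have S: "open ?S" by (rule open_image_Int[OF W c e])
  have S': "smooth_on ?S (snd e \<circ> chart_inv c)"
    by (rule smooth_on_subset[OF smooth_transition[OF c e]]) blast
  have g: "smooth_on ?S (\<lambda>x. frechet_derivative (snd e \<circ> chart_inv c) (at x) b)" for b
    by (rule smooth_on_frechet_along[OF S S' smooth_on_const[OF S]])
  define h where "h = (\<lambda>x. covec_coords A e (chart_inv e x) (\<alpha> (chart_inv e x)))"
  have h: "smooth_on ?S (\<lambda>x. h ((snd e \<circ> chart_inv c) x))"
    using smooth_pullback_change[OF W c e s] unfolding h_def .
  have "smooth_on ?S (\<lambda>x. \<Sum>b\<in>Basis. (h ((snd e \<circ> chart_inv c) x) \<bullet>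
      frechet_derivative (snd e \<circ> chart_inv c) (at x) b) *\<^sub>R b)"
    by (intro smooth_on_sum smooth_on_scaleR smooth_on_inner S smooth_on_const g h)
  then show ?thesis
  proof (rule smooth_on_eqI[OF S], clarify)
    fix p assume p: "p \<in> W" "p \<in> fst e" "p \<in> fst c"
    with c e have pc: "c \<in> charts_at A p" "e \<in> charts_at A p" by (auto simp: charts_at_iff)
    from covec_coords_change[OF \<alpha>[OF p(1)] pc(2,1)] p c e
    show "covec_coords A c (chart_inv c (snd c p)) (\<alpha> (chart_inv c (snd c p))) =
      (\<Sum>b\<in>Basis. (h ((snd e \<circ> chart_inv c) (snd c p)) \<bullet>
      frechet_derivative (snd e \<circ> chart_inv c) (at (snd c p)) b) *\<^sub>R b)" by (simp add: h_def)
  qed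
qed

lemma smooth_1formD:
  assumes U: "openin (manifold_topology A) U" and \<alpha>: "smooth_1form A U \<alpha>" and c: "c \<in> max_atlas A"
  shows "smooth_on (snd c ` (U \<inter> fst c)) (\<lambda>x. covec_coords A c (chart_inv c x) (\<alpha> (chart_inv c x)))"
proof (rule smooth_on_local, clarify)
  fix p assume p: "p \<in> U" "p \<in> fst c"
  then obtain e where e: "e \<in> A" "p \<in> fst e" using max_atlas_carrier[OF c] mcarrier_chart by blast
  have "smooth_on (snd c ` (U \<inter> fst e \<inter> fst c)) (\<lambda>x. covec_coords A c (chart_inv c x) (\<alpha> (chart_inv c x)))"
    using \<alpha> e(1) by (intro smooth_1form_change[OF U c atlas_in_max]) (auto simp: smooth_1form_def)
  with p e open_image_Int[OF U c atlas_in_max[OF e(1)]]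
  show "\<exists>T. open T \<and> snd c p \<in> T \<and> smooth_on T (\<lambda>x. covec_coords A c (chart_inv c x) (\<alpha> (chart_inv c x)))" by blast
qed

text \<open>Produces one-forms with prescribed components in one chart; the sections that realise
  horizontal vectors are built in this way.\<close>

lemma smooth_covec:
  assumes U: "openin (manifold_topology A) U" and e: "e \<in> max_atlas A" "U \<subseteq> fst e"
    and a: "smooth_on (snd e ` U) a"
  shows "smooth_1form A U (\<lambda>q. covec e q (a (snd e q)))"
  unfolding smooth_1form_def
proof (intro conjI ballI)
  fix p assume "p \<in> U"
  then show "covec e p (a (snd e p)) \<in> cotangent_space A p"
    using e by (intro covec_in) (auto simp: charts_at_iff)
next
  have o: "open (snd e ` U)" using open_chart_image[OF U e(1)] e(2) by (simp add: Int_absorb2)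
  have s: "smooth_on (snd e ` (U \<inter> fst e)) (\<lambda>x. covec_coords A e (chart_inv e x) (covec e (chart_inv e x) (a (snd e (chart_inv e x)))))"
    unfolding Int_absorb2[OF e(2)]
  proof (rule smooth_on_eqI[OF o a], clarify)
    fix p assume "p \<in> U"
    with e have "p \<in> fst e" "e \<in> charts_at A p" by (auto simp: charts_at_iff)
    then show "covec_coords A e (chart_inv e (snd e p)) (covec e (chart_inv e (snd e p)) (a (snd e (chart_inv e (snd e p))))) = a (snd e p)"
      using e by simp
  qed
  fix c assume "c \<in> A"
  then have c: "c \<in> max_atlas A" by (rule atlas_in_max)
  have "smooth_on (snd c ` (U \<inter> fst e \<inter> fst c)) (\<lambda>x. covec_coords A c (chart_inv c x) (covec e (chart_inv c x) (a (snd e (chart_inv c x)))))"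
    by (rule smooth_1form_change[OF U c e(1) _ s]) (use e in \<open>auto intro!: covec_in simp: charts_at_iff\<close>)
  then show "smooth_on (snd c ` (U \<inter> fst c)) (\<lambda>x. covec_coords A c (chart_inv c x) (covec e (chart_inv c x) (a (snd e (chart_inv c x)))))"
    using e(2) by (simp add: Int_absorb2)
qed

end

section \<open>Connections in a chart\<close>

lemma linear_Basis_sumI:
  fixes f :: "'a::euclidean_space \<Rightarrow> 'b::real_vector"
  assumes "\<And>v. f v = (\<Sum>b\<in>Basis. (v \<bullet> b) *\<^sub>R g b)"
  shows "linear f"
  by (rule linearI) (simp_all add: assms inner_add_left scaleR_add_left sum.distrib scaleR_sum_right)

lemma sum_fun_apply: "(\<Sum>i\<in>I. f i) x = (\<Sum>i\<in>I. f i x)"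
  by (induction I rule: infinite_finite_induct) auto

context smooth_atlas_on
begin

lemma smooth_vfield_subset:
  "smooth_vfield A U X \<Longrightarrow> W \<subseteq> U \<Longrightarrow> smooth_vfield A W X"
  unfolding smooth_vfield_def by (blast intro: smooth_on_subset)

lemma smooth_vfield_add:
  assumes U: "openin (manifold_topology A) U" and X: "smooth_vfield A U X" and Y: "smooth_vfield A U Y"
  shows "smooth_vfield A U (\<lambda>q. X q + Y q)"
  unfolding smooth_vfield_def
proof (intro conjI ballI)
  fix p assume p: "p \<in> U"
  then have "p \<in> mcarrier A" using U openin_manifold by blast
  then obtain c where "c \<in> charts_at A p" using some_chart_at by blast
  then show "X p + Y p \<in> tangent_space A p"
    using smooth_vfield_tangent[OF X p] smooth_vfield_tangent[OF Y p] by (rule tangent_add)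
next
  fix c assume c: "c \<in> A"
  then have "smooth_on (snd c ` (U \<inter> fst c)) (\<lambda>x. X (chart_inv c x) c + Y (chart_inv c x) c)"
    by (intro smooth_on_add open_chart_image[OF U] atlas_in_max c)
      (use X Y c in \<open>unfold smooth_vfield_def, blast+\<close>)
  then show "smooth_on (snd c ` (U \<inter> fst c)) (\<lambda>x. (X (chart_inv c x) + Y (chart_inv c x)) c)" by simp
qed

lemma smooth_vfield_scaleR:
  assumes U: "openin (manifold_topology A) U" and X: "smooth_vfield A U X" and f: "smooth_fun A U f"
  shows "smooth_vfield A U (\<lambda>q. f q *\<^sub>R X q)"
  unfolding smooth_vfield_def
proof (intro conjI ballI)
  fix p assume p: "p \<in> U"
  then have "p \<in> mcarrier A" using U openin_manifold by blast
  then obtain c where "c \<in> charts_at A p" using some_chart_at by blast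
  then show "f p *\<^sub>R X p \<in> tangent_space A p"
    using smooth_vfield_tangent[OF X p] by (rule tangent_scaleR)
next
  fix c assume c: "c \<in> A"
  then have "smooth_on (snd c ` (U \<inter> fst c)) (\<lambda>x. (f \<circ> chart_inv c) x *\<^sub>R X (chart_inv c x) c)"
    by (intro smooth_on_scaleR open_chart_image[OF U] atlas_in_max c)
      (use X f c in \<open>unfold smooth_vfield_def smooth_fun_def, blast+\<close>)
  then show "smooth_on (snd c ` (U \<inter> fst c)) (\<lambda>x. (f (chart_inv c x) *\<^sub>R X (chart_inv c x)) c)" by simp
qed

lemma smooth_vfield_zero:
  assumes U: "openin (manifold_topology A) U" shows "smooth_vfield A U (\<lambda>q. 0)"
  unfolding smooth_vfield_def
proof (intro conjI ballI)
  fix p assume p: "p \<in> U"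
  then have "p \<in> mcarrier A" using U openin_manifold by blast
  then obtain c where "c \<in> charts_at A p" using some_chart_at by blast
  then show "0 \<in> tangent_space A p" by (rule tangent_zero)
next
  fix c assume c: "c \<in> A"
  then show "smooth_on (snd c ` (U \<inter> fst c)) (\<lambda>x. (0 :: ('a, 'e) tvec) c)"
    by (simp add: smooth_on_const open_chart_image[OF U] atlas_in_max)
qed

lemma smooth_vfield_sum:
  assumes U: "openin (manifold_topology A) U"
    and "\<And>i. i \<in> I \<Longrightarrow> smooth_vfield A U (X i)" "\<And>i. i \<in> I \<Longrightarrow> smooth_fun A U (f i)"
  shows "smooth_vfield A U (\<lambda>q. \<Sum>i\<in>I. f i q *\<^sub>R X i q)"
  using assms(2,3)
  by (induction I rule: infinite_finite_induct)
    (simp_all add: smooth_vfield_zero[OF U] smooth_vfield_add[OF U] smooth_vfield_scaleR[OF U])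

lemma smooth_coord_const:
  "c \<in> max_atlas A \<Longrightarrow> openin (manifold_topology A) U \<Longrightarrow> U \<subseteq> fst c \<Longrightarrow>
    smooth_vfield A U (\<lambda>q. coord_tvec A c q a)"
  by (rule smooth_coord_tvec[where a="\<lambda>_. a"])
    (auto intro!: smooth_on_const dest: open_chart_image simp: Int_absorb2)

lemma smooth_fun_component:
  assumes U: "openin (manifold_topology A) U" and c: "c \<in> max_atlas A" "U \<subseteq> fst c" and Y: "smooth_vfield A U Y"
  shows "smooth_fun A U (\<lambda>q. Y q c \<bullet> b)"
proof (rule smooth_funI[OF U c])
  have "open (snd c ` U)" using open_chart_image[OF U c(1)] c(2) by (simp add: Int_absorb2)
  moreover have "smooth_on (snd c ` U) (\<lambda>x. Y (chart_inv c x) c)"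
    using smooth_vfieldD[OF U Y c(1)] c(2) by (simp add: Int_absorb2)
  ultimately show "smooth_on (snd c ` U) ((\<lambda>q. Y q c \<bullet> b) \<circ> chart_inv c)"
    unfolding o_def by (intro smooth_on_inner smooth_on_const)
qed

lemma vfield_expand:
  assumes c: "c \<in> charts_at A q" and v: "v \<in> tangent_space A q"
  shows "v = (\<Sum>b\<in>Basis. (v c \<bullet> b) *\<^sub>R coord_tvec A c q b)"
  using tangent_eq_coord_tvec[OF v c] linear_expand_Basis[OF linear_coord_tvec[OF c], of "v c"] by simp

end

text \<open>One chart on each side suffices: near \<open>p\<close> the map stays inside
  \<open>fst d\<close>, so its expression in any other target chart is the expression in
  \<open>d\<close> followed by a coordinate change.\<close>

lemma differential_coord:
  assumes "smooth_atlas_on A" "smooth_atlas_on B"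
    and c: "c \<in> charts_at A p" and d: "d \<in> charts_at B (F p)" and v: "v \<in> tangent_space A p"
    and W: "openin (manifold_topology A) W" "p \<in> W" "F ` W \<subseteq> fst d"
    and f: "(snd d \<circ> F \<circ> chart_inv c) differentiable (at (snd c p))"
  shows "differential A B F p v =
    coord_tvec B d (F p) (frechet_derivative (snd d \<circ> F \<circ> chart_inv c) (at (snd c p)) (v c))"
proof
  interpret A: smooth_atlas_on A by fact
  interpret B: smooth_atlas_on B by fact
  fix e
  show "differential A B F p v e =
    coord_tvec B d (F p) (frechet_derivative (snd d \<circ> F \<circ> chart_inv c) (at (snd c p)) (v c)) e"
  proof (cases "e \<in> charts_at B (F p)")
    case False
    then show ?thesis by (simp add: differential_def coord_tvec_def)
  next
    case e: True
    have cm: "c \<in> max_atlas A" "p \<in> fst c" using c by (auto simp: A.charts_at_iff)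
    have dm: "d \<in> max_atlas B" using d by (simp add: B.charts_at_iff)
    let ?f = "snd d \<circ> F \<circ> chart_inv c" and ?t = "snd e \<circ> chart_inv d"
    have eq: "?f (snd c p) = snd d (F p)" using cm by simp
    have "((\<lambda>x. ?t (?f x)) has_derivative (\<lambda>v. frechet_derivative ?t (at (snd d (F p)))
        (frechet_derivative ?f (at (snd c p)) v))) (at (snd c p))"
      by (rule has_derivative_compose[OF has_derivative_frechet[OF f]])
        (unfold eq, rule B.transition_derivative[OF d e])
    moreover have "?t (?f x) = (snd e \<circ> F \<circ> chart_inv c) x" if "x \<in> snd c ` (W \<inter> fst c)" for x
      using that W cm dm by auto
    ultimately have D: "((snd e \<circ> F \<circ> chart_inv c) has_derivative (\<lambda>v. frechet_derivative ?t (at (snd d (F p)))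
        (frechet_derivative ?f (at (snd c p)) v))) (at (snd c p))"
      using has_derivative_cong_open[OF A.open_chart_image[OF W(1) cm(1)], of "snd c p" "\<lambda>x. ?t (?f x)" "snd e \<circ> F \<circ> chart_inv c"]
        cm W(2) by blast
    have "(snd e \<circ> F \<circ> chart_inv c) differentiable (at (snd c p))" using D unfolding differentiable_def by blast
    from A.differential_chart[where F=F, OF c v e this] frechet_derivative_eqI[OF D] B.coord_tvec_apply[OF e]
    show ?thesis by simp
  qed
qed

section \<open>Coordinate expression of a connection\<close>

locale connection_on = smooth_atlas_on A for A :: "('a, 'e::euclidean_space) chart set" +
  fixes nabla :: "('a, 'e) vfield \<Rightarrow> ('a, 'e) vfield \<Rightarrow> ('a, 'e) vfield"
  assumes conn: "connection A nabla"
begin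

interpretation N: smooth_atlas_on "cotangent_atlas A" by (rule smooth_atlas_cotangent)

lemmas connD = conn[unfolded connection_def, rule_format]

lemmas nabla_smooth = connD[THEN conjunct1]

lemma nabla_cong:
  assumes "openin (manifold_topology A) U" "smooth_vfield A U X" "smooth_vfield A U Y"
    "smooth_vfield A U X'" "smooth_vfield A U Y'" "\<And>q. q \<in> U \<Longrightarrow> X' q = X q" "\<And>q. q \<in> U \<Longrightarrow> Y' q = Y q" "p \<in> U"
  shows "nabla X' Y' p = nabla X Y p"
  by (rule connD[OF assms(1-3), THEN conjunct2, THEN conjunct1, rule_format, OF assms(4,5) _ assms(8)])
    (simp add: assms(6,7))

lemma nabla_add1:
  assumes "openin (manifold_topology A) U" "smooth_vfield A U X" "smooth_vfield A U Y" "smooth_vfield A U X'" "p \<in> U"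
  shows "nabla (\<lambda>q. X q + X' q) Y p = nabla X Y p + nabla X' Y p"
  by (rule connD[OF assms(1-3), THEN conjunct2, THEN conjunct2, THEN conjunct1, rule_format, OF assms(4,5)])

lemma nabla_add2:
  assumes "openin (manifold_topology A) U" "smooth_vfield A U X" "smooth_vfield A U Y" "smooth_vfield A U Y'" "p \<in> U"
  shows "nabla X (\<lambda>q. Y q + Y' q) p = nabla X Y p + nabla X Y' p"
  by (rule connD[OF assms(1-3), THEN conjunct2, THEN conjunct2, THEN conjunct2, THEN conjunct1, rule_format, OF assms(4,5)])

lemma nabla_scaleR:
  assumes "openin (manifold_topology A) U" "smooth_vfield A U X" "smooth_vfield A U Y" "smooth_fun A U f" "p \<in> U"
  shows nabla_scaleR1: "nabla (\<lambda>q. f q *\<^sub>R X q) Y p = f p *\<^sub>R nabla X Y p"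
    and nabla_scaleR2: "nabla X (\<lambda>q. f q *\<^sub>R Y q) p = dir_deriv A p (X p) f *\<^sub>R Y p + f p *\<^sub>R nabla X Y p"
  using connD[OF assms(1-3), THEN conjunct2, THEN conjunct2, THEN conjunct2, THEN conjunct2, rule_format, OF assms(4,5)]
  by blast+

lemma nabla_sum1:
  assumes U: "openin (manifold_topology A) U" and Y: "smooth_vfield A U Y" and p: "p \<in> U" and I: "finite I"
    and X: "\<And>i. i \<in> I \<Longrightarrow> smooth_vfield A U (X i)" "\<And>i. i \<in> I \<Longrightarrow> smooth_fun A U (f i)"
  shows "nabla (\<lambda>q. \<Sum>i\<in>I. f i q *\<^sub>R X i q) Y p = (\<Sum>i\<in>I. f i p *\<^sub>R nabla (X i) Y p)"
  using I X
proof (induction I rule: finite_induct)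
  case empty
  \<comment> \<open>Additivity applied to 0 = 0 + 0.\<close>
  have "nabla (\<lambda>q. 0) Y p = 0"
    using nabla_add1[OF U smooth_vfield_zero[OF U] Y smooth_vfield_zero[OF U] p] by simp
  then show ?case by (simp only: sum.empty)
next
  case (insert i I)
  have s: "smooth_vfield A U (X i)" "smooth_fun A U (f i)"
    "\<And>j. j \<in> I \<Longrightarrow> smooth_vfield A U (X j)" "\<And>j. j \<in> I \<Longrightarrow> smooth_fun A U (f j)"
    using insert.prems by blast+
  have "nabla (\<lambda>q. f i q *\<^sub>R X i q + (\<Sum>j\<in>I. f j q *\<^sub>R X j q)) Y p =
      nabla (\<lambda>q. f i q *\<^sub>R X i q) Y p + nabla (\<lambda>q. \<Sum>j\<in>I. f j q *\<^sub>R X j q) Y p"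
    by (rule nabla_add1[OF U smooth_vfield_scaleR[OF U s(1,2)] Y smooth_vfield_sum[OF U s(3,4)] p])
  then show ?case
    by (simp only: sum.insert[OF insert.hyps] nabla_scaleR1[OF U s(1) Y s(2) p] insert.IH[OF s(3,4)])
qed

lemma nabla_sum2:
  assumes U: "openin (manifold_topology A) U" and X: "smooth_vfield A U X" and p: "p \<in> U" and I: "finite I"
    and Y: "\<And>i. i \<in> I \<Longrightarrow> smooth_vfield A U (Y i)" "\<And>i. i \<in> I \<Longrightarrow> smooth_fun A U (f i)"
  shows "nabla X (\<lambda>q. \<Sum>i\<in>I. f i q *\<^sub>R Y i q) p =
    (\<Sum>i\<in>I. dir_deriv A p (X p) (f i) *\<^sub>R Y i p + f i p *\<^sub>R nabla X (Y i) p)"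
  using I Y
proof (induction I rule: finite_induct)
  case empty
  have "nabla X (\<lambda>q. 0) p = 0"
    using nabla_add2[OF U X smooth_vfield_zero[OF U] smooth_vfield_zero[OF U] p] by simp
  then show ?case by (simp only: sum.empty)
next
  case (insert i I)
  have s: "smooth_vfield A U (Y i)" "smooth_fun A U (f i)"
    "\<And>j. j \<in> I \<Longrightarrow> smooth_vfield A U (Y j)" "\<And>j. j \<in> I \<Longrightarrow> smooth_fun A U (f j)"
    using insert.prems by blast+
  have "nabla X (\<lambda>q. f i q *\<^sub>R Y i q + (\<Sum>j\<in>I. f j q *\<^sub>R Y j q)) p =
      nabla X (\<lambda>q. f i q *\<^sub>R Y i q) p + nabla X (\<lambda>q. \<Sum>j\<in>I. f j q *\<^sub>R Y j q) p"
    by (rule nabla_add2[OF U X smooth_vfield_scaleR[OF U s(1,2)] smooth_vfield_sum[OF U s(3,4)] p])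
  then show ?case
    by (simp only: sum.insert[OF insert.hyps] nabla_scaleR2[OF U X s(1,2) p] insert.IH[OF s(3,4)])
qed

text \<open>The Christoffel symbol, as a map of two vectors of the model space in place of an array
  of components.\<close>

definition chris :: "('a, 'e) chart \<Rightarrow> 'a \<Rightarrow> 'e \<Rightarrow> 'e \<Rightarrow> 'e" where
  "chris c p v w = nabla (\<lambda>q. coord_tvec A c q v) (\<lambda>q. coord_tvec A c q w) p c"

lemma coord_const_field:
  "c \<in> max_atlas A \<Longrightarrow> x \<in> snd c ` fst c \<Longrightarrow> coord_tvec A c (chart_inv c x) w c = w"
  using coord_tvec_self[of c "chart_inv c x" w] chart_inv_in[of c x] by (simp add: charts_at_iff max_atlas_is_chart)

text \<open>The direction enters tensorially: on \<open>U\<close> the field \<open>X\<close> is a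
  combination of coordinate fields with smooth coefficients, and these come out
  undifferentiated.\<close>

lemma chris_sum1:
  assumes c: "c \<in> charts_at A p" and U: "openin (manifold_topology A) U" "U \<subseteq> fst c" "p \<in> U"
    and X: "smooth_vfield A U X" and Y: "smooth_vfield A U Y"
  shows "nabla X Y p = (\<Sum>b\<in>Basis. (X p c \<bullet> b) *\<^sub>R nabla (\<lambda>q. coord_tvec A c q b) Y p)"
proof -
  have cm: "c \<in> max_atlas A" using c by (simp add: charts_at_iff)
  let ?X = "\<lambda>q. \<Sum>b\<in>Basis. (X q c \<bullet> b) *\<^sub>R coord_tvec A c q b"
  note s = smooth_coord_const[OF cm U(1,2)] smooth_fun_component[OF U(1) cm U(2) X]
  have "nabla X Y p = nabla ?X Y p"
  proof (rule nabla_cong[OF U(1) smooth_vfield_sum[OF U(1) s] Y X Y _ _ U(3)])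
    fix q assume q: "q \<in> U"
    then have "c \<in> charts_at A q" using cm U(2) by (auto simp: charts_at_iff)
    from vfield_expand[OF this smooth_vfield_tangent[OF X q]] show "X q = ?X q" .
  qed auto
  also have "\<dots> = (\<Sum>b\<in>Basis. (X p c \<bullet> b) *\<^sub>R nabla (\<lambda>q. coord_tvec A c q b) Y p)"
    by (rule nabla_sum1[OF U(1) Y U(3) finite_Basis s])
  finally show ?thesis .
qed

text \<open>Here the Leibniz rule differentiates the coefficients of \<open>Y\<close>; these
  derivatives reassemble to the ordinary derivative of the coordinate expression of
  \<open>Y\<close>.\<close>

lemma chris_sum2:
  assumes c: "c \<in> charts_at A p" and U: "openin (manifold_topology A) U" "U \<subseteq> fst c" "p \<in> U"
    and X: "smooth_vfield A U X" and Y: "smooth_vfield A U Y"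
  shows "nabla X Y p c = frechet_derivative (\<lambda>x. Y (chart_inv c x) c) (at (snd c p)) (X p c)
    + (\<Sum>b\<in>Basis. (Y p c \<bullet> b) *\<^sub>R nabla X (\<lambda>q. coord_tvec A c q b) p c)"
proof -
  have cm: "c \<in> max_atlas A" using c by (simp add: charts_at_iff)
  let ?Y = "\<lambda>q. \<Sum>b\<in>Basis. (Y q c \<bullet> b) *\<^sub>R coord_tvec A c q b"
  let ?D = "frechet_derivative (\<lambda>x. Y (chart_inv c x) c) (at (snd c p)) (X p c)"
  note s = smooth_coord_const[OF cm U(1,2)] smooth_fun_component[OF U(1) cm U(2) Y]
  have "nabla X Y p = nabla X ?Y p"
  proof (rule nabla_cong[OF U(1) X smooth_vfield_sum[OF U(1) s] X Y _ _ U(3)])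
    fix q assume q: "q \<in> U"
    then have "c \<in> charts_at A q" using cm U(2) by (auto simp: charts_at_iff)
    from vfield_expand[OF this smooth_vfield_tangent[OF Y q]] show "Y q = ?Y q" .
  qed auto
  also have "\<dots> = (\<Sum>b\<in>Basis. dir_deriv A p (X p) (\<lambda>q. Y q c \<bullet> b) *\<^sub>R coord_tvec A c p b
      + (Y p c \<bullet> b) *\<^sub>R nabla X (\<lambda>q. coord_tvec A c q b) p)"
    by (rule nabla_sum2[OF U(1) X U(3) finite_Basis s])
  finally have "nabla X Y p c = (\<Sum>b\<in>Basis. dir_deriv A p (X p) (\<lambda>q. Y q c \<bullet> b) *\<^sub>R coord_tvec A c p b
      + (Y p c \<bullet> b) *\<^sub>R nabla X (\<lambda>q. coord_tvec A c q b) p) c" by (rule fun_cong)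
  also have "\<dots> = (\<Sum>b\<in>Basis. (?D \<bullet> b) *\<^sub>R b + (Y p c \<bullet> b) *\<^sub>R nabla X (\<lambda>q. coord_tvec A c q b) p c)"
  proof -
    have "dir_deriv A p (X p) (\<lambda>q. Y q c \<bullet> b) = ?D \<bullet> b" for b
    proof -
      have "((\<lambda>x. Y (chart_inv c x) c) has_derivative frechet_derivative (\<lambda>x. Y (chart_inv c x) c) (at (snd c p))) (at (snd c p))"
        by (rule smooth_on_derivative[OF smooth_vfieldD[OF U(1) Y cm]]) (use U in auto)
      from has_derivative_inner_left[OF this, of b]
      have D: "((\<lambda>q. Y q c \<bullet> b) \<circ> chart_inv c has_derivative
         (\<lambda>v. frechet_derivative (\<lambda>x. Y (chart_inv c x) c) (at (snd c p)) v \<bullet> b)) (at (snd c p))"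
        by (simp add: o_def)
      then have "((\<lambda>q. Y q c \<bullet> b) \<circ> chart_inv c) differentiable (at (snd c p))" unfolding differentiable_def by blast
      from dir_deriv_chart[OF c smooth_vfield_tangent[OF X U(3)] this] frechet_derivative_eqI[OF D]
      show ?thesis by simp
    qed
    then show ?thesis using c unfolding sum_fun_apply plus_fun_apply scaleR_fun_apply by (simp only: coord_tvec_self)
  qed
  finally show ?thesis unfolding sum.distrib euclidean_representation .
qed

lemma chris_linear1: "c \<in> charts_at A p \<Longrightarrow> linear (\<lambda>v. chris c p v w)"
proof -
  assume c: "c \<in> charts_at A p"
  then have cm: "c \<in> max_atlas A" "p \<in> fst c" by (auto simp: charts_at_iff)
  have "chris c p v w = (\<Sum>b\<in>Basis. (v \<bullet> b) *\<^sub>R chris c p b w)" for v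
    using chris_sum1[OF c openin_chart[OF cm(1)] subset_refl cm(2) smooth_coord_const[OF cm(1) openin_chart[OF cm(1)] subset_refl, of v]
        smooth_coord_const[OF cm(1) openin_chart[OF cm(1)] subset_refl, of w]] c
    by (simp add: chris_def sum_fun_apply)
  then show ?thesis by (rule linear_Basis_sumI)
qed

lemma chris_linear2: "c \<in> charts_at A p \<Longrightarrow> linear (\<lambda>w. chris c p v w)"
proof -
  assume c: "c \<in> charts_at A p"
  then have cm: "c \<in> max_atlas A" "p \<in> fst c" by (auto simp: charts_at_iff)
  have "chris c p v w = (\<Sum>b\<in>Basis. (w \<bullet> b) *\<^sub>R chris c p v b)" for w
  proof -
    have "((\<lambda>x. coord_tvec A c (chart_inv c x) w c) has_derivative (\<lambda>_. 0)) (at (snd c p))"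
    proof (rule iffD1[OF has_derivative_cong_open[OF open_chart[OF cm(1)]] has_derivative_const])
      show "w = coord_tvec A c (chart_inv c y) w c" if "y \<in> snd c ` fst c" for y
        using coord_const_field[OF cm(1) that] by simp
    qed (use cm in blast)
    from frechet_derivative_eqI[OF this] show ?thesis
      using chris_sum2[OF c openin_chart[OF cm(1)] subset_refl cm(2) smooth_coord_const[OF cm(1) openin_chart[OF cm(1)] subset_refl, of v]
        smooth_coord_const[OF cm(1) openin_chart[OF cm(1)] subset_refl, of w]] c
      by (simp add: chris_def)
  qed
  then show ?thesis by (rule linear_Basis_sumI)
qed

text \<open>The expansions hold only where \<open>c\<close> is defined, so \<open>U\<close> is
  replaced by \<open>U \<inter> fst c\<close>. The value of \<open>nabla X Y\<close> at
  \<open>p\<close> does not refer to the open set, because fields are total functions.\<close>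

lemma nabla_chart:
  assumes c: "c \<in> charts_at A p" and U: "openin (manifold_topology A) U" "p \<in> U"
    and X: "smooth_vfield A U X" and Y: "smooth_vfield A U Y"
  shows "nabla X Y p c = frechet_derivative (\<lambda>x. Y (chart_inv c x) c) (at (snd c p)) (X p c)
    + chris c p (X p c) (Y p c)"
proof -
  have cm: "c \<in> max_atlas A" "p \<in> fst c" using c by (auto simp: charts_at_iff)
  let ?U = "U \<inter> fst c"
  have U': "openin (manifold_topology A) ?U" "?U \<subseteq> fst c" "p \<in> ?U"
    using U cm openin_chart[OF cm(1)] by auto
  have X': "smooth_vfield A ?U X" and Y': "smooth_vfield A ?U Y"
    using X Y by (auto intro: smooth_vfield_subset)
  have "nabla X (\<lambda>q. coord_tvec A c q b) p c = chris c p (X p c) b" for b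
    using chris_sum1[OF c U' X' smooth_coord_const[OF cm(1) U'(1,2), of b]]
      linear_expand_Basis[OF chris_linear1[OF c], of "X p c" b]
    by (simp add: chris_def sum_fun_apply)
  then show ?thesis
    using chris_sum2[OF c U' X' Y'] linear_expand_Basis[OF chris_linear2[OF c], of "X p c" "Y p c"] by simp
qed

lemma smooth_chris:
  assumes c: "c \<in> max_atlas A"
  shows "smooth_on (snd c ` fst c) (\<lambda>x. chris c (chart_inv c x) v w)"
proof -
  note U = openin_chart[OF c]
  have "smooth_vfield A (fst c) (nabla (\<lambda>q. coord_tvec A c q v) (\<lambda>q. coord_tvec A c q w))"
    by (intro nabla_smooth U smooth_coord_const c subset_refl)
  from smooth_vfieldD[OF U this c] show ?thesis by (simp add: chris_def)
qed

subsection \<open>Horizontal and vertical lifts\<close>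

text \<open>The fibre component of the horizontal lift to \<open>x\<close> of the vector with coordinates \<open>a\<close>.\<close>
definition hor :: "('a, 'e) chart \<Rightarrow> 'a \<times> ('a, 'e) covec \<Rightarrow> 'e \<Rightarrow> 'e" where
  "hor c x a = (\<Sum>b\<in>Basis. (covec_coords A c (fst x) (snd x) \<bullet> chris c (fst x) a b) *\<^sub>R b)"

lemma linear_hor: "c \<in> charts_at A (fst x) \<Longrightarrow> linear (hor c x)"
  using linear_add[OF chris_linear1] linear_scale[OF chris_linear1]
  by (simp add: linear_iff hor_def inner_add_right scaleR_add_left sum.distrib scaleR_sum_right)

text \<open>Characterises \<open>hor\<close> without a basis, as the covector \<xi> o \<Gamma>(a, -)
  read through the real inner product.\<close>

lemma inner_hor:
  assumes c: "c \<in> charts_at A (fst x)"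
  shows "hor c x a \<bullet> w = covec_coords A c (fst x) (snd x) \<bullet> chris c (fst x) a w"
proof -
  have "covec_coords A c (fst x) (snd x) \<bullet> chris c (fst x) a w =
      (\<Sum>b\<in>Basis. (w \<bullet> b) * (covec_coords A c (fst x) (snd x) \<bullet> chris c (fst x) a b))"
    by (subst linear_expand_Basis[OF chris_linear2[OF c], of a w]) (simp add: inner_sum_right)
  then show ?thesis by (simp add: hor_def inner_sum_left inner_sum_right inner_commute[of _ w] mult.commute)
qed

text \<open>In the induced chart the section is the graph x -> (x, a x) of its components.\<close>

lemma differential_section:
  assumes c: "c \<in> charts_at A p" and U: "openin (manifold_topology A) U" "p \<in> U"
    and \<alpha>: "smooth_1form A U \<alpha>" and v: "v \<in> tangent_space A p"
  shows "differential A (cotangent_atlas A) (\<lambda>q. (q, \<alpha> q)) p v =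
    coord_tvec (cotangent_atlas A) (cot_chart c) (p, \<alpha> p)
      (v c, frechet_derivative (\<lambda>x. covec_coords A c (chart_inv c x) (\<alpha> (chart_inv c x))) (at (snd c p)) (v c))"
proof -
  have cm: "c \<in> max_atlas A" "p \<in> fst c" using c by (auto simp: charts_at_iff)
  let ?W = "U \<inter> fst c"
  let ?a = "\<lambda>x. covec_coords A c (chart_inv c x) (\<alpha> (chart_inv c x))"
  have W: "openin (manifold_topology A) ?W" "p \<in> ?W" using U cm openin_chart[OF cm(1)] by auto
  have \<alpha>c: "\<And>q. q \<in> U \<Longrightarrow> \<alpha> q \<in> cotangent_space A q" using \<alpha> by (simp add: smooth_1form_def)
  have sub: "(\<lambda>q. (q, \<alpha> q)) ` ?W \<subseteq> fst (cot_chart c)" using \<alpha>c by (auto simp: mem_cot_chart)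
  have at: "cot_chart c \<in> charts_at (cotangent_atlas A) (p, \<alpha> p)"
    using cot_chart_max[OF cm(1)] sub W by (auto simp: N.charts_at_iff)
  have "(?a has_derivative frechet_derivative ?a (at (snd c p))) (at (snd c p))"
    by (rule smooth_on_derivative[OF smooth_1formD[OF U(1) \<alpha> cm(1)]]) (use U cm in auto)
  then have "((\<lambda>x. (x, ?a x)) has_derivative (\<lambda>v. (v, frechet_derivative ?a (at (snd c p)) v))) (at (snd c p))"
    by (intro has_derivative_Pair has_derivative_ident)
  then have D: "((snd (cot_chart c) \<circ> (\<lambda>q. (q, \<alpha> q)) \<circ> chart_inv c) has_derivative
      (\<lambda>v. (v, frechet_derivative ?a (at (snd c p)) v))) (at (snd c p))"
  proof (rule has_derivative_transform_within_open[OF _ open_chart[OF cm(1)]])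
    fix y assume "y \<in> snd c ` fst c"
    from chart_right[OF this] show "(y, ?a y) = (snd (cot_chart c) \<circ> (\<lambda>q. (q, \<alpha> q)) \<circ> chart_inv c) y"
      by (simp add: snd_cot_chart)
  qed (use cm in blast)
  have "(snd (cot_chart c) \<circ> (\<lambda>q. (q, \<alpha> q)) \<circ> chart_inv c) differentiable (at (snd c p))"
    using D unfolding differentiable_def by blast
  from differential_coord[where F="\<lambda>q. (q, \<alpha> q)", OF smooth_atlas_on_axioms N.smooth_atlas_on_axioms c at v W sub this]
    frechet_derivative_eqI[OF D]
  show ?thesis by simp
qed

lemma d_proj_chart:
  assumes c: "c \<in> charts_at A (fst x)" and x: "x \<in> mcarrier (cotangent_atlas A)"
    and w: "w \<in> tangent_space (cotangent_atlas A) x"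
  shows "d_proj A x w = coord_tvec A c (fst x) (fst (w (cot_chart c)))"
proof -
  have cm: "c \<in> max_atlas A" "fst x \<in> fst c" using c by (auto simp: charts_at_iff)
  note at = cot_chart_at[OF c x]
  note W = N.openin_chart[OF cot_chart_max[OF cm(1)]]
  have xW: "x \<in> fst (cot_chart c)" "fst ` fst (cot_chart c) \<subseteq> fst c"
    using at by (auto simp: N.charts_at_iff mem_cot_chart)
  have "((snd c \<circ> fst \<circ> chart_inv (cot_chart c)) has_derivative fst) (at (snd (cot_chart c) x)) \<longleftrightarrow>
      (fst has_derivative fst) (at (snd (cot_chart c) x))"
  proof (rule has_derivative_cong_open[OF N.open_chart[OF cot_chart_max[OF cm(1)]]])
    show "snd (cot_chart c) x \<in> snd (cot_chart c) ` fst (cot_chart c)" using xW by blast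
    fix y assume "y \<in> snd (cot_chart c) ` fst (cot_chart c)"
    then obtain z where z: "z \<in> fst (cot_chart c)" "y = snd (cot_chart c) z" by blast
    with N.chart_left[OF cot_chart_max[OF cm(1)]] show "(snd c \<circ> fst \<circ> chart_inv (cot_chart c)) y = fst y"
      by (simp add: snd_cot_chart)
  qed
  then have D: "((snd c \<circ> fst \<circ> chart_inv (cot_chart c)) has_derivative fst) (at (snd (cot_chart c) x))"
    using has_derivative_fst[OF has_derivative_ident] by blast
  have "(snd c \<circ> fst \<circ> chart_inv (cot_chart c)) differentiable (at (snd (cot_chart c) x))"
    using D unfolding differentiable_def by blast
  from differential_coord[where F=fst, OF N.smooth_atlas_on_axioms smooth_atlas_on_axioms at c w W xW this]
    frechet_derivative_eqI[OF D]
  show ?thesis by simp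
qed

text \<open>In the induced chart the defining curve is a straight line in the fibre direction,
  because \<open>covec_coords\<close> is linear.\<close>

lemma vertical_lift_chart:
  assumes c: "c \<in> charts_at A (fst x)" and x: "x \<in> mcarrier (cotangent_atlas A)"
    and \<eta>: "\<eta> \<in> cotangent_space A (fst x)"
  shows "vertical_lift A x \<eta> = coord_tvec (cotangent_atlas A) (cot_chart c) x (0, covec_coords A c (fst x) \<eta>)"
proof
  fix d
  let ?N = "cotangent_atlas A" and ?\<gamma> = "\<lambda>t. (fst x, snd x + t *\<^sub>R \<eta>)" and ?c = "cot_chart c"
  have cm: "c \<in> max_atlas A" "fst x \<in> fst c" using c by (auto simp: charts_at_iff)
  note at = cot_chart_at[OF c x]
  have 0: "?\<gamma> 0 = x" by simp
  show "vertical_lift A x \<eta> d = coord_tvec ?N ?c x (0, covec_coords A c (fst x) \<eta>) d"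
  proof (cases "d \<in> charts_at ?N x")
    case False
    then show ?thesis by (simp add: vertical_lift_def velocity_def coord_tvec_def)
  next
    case d: True
    have cc: "snd ?c (?\<gamma> t) = snd ?c x + t *\<^sub>R (0, covec_coords A c (fst x) \<eta>)" for t
      by (simp add: snd_cot_chart linear_add[OF covec_coords_linear] linear_scale[OF covec_coords_linear])
    have \<gamma>: "?\<gamma> t \<in> fst ?c" for t
      using cm \<eta> x subspace_cotangent[OF c]
      by (auto simp: mem_cot_chart mcarrier_cotangent intro!: subspace_add subspace_scale)
    have "((\<lambda>t. snd ?c x + t *\<^sub>R (0, covec_coords A c (fst x) \<eta>)) has_vector_derivative (0, covec_coords A c (fst x) \<eta>)) (at 0)"
      by (auto intro!: derivative_eq_intros)
    then have "((\<lambda>t. snd ?c (?\<gamma> t)) has_derivative (\<lambda>t. t *\<^sub>R (0, covec_coords A c (fst x) \<eta>))) (at 0)"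
      by (simp only: cc has_vector_derivative_def)
    moreover have "((snd d \<circ> chart_inv ?c) has_derivative frechet_derivative (snd d \<circ> chart_inv ?c) (at (snd ?c x))) (at (snd ?c (?\<gamma> 0)))"
      using N.transition_derivative[OF at d] by simp
    ultimately have "((\<lambda>t. (snd d \<circ> chart_inv ?c) (snd ?c (?\<gamma> t))) has_derivative
       (\<lambda>t. frechet_derivative (snd d \<circ> chart_inv ?c) (at (snd ?c x)) (t *\<^sub>R (0, covec_coords A c (fst x) \<eta>)))) (at 0)"
      by (rule has_derivative_compose)
    moreover have "(snd d \<circ> chart_inv ?c) (snd ?c (?\<gamma> t)) = snd d (?\<gamma> t)" for t
      using N.chart_left[OF cot_chart_max[OF cm(1)] \<gamma>] by simp
    ultimately have "((\<lambda>t. snd d (?\<gamma> t)) has_derivative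
       (\<lambda>t. t *\<^sub>R frechet_derivative (snd d \<circ> chart_inv ?c) (at (snd ?c x)) (0, covec_coords A c (fst x) \<eta>))) (at 0)"
      by (simp only: linear_scale[OF N.linear_transition[OF at d]])
    then have "((snd d \<circ> ?\<gamma>) has_vector_derivative frechet_derivative (snd d \<circ> chart_inv ?c) (at (snd ?c x)) (0, covec_coords A c (fst x) \<eta>)) (at 0)"
      by (simp add: has_vector_derivative_def o_def)
    from vector_derivative_at[OF this] show ?thesis
      using d by (simp add: vertical_lift_def velocity_def N.coord_tvec_apply)
  qed
qed

lemma parallel_at_chart:
  assumes c: "c \<in> charts_at A p" and U: "openin (manifold_topology A) U" "p \<in> U"
    and X: "smooth_vfield A U X" and \<alpha>: "smooth_1form A U \<alpha>"
  shows "parallel_at A nabla p X \<alpha> \<longleftrightarrow>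
    frechet_derivative (\<lambda>x. covec_coords A c (chart_inv c x) (\<alpha> (chart_inv c x))) (at (snd c p)) (X p c) = hor c (p, \<alpha> p) (X p c)"
proof -
  have cm: "c \<in> max_atlas A" "p \<in> fst c" using c by (auto simp: charts_at_iff)
  let ?a = "\<lambda>x. covec_coords A c (chart_inv c x) (\<alpha> (chart_inv c x))"
  let ?Da = "frechet_derivative ?a (at (snd c p)) (X p c)"
  have \<alpha>c: "\<And>q. q \<in> U \<Longrightarrow> \<alpha> q \<in> cotangent_space A q" using \<alpha> by (simp add: smooth_1form_def)
  have a: "(?a has_derivative frechet_derivative ?a (at (snd c p))) (at (snd c p))"
    by (rule smooth_on_derivative[OF smooth_1formD[OF U(1) \<alpha> cm(1)]]) (use U cm in auto)
  \<comment> \<open>In the expression for (\<nabla>_X \<alpha>) Y the derivatives of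
    \<open>Y\<close> cancel, so the condition depends on \<open>Y\<close> only through its value at
    \<open>p\<close>.\<close>
  have key: "dir_deriv A p (X p) (\<lambda>q. \<alpha> q (Y q)) - \<alpha> p (nabla X Y p) = (?Da - hor c (p, \<alpha> p) (X p c)) \<bullet> Y p c"
    if V: "openin (manifold_topology A) V" "p \<in> V" and Y: "smooth_vfield A V Y" for V Y
  proof -
    let ?W = "U \<inter> V \<inter> fst c"
    have W: "openin (manifold_topology A) ?W" "p \<in> ?W" using U V cm openin_chart[OF cm(1)] by auto
    have X': "smooth_vfield A ?W X" and Y': "smooth_vfield A ?W Y"
      using X Y by (auto intro: smooth_vfield_subset)
    let ?y = "\<lambda>x. Y (chart_inv c x) c"
    have y: "(?y has_derivative frechet_derivative ?y (at (snd c p))) (at (snd c p))"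
      by (rule smooth_on_derivative[OF smooth_vfieldD[OF V(1) Y cm(1)]]) (use V cm in auto)
    have "((\<lambda>x. ?a x \<bullet> ?y x) has_derivative (\<lambda>v. ?a (snd c p) \<bullet> frechet_derivative ?y (at (snd c p)) v
       + frechet_derivative ?a (at (snd c p)) v \<bullet> ?y (snd c p))) (at (snd c p))"
      by (rule has_derivative_inner[OF a y])
    moreover have "?a x \<bullet> ?y x = ((\<lambda>q. \<alpha> q (Y q)) \<circ> chart_inv c) x" if "x \<in> snd c ` (?W \<inter> fst c)" for x
    proof -
      from that obtain q where q: "q \<in> ?W" "x = snd c q" by blast
      then have "c \<in> charts_at A q" using cm by (simp add: charts_at_iff)
      from cotangent_apply[OF \<alpha>c this smooth_vfield_tangent[OF Y]] q cm show ?thesis by simp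
    qed
    ultimately have D: "((\<lambda>q. \<alpha> q (Y q)) \<circ> chart_inv c has_derivative (\<lambda>v. ?a (snd c p) \<bullet> frechet_derivative ?y (at (snd c p)) v
       + frechet_derivative ?a (at (snd c p)) v \<bullet> ?y (snd c p))) (at (snd c p))"
      using has_derivative_cong_open[OF open_chart_image[OF W(1) cm(1)], of "snd c p" "\<lambda>x. ?a x \<bullet> ?y x" "(\<lambda>q. \<alpha> q (Y q)) \<circ> chart_inv c"]
        W(2) cm by blast
    have "((\<lambda>q. \<alpha> q (Y q)) \<circ> chart_inv c) differentiable (at (snd c p))" using D unfolding differentiable_def by blast
    from dir_deriv_chart[OF c smooth_vfield_tangent[OF X U(2)] this] frechet_derivative_eqI[OF D] cm
    have "dir_deriv A p (X p) (\<lambda>q. \<alpha> q (Y q)) =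
       covec_coords A c p (\<alpha> p) \<bullet> frechet_derivative ?y (at (snd c p)) (X p c) + ?Da \<bullet> Y p c" by simp
    moreover have "\<alpha> p (nabla X Y p) = covec_coords A c p (\<alpha> p) \<bullet> frechet_derivative ?y (at (snd c p)) (X p c)
        + hor c (p, \<alpha> p) (X p c) \<bullet> Y p c"
      using cotangent_apply[OF \<alpha>c[OF U(2)] c smooth_vfield_tangent[OF nabla_smooth[OF W(1) X' Y'] W(2)]]
        nabla_chart[OF c W X' Y'] inner_hor[of c "(p, \<alpha> p)" "X p c" "Y p c"] c
      by (simp add: inner_add_right)
    ultimately show ?thesis by (simp add: inner_diff_left)
  qed
  show ?thesis
  proof
    assume par: "parallel_at A nabla p X \<alpha>"
    have "(?Da - hor c (p, \<alpha> p) (X p c)) \<bullet> b = 0" for b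
      using key[OF openin_chart[OF cm(1)] cm(2) smooth_coord_const[OF cm(1) openin_chart[OF cm(1)] subset_refl, of b]] c
        par openin_chart[OF cm(1)] cm(2) smooth_coord_const[OF cm(1) openin_chart[OF cm(1)] subset_refl, of b]
      unfolding parallel_at_def by auto
    \<comment> \<open>The difference is orthogonal to every vector, in particular to itself.\<close>
    from this[of "?Da - hor c (p, \<alpha> p) (X p c)"] show "?Da = hor c (p, \<alpha> p) (X p c)" by simp
  next
    assume "?Da = hor c (p, \<alpha> p) (X p c)"
    then show "parallel_at A nabla p X \<alpha>" unfolding parallel_at_def using key by simp
  qed
qed

lemma horizontal_space_chart:
  assumes c: "c \<in> charts_at A (fst x)" and x: "x \<in> mcarrier (cotangent_atlas A)"
  shows "horizontal_space A nabla x =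
    range (\<lambda>a. coord_tvec (cotangent_atlas A) (cot_chart c) x (a, hor c x a))"
proof (intro equalityI subsetI)
  fix w assume "w \<in> horizontal_space A nabla x"
  then obtain X \<alpha> U where *: "w = differential A (cotangent_atlas A) (\<lambda>q. (q, \<alpha> q)) (fst x) (X (fst x))"
    "openin (manifold_topology A) U" "fst x \<in> U" "smooth_vfield A U X" "smooth_1form A U \<alpha>" "\<alpha> (fst x) = snd x"
    "parallel_at A nabla (fst x) X \<alpha>"
    unfolding horizontal_space_def by blast
  then have "w = coord_tvec (cotangent_atlas A) (cot_chart c) x (X (fst x) c, hor c x (X (fst x) c))"
    using differential_section[OF c *(2,3,5) smooth_vfield_tangent[OF *(4,3)]] parallel_at_chart[OF c *(2-5)]
    by simp
  then show "w \<in> range (\<lambda>a. coord_tvec (cotangent_atlas A) (cot_chart c) x (a, hor c x a))" by blast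
next
  fix w assume "w \<in> range (\<lambda>a. coord_tvec (cotangent_atlas A) (cot_chart c) x (a, hor c x a))"
  then obtain a where w: "w = coord_tvec (cotangent_atlas A) (cot_chart c) x (a, hor c x a)" by blast
  let ?p = "fst x"
  have cm: "c \<in> max_atlas A" "?p \<in> fst c" using c by (auto simp: charts_at_iff)
  have xi: "snd x \<in> cotangent_space A ?p" using x by (simp add: mcarrier_cotangent)
  \<comment> \<open>A section is wanted with value \<xi> at the base point and derivative
    \<open>hor c x a\<close> in the direction \<open>a\<close>; \<open>L\<close> is a rank one map
    with this property. For \<open>a = 0\<close> the division gives 0, in agreement with
    \<open>hor c x 0 = 0\<close>.\<close>
  define L where "L = (\<lambda>y::'e. ((y \<bullet> a) / (a \<bullet> a)) *\<^sub>R hor c x a)"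
  have La: "L a = hor c x a"
    using linear_0[OF linear_hor[OF c]] by (cases "a = 0") (auto simp: L_def)
  have L: "bounded_linear L"
    unfolding L_def divide_inverse
    by (intro bounded_linear_scaleR_const bounded_linear_mult_const bounded_linear_inner_left)
  define e where "e = (\<lambda>y. covec_coords A c ?p (snd x) + L (y - snd c ?p))"
  have e: "smooth_on (snd c ` fst c) e"
    unfolding e_def
    by (intro smooth_on_add smooth_on_const smooth_on_linear[OF _ L] smooth_on_diff smooth_on_id open_chart cm)
  have De: "(e has_derivative L) (at y)" for y
    unfolding e_def by (auto intro!: derivative_eq_intros bounded_linear.has_derivative[OF L] simp: linear_0 bounded_linear.linear[OF L])
  let ?\<alpha> = "\<lambda>q. covec c q (e (snd c q))" and ?X = "\<lambda>q. coord_tvec A c q a"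
  note U = openin_chart[OF cm(1)]
  have \<alpha>: "smooth_1form A (fst c) ?\<alpha>" by (rule smooth_covec[OF U cm(1) subset_refl e])
  have X: "smooth_vfield A (fst c) ?X" by (rule smooth_coord_const[OF cm(1) U subset_refl])
  have \<alpha>p: "?\<alpha> ?p = snd x"
    using covec_covec_coords[OF xi c] by (simp add: e_def linear_0 bounded_linear.linear[OF L])
  have "((\<lambda>y. covec_coords A c (chart_inv c y) (?\<alpha> (chart_inv c y))) has_derivative L) (at (snd c ?p))"
  proof (rule has_derivative_transform_within_open[OF De open_chart[OF cm(1)]])
    fix y assume y: "y \<in> snd c ` fst c"
    then have "c \<in> charts_at A (chart_inv c y)"
      using cm(1) by (simp add: charts_at_iff chart_inv_in max_atlas_is_chart)
    then show "e y = covec_coords A c (chart_inv c y) (?\<alpha> (chart_inv c y))"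
      using chart_right[OF y] by simp
  qed (use cm in blast)
  from frechet_derivative_eqI[OF this]
  have D: "frechet_derivative (\<lambda>y. covec_coords A c (chart_inv c y) (?\<alpha> (chart_inv c y))) (at (snd c ?p)) (?X ?p c) = hor c (?p, ?\<alpha> ?p) (?X ?p c)"
    using c \<alpha>p La by simp
  have "parallel_at A nabla ?p ?X ?\<alpha>"
    using parallel_at_chart[OF c U cm(2) X \<alpha>] D by blast
  moreover have "w = differential A (cotangent_atlas A) (\<lambda>q. (q, ?\<alpha> q)) ?p (?X ?p)"
    using differential_section[OF c U cm(2) \<alpha> coord_tvec_tangent[OF c, of a]] D c \<alpha>p w by simp
  ultimately show "w \<in> horizontal_space A nabla x"
    unfolding horizontal_space_def
    by - (rule CollectI, rule exI[of _ ?X], rule exI[of _ ?\<alpha>], rule conjI, assumption,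
        rule exI[of _ "fst c"], intro conjI U cm(2) X \<alpha> \<alpha>p, assumption)
qed

lemma horizontal_lift_chart:
  assumes c: "c \<in> charts_at A (fst x)" and x: "x \<in> mcarrier (cotangent_atlas A)"
    and v: "v \<in> tangent_space A (fst x)"
  shows "horizontal_lift A nabla x v = coord_tvec (cotangent_atlas A) (cot_chart c) x (v c, hor c x (v c))"
  unfolding horizontal_lift_def
proof (rule the_equality)
  note at = cot_chart_at[OF c x]
  have P: "d_proj A x (coord_tvec (cotangent_atlas A) (cot_chart c) x (a, b)) = coord_tvec A c (fst x) a" for a b
    using d_proj_chart[OF c x N.coord_tvec_tangent[OF at]] at by simp
  show "coord_tvec (cotangent_atlas A) (cot_chart c) x (v c, hor c x (v c)) \<in> horizontal_space A nabla x \<and>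
    d_proj A x (coord_tvec (cotangent_atlas A) (cot_chart c) x (v c, hor c x (v c))) = v"
    using P tangent_eq_coord_tvec[OF v c] horizontal_space_chart[OF c x] by simp
  fix w assume w: "w \<in> horizontal_space A nabla x \<and> d_proj A x w = v"
  then obtain a where a: "w = coord_tvec (cotangent_atlas A) (cot_chart c) x (a, hor c x a)"
    using horizontal_space_chart[OF c x] by blast
  then have "a = v c" using w P c coord_tvec_self by metis
  with a show "w = coord_tvec (cotangent_atlas A) (cot_chart c) x (v c, hor c x (v c))" by simp
qed

section \<open>The splitting of the tangent spaces of the bundle, and block operators\<close>

definition lift where "lift x v \<eta> = horizontal_lift A nabla x v + vertical_lift A x \<eta>"

text \<open>In the induced chart the inverse of the splitting is the shear (a, e) -> (a, hor a + e),
  which makes its linearity and bijectivity visible.\<close>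

lemma lift_chart:
  assumes c: "c \<in> charts_at A (fst x)" and x: "x \<in> mcarrier (cotangent_atlas A)"
    and v: "v \<in> tangent_space A (fst x)" and \<eta>: "\<eta> \<in> cotangent_space A (fst x)"
  shows "lift x v \<eta> = coord_tvec (cotangent_atlas A) (cot_chart c) x (v c, hor c x (v c) + covec_coords A c (fst x) \<eta>)"
  using N.coord_tvec_add[OF cot_chart_at[OF c x], of "(v c, hor c x (v c))" "(0, covec_coords A c (fst x) \<eta>)"]
  by (simp add: lift_def horizontal_lift_chart[OF c x v] vertical_lift_chart[OF c x \<eta>])

context
  fixes x assumes x: "x \<in> mcarrier (cotangent_atlas A)"
begin

lemma base_chart_at: "some_chart A (fst x) \<in> charts_at A (fst x)"
  using x by (simp add: mcarrier_cotangent some_chart_at)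

lemma lift_tangent:
  "v \<in> tangent_space A (fst x) \<Longrightarrow> \<eta> \<in> cotangent_space A (fst x) \<Longrightarrow>
    lift x v \<eta> \<in> tangent_space (cotangent_atlas A) x"
  using N.coord_tvec_tangent[OF cot_chart_at[OF base_chart_at x]] by (simp add: lift_chart[OF base_chart_at x])

lemma lift_surj:
  assumes w: "w \<in> tangent_space (cotangent_atlas A) x"
  obtains v \<eta> where "v \<in> tangent_space A (fst x)" "\<eta> \<in> cotangent_space A (fst x)" "w = lift x v \<eta>"
proof -
  let ?c = "some_chart A (fst x)"
  note c = base_chart_at
  let ?w = "w (cot_chart ?c)"
  \<comment> \<open>The shear is inverted by subtracting the horizontal contribution from the fibre
    coordinate.\<close>
  have "lift x (coord_tvec A ?c (fst x) (fst ?w)) (covec ?c (fst x) (snd ?w - hor ?c x (fst ?w))) = w"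
    using N.tangent_eq_coord_tvec[OF w cot_chart_at[OF c x]] c
    by (simp add: lift_chart[OF c x] coord_tvec_tangent covec_in)
  with that[OF coord_tvec_tangent[OF c] covec_in[OF c]] show thesis by metis
qed

lemma lift_add:
  assumes "v \<in> tangent_space A (fst x)" "\<eta> \<in> cotangent_space A (fst x)"
    "v' \<in> tangent_space A (fst x)" "\<eta>' \<in> cotangent_space A (fst x)"
  shows "lift x v \<eta> + lift x v' \<eta>' = lift x (v + v') (\<eta> + \<eta>')"
  using assms linear_add[OF linear_hor[OF base_chart_at]]
    N.coord_tvec_add[OF cot_chart_at[OF base_chart_at x], symmetric]
  by (simp add: lift_chart[OF base_chart_at x] tangent_add[OF base_chart_at] subspace_add[OF subspace_cotangent[OF base_chart_at]]
      linear_add[OF covec_coords_linear] algebra_simps)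

lemma lift_scaleR:
  assumes "v \<in> tangent_space A (fst x)" "\<eta> \<in> cotangent_space A (fst x)"
  shows "r *\<^sub>R lift x v \<eta> = lift x (r *\<^sub>R v) (r *\<^sub>R \<eta>)"
  using assms linear_scale[OF linear_hor[OF base_chart_at]]
    N.coord_tvec_scaleR[OF cot_chart_at[OF base_chart_at x], symmetric]
  by (simp add: lift_chart[OF base_chart_at x] tangent_scaleR[OF base_chart_at] subspace_scale[OF subspace_cotangent[OF base_chart_at]]
      linear_scale[OF covec_coords_linear] algebra_simps)

text \<open>The definite description in \<open>vertical_part\<close> is met, since the fibre
  coordinates of a vertical vector determine the covector. From here on block operators are handled
  as matrices acting on pairs.\<close>

lemma block_op_lift:
  assumes v: "v \<in> tangent_space A (fst x)" and \<eta>: "\<eta> \<in> cotangent_space A (fst x)"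
  shows "block_op A nabla x a b c d (lift x v \<eta>) = lift x (a v + b \<eta>) (c v + d \<eta>)"
proof -
  let ?c = "some_chart A (fst x)"
  note ch = base_chart_at
  note at = cot_chart_at[OF ch x]
  let ?w = "lift x v \<eta>"
  have wt: "?w \<in> tangent_space (cotangent_atlas A) x" by (rule lift_tangent[OF v \<eta>])
  have P: "d_proj A x ?w = v"
    using d_proj_chart[OF ch x wt] lift_chart[OF ch x v \<eta>] at tangent_eq_coord_tvec[OF v ch] by simp
  have V: "vertical_part A nabla x ?w = \<eta>"
    unfolding vertical_part_def P
  proof (rule the_equality)
    show "\<eta> \<in> cotangent_space A (fst x) \<and> vertical_lift A x \<eta> = ?w - horizontal_lift A nabla x v"
      using \<eta> by (simp add: lift_def)
    fix \<zeta> assume \<zeta>: "\<zeta> \<in> cotangent_space A (fst x) \<and> vertical_lift A x \<zeta> = ?w - horizontal_lift A nabla x v"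
    then have "vertical_lift A x \<zeta> = vertical_lift A x \<eta>" by (simp only: lift_def add_diff_cancel_left')
    moreover have "vertical_lift A x \<theta> (cot_chart ?c) = (0, covec_coords A ?c (fst x) \<theta>)"
      if "\<theta> \<in> cotangent_space A (fst x)" for \<theta>
      using that at by (simp add: vertical_lift_chart[OF ch x])
    ultimately have "covec_coords A ?c (fst x) \<zeta> = covec_coords A ?c (fst x) \<eta>"
      using \<zeta> \<eta> by (metis snd_conv)
    with \<zeta> \<eta> ch show "\<zeta> = \<eta>" by (blast intro: cotangent_eqI)
  qed
  show ?thesis by (simp add: block_op_def Let_def P V) (simp add: lift_def)
qed

end

end

section \<open>Flat linear systems of partial differential equations\<close>

lemma Ck_on_continuous: "Ck_on k S f \<Longrightarrow> continuous_on S f"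
proof (induction k)
  case (Suc k)
  then show ?case using Ck_on_SucD by blast
qed simp

text \<open>Differentiation under the integral sign. \<open>S\<close> is open and contains the
  product of \<open>B\<close> with the closed unit interval, so the full derivative of
  \<open>K\<close> exists also at the ends of the interval.\<close>

lemma param_integral_derivative:
  fixes K :: "'e::euclidean_space \<times> real \<Rightarrow> 'w::euclidean_space"
  assumes S: "open S" and B: "open B" "convex B" "\<And>x t. x \<in> B \<Longrightarrow> t \<in> {0..1} \<Longrightarrow> (x, t) \<in> S"
    and K: "Ck_on (Suc 0) S K" and x: "x \<in> B"
  shows "((\<lambda>x. integral {0..1} (\<lambda>t. K (x, t))) has_derivative
    (\<lambda>v. integral {0..1} (\<lambda>t. frechet_derivative K (at (x, t)) (v, 0)))) (at x)"
proof -
  define fx where "fx = (\<lambda>x t. Blinfun (\<lambda>v. frechet_derivative K (at (x, t)) (v, 0)))"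
  have DK: "(K has_derivative frechet_derivative K (at (x, t))) (at (x, t))" if "(x, t) \<in> S" for x t
    by (rule Ck_on_Suc_derivative[OF K that])
  have fx: "blinfun_apply (fx x t) = (\<lambda>v. frechet_derivative K (at (x, t)) (v, 0))" if "(x, t) \<in> S" for x t
    unfolding fx_def
    by (intro bounded_linear_Blinfun_apply bounded_linear_compose[OF has_derivative_bounded_linear[OF DK[OF that]]]
        bounded_linear_Pair bounded_linear_ident bounded_linear_zero)
  have cK: "continuous_on S K" by (rule Ck_on_continuous[OF K])
  have cD: "continuous_on S (\<lambda>z. frechet_derivative K (at z) v)" for v
    using K unfolding Ck_on.simps by blast
  \<comment> \<open>In finite dimension, continuity of the derivative as an operator follows from
    continuity on each basis vector.\<close>
  have c: "continuous_on (B \<times> cbox 0 1) (\<lambda>(x, t). fx x t)"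
  proof (rule continuous_on_blinfun_componentwise)
    fix i :: 'e
    have "continuous_on (B \<times> cbox 0 1) (\<lambda>z. frechet_derivative K (at z) (i, 0))"
      by (rule continuous_on_subset[OF cD]) (use B(3) in auto)
    then show "continuous_on (B \<times> cbox 0 1) (\<lambda>z. blinfun_apply (case z of (x, t) \<Rightarrow> fx x t) i)"
      by (rule continuous_on_eq) (use B(3) in \<open>auto simp: fx\<close>)
  qed
  have int: "f x integrable_on cbox 0 1" if "continuous_on (B \<times> cbox 0 1) (\<lambda>(x, t). f x t)" "x \<in> B"
    for f :: "'e \<Rightarrow> real \<Rightarrow> 'z::banach" and x
  proof -
    have "continuous_on (cbox 0 1) (\<lambda>t. (\<lambda>(x, t). f x t) (x, t))"
      by (rule continuous_on_compose2[OF that(1)]) (use that(2) in \<open>auto intro!: continuous_intros\<close>)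
    then show ?thesis by (simp add: integrable_continuous_real)
  qed
  have "B \<times> cbox 0 1 \<subseteq> S" using B(3) by auto
  then have cK': "continuous_on (B \<times> cbox 0 1) (\<lambda>(x, t). K (x, t))"
    using continuous_on_subset[OF cK, of "B \<times> cbox 0 1"] by simp
  have "((\<lambda>x. integral (cbox 0 1) (\<lambda>t. K (x, t))) has_derivative blinfun_apply (integral (cbox 0 1) (fx x))) (at x within B)"
  proof (rule leibniz_rule[OF _ int[OF cK'] c x B(2)])
    fix y t assume yt: "y \<in> B" "t \<in> cbox (0::real) 1"
    then have "(y, t) \<in> S" using B(3) by auto
    then have "((\<lambda>z. K (z, t)) has_derivative (\<lambda>v. frechet_derivative K (at (y, t)) (v, 0))) (at y)"
      by (intro has_derivative_compose[OF has_derivative_Pair[OF has_derivative_ident has_derivative_const] DK])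
    then show "((\<lambda>z. K (z, t)) has_derivative blinfun_apply (fx y t)) (at y within B)"
      using fx \<open>(y, t) \<in> S\<close> has_derivative_at_withinI by fastforce
  qed
  moreover have "blinfun_apply (integral (cbox 0 1) (fx x)) v =
      integral (cbox 0 1) (\<lambda>t. frechet_derivative K (at (x, t)) (v, 0))" for v
    unfolding blinfun_apply_integral[OF int[OF c x]]
    by (rule integral_cong) (use B(3) x in \<open>auto simp: fx\<close>)
  then have "blinfun_apply (integral (cbox 0 1) (fx x)) =
      (\<lambda>v. integral (cbox 0 1) (\<lambda>t. frechet_derivative K (at (x, t)) (v, 0)))" by blast
  ultimately show ?thesis using at_within_open[OF x B(1)] by simp
qed

text \<open>The derivative of the integral is an integral of the same kind, with \<open>K\<close>
  replaced by its derivative in the direction \<open>(v, 0)\<close>; hence the induction varies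
  \<open>K\<close>.\<close>

lemma Ck_on_param_integral:
  fixes K :: "'e::euclidean_space \<times> real \<Rightarrow> 'w::euclidean_space"
  assumes S: "open S" and B: "open B" "convex B" "\<And>x t. x \<in> B \<Longrightarrow> t \<in> {0..1} \<Longrightarrow> (x, t) \<in> S"
  shows "Ck_on k S K \<Longrightarrow> Ck_on k B (\<lambda>x. integral {0..1} (\<lambda>t. K (x, t)))"
proof (induction k arbitrary: K)
  case 0
  moreover have "B \<times> cbox 0 1 \<subseteq> S" using B(3) by auto
  ultimately have "continuous_on (B \<times> cbox 0 1) (\<lambda>(x, t). K (x, t))"
    using continuous_on_subset[of S K "B \<times> cbox 0 1"] by simp
  from integral_continuous_on_param[OF this] show ?case by simp
next
  case (Suc k)
  have "Ck_on (Suc 0) S K"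
    using Suc.prems by (auto intro: Ck_on_continuous)
  note K = this
  show ?case
  proof (rule Ck_on_SucI[OF B(1)])
    show "((\<lambda>x. integral {0..1} (\<lambda>t. K (x, t))) has_derivative
      (\<lambda>v. integral {0..1} (\<lambda>t. frechet_derivative K (at (x, t)) (v, 0)))) (at x)" if "x \<in> B" for x
      by (rule param_integral_derivative[OF S B K that])
    show "Ck_on k B (\<lambda>x. integral {0..1} (\<lambda>t. frechet_derivative K (at (x, t)) (v, 0)))" for v
      by (rule Suc.IH) (use Suc.prems in \<open>unfold Ck_on.simps, blast\<close>)
  qed
qed

text \<open>Comparison with a geometric series of ratio 1/2, whose tail is twice its first term;
  hence the factor 2.\<close>

lemma geometric_tail:
  fixes a :: "nat \<Rightarrow> 'a::banach"
  assumes "\<And>n. norm (a n) \<le> K * (1/2)^n"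
  shows "summable a" "norm ((\<Sum>i<n. a i) - suminf a) \<le> 2 * K * (1/2)^n" "norm (suminf a) \<le> 2 * K"
proof -
  have sm: "summable (\<lambda>i. K * (1/2)^(i + m))" for m
    unfolding power_add mult.assoc[symmetric] by (intro summable_mult2 summable_mult summable_geometric) simp
  have sn: "summable (\<lambda>i. norm (a (i + m)))" for m
    by (rule summable_comparison_test'[OF sm[of m], of 0]) (use assms in auto)
  from sn[of 0] show s: "summable a" by (auto intro: summable_norm_cancel)
  have tail: "norm (suminf (\<lambda>i. a (i + m))) \<le> 2 * K * (1/2)^m" for m
  proof -
    have "norm (suminf (\<lambda>i. a (i + m))) \<le> (\<Sum>i. norm (a (i + m)))" by (rule summable_norm[OF sn])
    also have "\<dots> \<le> (\<Sum>i. K * (1/2)^(i + m))" by (rule suminf_le[OF assms sn sm])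
    also have "\<dots> = (\<Sum>i. (K * (1/2)^m) * (1/2)^i)" by (simp add: power_add mult_ac)
    also have "\<dots> = (K * (1/2)^m) * 2"
      by (subst suminf_mult) (simp_all add: suminf_geometric summable_geometric)
    finally show ?thesis by (simp add: mult_ac)
  qed
  show "norm ((\<Sum>i<n. a i) - suminf a) \<le> 2 * K * (1/2)^n"
    using tail[of n] suminf_minus_initial_segment[OF s, of n] by (simp add: norm_minus_commute)
  show "norm (suminf a) \<le> 2 * K" using tail[of 0] by simp
qed

section \<open>Linear systems D f(x) v = A x v (f x) and their Picard operator\<close>

locale linear_system =
  fixes A :: "'e::euclidean_space \<Rightarrow> 'e \<Rightarrow> 'w::euclidean_space \<Rightarrow> 'w" and S :: "'e set"
  assumes S: "open S"
    and lin1: "\<And>x w. x \<in> S \<Longrightarrow> linear (\<lambda>v. A x v w)"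
    and lin2: "\<And>x v. x \<in> S \<Longrightarrow> linear (A x v)"
    and smooth: "\<And>v w. smooth_on S (\<lambda>x. A x v w)"
begin

definition dA :: "'e \<Rightarrow> 'e \<Rightarrow> 'e \<Rightarrow> 'w \<Rightarrow> 'w" where
  "dA x u v w = frechet_derivative (\<lambda>x. A x v w) (at x) u"

lemma A_derivative: "x \<in> S \<Longrightarrow> ((\<lambda>x. A x v w) has_derivative (\<lambda>u. dA x u v w)) (at x)"
  unfolding dA_def by (rule smooth_on_derivative[OF smooth])

lemma dA_linear: "x \<in> S \<Longrightarrow> linear (\<lambda>u. dA x u v w)"
  using A_derivative has_derivative_linear by blast

lemma A_expand:
  "x \<in> S \<Longrightarrow> A x v w = (\<Sum>b\<in>Basis. \<Sum>c\<in>Basis. (v \<bullet> b) *\<^sub>R (w \<bullet> c) *\<^sub>R A x b c)"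
  using linear_expand_Basis[OF lin1, of x v w] linear_expand_Basis[OF lin2, of x _ w]
  by (simp add: scaleR_sum_right)

text \<open>Linearity in \<open>v\<close> and \<open>w\<close> survives differentiation in
  \<open>x\<close>: the finite expansion of \<open>A\<close> is differentiated termwise, and
  derivatives are unique.\<close>

lemma dA_expand:
  assumes x: "x \<in> S"
  shows "dA x u v w = (\<Sum>b\<in>Basis. \<Sum>c\<in>Basis. (v \<bullet> b) *\<^sub>R (w \<bullet> c) *\<^sub>R dA x u b c)"
proof -
  have "((\<lambda>x. \<Sum>b\<in>Basis. \<Sum>c\<in>Basis. (v \<bullet> b) *\<^sub>R (w \<bullet> c) *\<^sub>R A x b c) has_derivative
      (\<lambda>u. \<Sum>b\<in>Basis. \<Sum>c\<in>Basis. (v \<bullet> b) *\<^sub>R (w \<bullet> c) *\<^sub>R dA x u b c)) (at x)"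
    by (intro has_derivative_sum has_derivative_scaleR_right A_derivative x)
  then have "((\<lambda>x. A x v w) has_derivative
      (\<lambda>u. \<Sum>b\<in>Basis. \<Sum>c\<in>Basis. (v \<bullet> b) *\<^sub>R (w \<bullet> c) *\<^sub>R dA x u b c)) (at x)"
    by (rule has_derivative_transform_within_open[OF _ S x]) (rule A_expand[symmetric])
  from has_derivative_unique[OF A_derivative[OF x] this] show ?thesis by (rule fun_cong)
qed

text \<open>The right-hand side of the integral equation \<open>f x = w\<^sub>0 + picard f x\<close>, which is the system
  restricted to the ray through \<open>x\<close>.\<close>
definition picard :: "('e \<Rightarrow> 'w) \<Rightarrow> 'e \<Rightarrow> 'w" where
  "picard u x = integral {0..1} (\<lambda>t. A (t *\<^sub>R x) x (u (t *\<^sub>R x)))"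

text \<open>The terms of the Neumann series obtained by applying \<open>picard\<close> repeatedly to
  the constant \<open>w0\<close>, rather than successive approximations; the solution is their
  sum.\<close>

primrec iter :: "'w \<Rightarrow> nat \<Rightarrow> 'e \<Rightarrow> 'w" where
  "iter w0 0 = (\<lambda>x. w0)"
| "iter w0 (Suc n) = picard (iter w0 n)"

text \<open>Smoothness of \<open>A\<close> is known only for fixed \<open>v\<close> and
  \<open>w\<close>. Expanding both in bases turns the composite into a finite sum of products, to
  which the product and chain rules apply.\<close>

lemma compose_derivative:
  assumes T: "open T" "z \<in> T" "\<And>z. z \<in> T \<Longrightarrow> y z \<in> S"
    and y: "(y has_derivative y') (at z)" and v: "(v has_derivative v') (at z)" and w: "(w has_derivative w') (at z)"
  shows "((\<lambda>z. A (y z) (v z) (w z)) has_derivative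
    (\<lambda>h. dA (y z) (y' h) (v z) (w z) + A (y z) (v' h) (w z) + A (y z) (v z) (w' h))) (at z)"
proof -
  have yz: "y z \<in> S" using T by blast
  have "((\<lambda>z. A (y z) b c) has_derivative (\<lambda>h. dA (y z) (y' h) b c)) (at z)" for b c
    by (rule has_derivative_compose[OF y A_derivative[OF yz]])
  then have "((\<lambda>z. \<Sum>b\<in>Basis. \<Sum>c\<in>Basis. (v z \<bullet> b) *\<^sub>R (w z \<bullet> c) *\<^sub>R A (y z) b c) has_derivative
    (\<lambda>h. \<Sum>b\<in>Basis. \<Sum>c\<in>Basis. (v z \<bullet> b) *\<^sub>R ((w z \<bullet> c) *\<^sub>R dA (y z) (y' h) b c + (w' h \<bullet> c) *\<^sub>R A (y z) b c)
       + (v' h \<bullet> b) *\<^sub>R (w z \<bullet> c) *\<^sub>R A (y z) b c)) (at z)"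
    by (intro has_derivative_sum has_derivative_scaleR has_derivative_inner_left v w)
  moreover have "(\<Sum>b\<in>Basis. \<Sum>c\<in>Basis. (v z \<bullet> b) *\<^sub>R ((w z \<bullet> c) *\<^sub>R dA (y z) (y' h) b c + (w' h \<bullet> c) *\<^sub>R A (y z) b c)
       + (v' h \<bullet> b) *\<^sub>R (w z \<bullet> c) *\<^sub>R A (y z) b c)
      = dA (y z) (y' h) (v z) (w z) + A (y z) (v' h) (w z) + A (y z) (v z) (w' h)" for h
    unfolding A_expand[OF yz, of "v' h"] A_expand[OF yz, of "v z"] dA_expand[OF yz, of "y' h" "v z"]
    by (simp add: sum.distrib scaleR_add_right add_ac)
  ultimately have "((\<lambda>z. \<Sum>b\<in>Basis. \<Sum>c\<in>Basis. (v z \<bullet> b) *\<^sub>R (w z \<bullet> c) *\<^sub>R A (y z) b c) has_derivative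
    (\<lambda>h. dA (y z) (y' h) (v z) (w z) + A (y z) (v' h) (w z) + A (y z) (v z) (w' h))) (at z)"
    by (simp only:)
  then show ?thesis
    by (rule has_derivative_transform_within_open[OF _ T(1,2)]) (rule A_expand[OF T(3), symmetric])
qed

lemma Ck_on_A:
  fixes y :: "'z::real_normed_vector \<Rightarrow> 'e"
  assumes T: "open T" "\<And>z. z \<in> T \<Longrightarrow> y z \<in> S" and "Ck_on k T y" "Ck_on k T v" "Ck_on k T w"
  shows "Ck_on k T (\<lambda>z. A (y z) (v z) (w z))"
proof (rule Ck_on_eqI[OF T(1)])
  show "Ck_on k T (\<lambda>z. \<Sum>b\<in>Basis. \<Sum>c\<in>Basis. (v z \<bullet> b) *\<^sub>R (w z \<bullet> c) *\<^sub>R A (y z) b c)"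
  proof (intro Ck_on_sum Ck_on_scaleR Ck_on_inner Ck_on_const T(1) assms)
    show "Ck_on k T (\<lambda>z. A (y z) b c)" for b c
      by (rule Ck_on_compose[OF T(1) S T(2) assms(3) smooth_on_Ck[OF smooth]])
  qed
qed (rule A_expand[OF T(2)])

text \<open>On a compact set each of the finitely many coefficients on basis vectors is bounded, and
  the multilinear expansion adds these bounds. The larger of the two sums serves \<open>A\<close>
  and its derivative at once.\<close>

lemma local_bound:
  assumes C: "compact C" "C \<subseteq> S"
  obtains M where "M \<ge> 0" "\<And>x v w. x \<in> C \<Longrightarrow> norm (A x v w) \<le> M * norm v * norm w"
    "\<And>x u v w. x \<in> C \<Longrightarrow> norm (dA x u v w) \<le> M * norm u * norm v * norm w"
proof -
  have bd: "\<exists>m\<ge>0. \<forall>x\<in>C. norm (f x) \<le> m" if "smooth_on S f" for f :: "'e \<Rightarrow> 'w"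
  proof -
    have "compact (f ` C)"
      using smooth_on_continuous[OF that] C by (intro compact_continuous_image) (auto intro: continuous_on_subset)
    then obtain m where "\<forall>y\<in>f ` C. norm y \<le> m" using compact_imp_bounded bounded_iff by metis
    then show ?thesis by (intro exI[of _ "max m 0"]) (auto simp: le_max_iff_disj)
  qed
  have "\<forall>b c. \<exists>m\<ge>0. \<forall>x\<in>C. norm (A x b c) \<le> m" using bd[OF smooth] by blast
  then obtain m where m: "\<And>b c. m b c \<ge> 0" "\<And>b c x. x \<in> C \<Longrightarrow> norm (A x b c) \<le> m b c" by metis
  have "\<forall>a b c. \<exists>m\<ge>0. \<forall>x\<in>C. norm (dA x a b c) \<le> m"
    unfolding dA_def using bd[OF smooth_on_frechet_along[OF S smooth smooth_on_const[OF S]]] by blast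
  then obtain m' where m': "\<And>a b c. m' a b c \<ge> 0" "\<And>a b c x. x \<in> C \<Longrightarrow> norm (dA x a b c) \<le> m' a b c" by metis
  define M1 where "M1 = (\<Sum>b\<in>Basis. \<Sum>c\<in>Basis. m b c)"
  define M2 where "M2 = (\<Sum>b\<in>Basis. \<Sum>c\<in>Basis. \<Sum>a\<in>Basis. m' a b c)"
  have bb: "norm ((v \<bullet> b) *\<^sub>R (w \<bullet> c) *\<^sub>R y) \<le> norm v * norm w * k"
    if "b \<in> Basis" "c \<in> Basis" "norm y \<le> k" for b v :: 'e and c w y :: 'w and k
  proof -
    have "0 \<le> k" using that(3) norm_ge_zero order_trans by blast
    then have "\<bar>v \<bullet> b\<bar> * (\<bar>w \<bullet> c\<bar> * norm y) \<le> norm v * (norm w * k)"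
      using that by (intro mult_mono) (auto simp: Basis_le_norm)
    then show ?thesis by (simp add: mult.assoc abs_mult)
  qed
  have pos: "M1 \<ge> 0" "M2 \<ge> 0" unfolding M1_def M2_def by (auto intro!: sum_nonneg m m')
  have n1: "norm (A x v w) \<le> M1 * norm v * norm w" if x: "x \<in> C" for x v w
  proof -
    have "norm (A x v w) \<le> (\<Sum>b\<in>Basis. \<Sum>c\<in>Basis. norm v * norm w * m b c)"
      unfolding A_expand[OF subsetD[OF C(2) x], of v w]
      by (intro order_trans[OF norm_sum] sum_mono bb m x)
    also have "\<dots> = M1 * norm v * norm w" by (simp add: M1_def sum_distrib_left mult_ac)
    finally show ?thesis .
  qed
  have n2: "norm (dA x u v w) \<le> M2 * norm u * norm v * norm w" if x: "x \<in> C" for x u v w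
  proof -
    have n3: "norm (dA x u b c) \<le> norm u * (\<Sum>a\<in>Basis. m' a b c)" for b c
    proof -
      have "norm (dA x u b c) \<le> (\<Sum>a\<in>Basis. norm u * m' a b c)"
        unfolding linear_expand_Basis[OF dA_linear[OF subsetD[OF C(2) x]], of u b c]
        by (intro order_trans[OF norm_sum] sum_mono) (auto intro!: mult_mono m' x Basis_le_norm)
      then show ?thesis by (simp add: sum_distrib_left)
    qed
    have "norm (dA x u v w) \<le> (\<Sum>b\<in>Basis. \<Sum>c\<in>Basis. norm v * norm w * (norm u * (\<Sum>a\<in>Basis. m' a b c)))"
      unfolding dA_expand[OF subsetD[OF C(2) x], of u v w]
      by (intro order_trans[OF norm_sum] sum_mono bb n3)
    also have "\<dots> = M2 * norm u * norm v * norm w" by (simp add: M2_def sum_distrib_left mult_ac)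
    finally show ?thesis .
  qed
  show thesis
  proof (rule that[of "max M1 M2"])
    show "norm (A x v w) \<le> max M1 M2 * norm v * norm w" if "x \<in> C" for x v w
      using n1[OF that, of v w] by (rule order_trans) (intro mult_right_mono, auto)
    show "norm (dA x u v w) \<le> max M1 M2 * norm u * norm v * norm w" if "x \<in> C" for x u v w
      using n2[OF that, of u v w] by (rule order_trans) (intro mult_right_mono, auto)
  qed (use pos in auto)
qed

text \<open>The integrand, at parameter \<open>t\<close>, of the derivative of
  \<open>picard u\<close> at \<open>x\<close> in the direction \<open>v\<close>: one term for each
  of the three places where \<open>x\<close> occurs in
  \<open>A (t *\<^sub>R x) x (u (t *\<^sub>R x))\<close>.\<close>

definition dpicard :: "('e \<Rightarrow> 'w) \<Rightarrow> 'e \<Rightarrow> 'e \<Rightarrow> real \<Rightarrow> 'w" where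
  "dpicard u x v t = dA (t *\<^sub>R x) (t *\<^sub>R v) x (u (t *\<^sub>R x)) + A (t *\<^sub>R x) v (u (t *\<^sub>R x))
     + A (t *\<^sub>R x) x (frechet_derivative u (at (t *\<^sub>R x)) (t *\<^sub>R v))"

context
  fixes r :: real
  assumes r: "ball 0 r \<subseteq> S"
begin

lemma ray: "(x::'e) \<in> ball 0 r \<Longrightarrow> t \<in> {0..1} \<Longrightarrow> t *\<^sub>R x \<in> ball 0 r"
  using mult_left_le_one_le[of "norm x" t] by auto

text \<open>An open set of pairs (x, t) on which the integrand of \<open>picard\<close> makes sense.
  It contains the ball times the closed unit interval, as differentiation under the integral
  requires.\<close>

definition cone :: "('e \<times> real) set" where "cone = {z. snd z *\<^sub>R fst z \<in> ball 0 r}"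

lemma open_cone: "open cone"
proof -
  have "continuous_on UNIV (\<lambda>z::'e \<times> real. snd z *\<^sub>R fst z)" by (intro continuous_intros)
  then have "open ((\<lambda>z::'e \<times> real. snd z *\<^sub>R fst z) -` ball 0 r)" by (intro open_vimage) auto
  then show ?thesis by (simp add: cone_def vimage_def)
qed

lemma Ck_on_picard_integrand:
  assumes "Ck_on k (ball 0 r) u"
  shows "Ck_on k cone (\<lambda>z. A (snd z *\<^sub>R fst z) (fst z) (u (snd z *\<^sub>R fst z)))"
proof -
  have f: "Ck_on k cone fst" "Ck_on k cone snd"
    by (rule Ck_on_linear[OF open_cone bounded_linear_fst Ck_on_id[OF open_cone]],
        rule Ck_on_linear[OF open_cone bounded_linear_snd Ck_on_id[OF open_cone]])
  have y: "Ck_on k cone (\<lambda>z. snd z *\<^sub>R fst z)" by (rule Ck_on_scaleR[OF open_cone f(2,1)])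
  have "Ck_on k cone (\<lambda>z. u (snd z *\<^sub>R fst z))"
    by (rule Ck_on_compose[OF open_cone open_ball _ y assms]) (simp add: cone_def)
  then show ?thesis using r by (intro Ck_on_A open_cone y f) (auto simp: cone_def)
qed

lemma cone_S: "z \<in> cone \<Longrightarrow> snd z *\<^sub>R fst z \<in> S"
  using r by (auto simp: cone_def)

lemma ray_cone: "x \<in> ball 0 r \<Longrightarrow> t \<in> {0..1} \<Longrightarrow> (x, t) \<in> cone"
  using ray by (simp add: cone_def)

lemma Ck_on_picard: "Ck_on k (ball 0 r) u \<Longrightarrow> Ck_on k (ball 0 r) (picard u)"
  unfolding picard_def
  using Ck_on_param_integral[OF open_cone open_ball convex_ball, of 0 r k
      "\<lambda>z. A (snd z *\<^sub>R fst z) (fst z) (u (snd z *\<^sub>R fst z))"] ray_cone Ck_on_picard_integrand[of k u] by simp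

lemma picard_integrand_continuous:
  assumes "Ck_on k (ball 0 r) u" "x \<in> ball 0 r"
  shows "continuous_on {0..1} (\<lambda>t. A (t *\<^sub>R x) x (u (t *\<^sub>R x)))"
proof -
  have "continuous_on {0..1} (\<lambda>t. (\<lambda>z. A (snd z *\<^sub>R fst z) (fst z) (u (snd z *\<^sub>R fst z))) (x, t))"
    by (rule continuous_on_compose2[OF Ck_on_continuous[OF Ck_on_picard_integrand[OF assms(1)]]])
      (auto intro!: continuous_intros ray_cone assms(2))
  then show ?thesis by simp
qed

lemma picard_derivative:
  assumes u: "Ck_on (Suc 0) (ball 0 r) u" and x: "x \<in> ball 0 r"
  shows "(picard u has_derivative (\<lambda>v. integral {0..1} (dpicard u x v))) (at x)"
    and "continuous_on {0..1} (dpicard u x v)"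
proof -
  let ?K = "\<lambda>z. A (snd z *\<^sub>R fst z) (fst z) (u (snd z *\<^sub>R fst z))"
  have D: "frechet_derivative ?K (at (x, t)) (v, 0) = dpicard u x v t" if t: "t \<in> {0..1}" for t v
  proof -
    have f: "(fst has_derivative fst) (at (x, t))" "(snd has_derivative snd) (at (x, t))"
      by (auto intro: bounded_linear_imp_has_derivative bounded_linear_fst bounded_linear_snd)
    have y: "((\<lambda>z. snd z *\<^sub>R fst z) has_derivative (\<lambda>h. t *\<^sub>R fst h + snd h *\<^sub>R x)) (at (x, t))"
      using has_derivative_scaleR[OF f(2,1)] by simp
    have u': "((\<lambda>z. u (snd z *\<^sub>R fst z)) has_derivative (\<lambda>h. frechet_derivative u (at (t *\<^sub>R x)) (t *\<^sub>R fst h + snd h *\<^sub>R x))) (at (x, t))"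
      using has_derivative_compose[OF y, of u] Ck_on_Suc_derivative[OF u ray[OF x t]] by simp
    have "(?K has_derivative (\<lambda>h. dA (t *\<^sub>R x) (t *\<^sub>R fst h + snd h *\<^sub>R x) x (u (t *\<^sub>R x)) + A (t *\<^sub>R x) (fst h) (u (t *\<^sub>R x))
      + A (t *\<^sub>R x) x (frechet_derivative u (at (t *\<^sub>R x)) (t *\<^sub>R fst h + snd h *\<^sub>R x)))) (at (x, t))"
      using compose_derivative[OF open_cone ray_cone[OF x t] cone_S y f(1) u'] by simp
    from frechet_derivative_eqI[OF this] show ?thesis by (simp add: dpicard_def)
  qed
  have "((\<lambda>x. integral {0..1} (\<lambda>t. ?K (x, t))) has_derivative
      (\<lambda>v. integral {0..1} (\<lambda>t. frechet_derivative ?K (at (x, t)) (v, 0)))) (at x)"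
    by (rule param_integral_derivative[OF open_cone open_ball convex_ball ray_cone Ck_on_picard_integrand[OF u] x])
  moreover have "integral {0..1} (\<lambda>t. frechet_derivative ?K (at (x, t)) (v, 0)) = integral {0..1} (dpicard u x v)" for v
    by (rule integral_cong) (rule D)
  ultimately show "(picard u has_derivative (\<lambda>v. integral {0..1} (dpicard u x v))) (at x)"
    unfolding picard_def by (simp add: picard_def[abs_def])
  have "continuous_on cone (\<lambda>z. frechet_derivative ?K (at z) (v, 0))"
    using Ck_on_picard_integrand[OF u] by simp
  then have "continuous_on {0..1} (\<lambda>t. (\<lambda>z. frechet_derivative ?K (at z) (v, 0)) (x, t))"
    by (rule continuous_on_compose2) (auto intro!: continuous_intros ray_cone x)
  then show "continuous_on {0..1} (dpicard u x v)"
    by (rule continuous_on_eq) (rule D)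
qed

text \<open>The linear argument \<open>x\<close> of \<open>A\<close> has norm below
  \<open>r\<close>, so \<open>M * r \<le> 1/4\<close> makes \<open>picard\<close> contract the
  supremum norm by 1/4.\<close>

lemma picard_bound:
  assumes "Ck_on k (ball 0 r) u" "x \<in> ball 0 r" and M: "M \<ge> 0" "M * r \<le> 1/4"
    and A: "\<And>x v w. x \<in> ball 0 r \<Longrightarrow> norm (A x v w) \<le> M * norm v * norm w"
    and U: "\<And>y. y \<in> ball 0 r \<Longrightarrow> norm (u y) \<le> U"
  shows "norm (picard u x) \<le> U / 4"
proof -
  have "0 \<le> U" using U[OF assms(2)] norm_ge_zero order_trans by blast
  have "0 \<le> r" using assms(2) norm_ge_zero[of x] by (simp del: norm_ge_zero)
  have "norm (picard u x) \<le> U / 4 * (1 - 0)"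
    unfolding picard_def
  proof (rule integral_bound[OF _ picard_integrand_continuous[OF assms(1,2)]])
    fix t :: real assume t: "t \<in> {0..1}"
    have "norm (A (t *\<^sub>R x) x (u (t *\<^sub>R x))) \<le> M * norm x * norm (u (t *\<^sub>R x))"
      by (rule A[OF ray[OF assms(2) t]])
    also have "\<dots> \<le> (M * r) * U"
      using assms(2) M(1) \<open>0 \<le> U\<close> \<open>0 \<le> r\<close> by (intro mult_mono mult_left_mono U ray t) auto
    also have "\<dots> \<le> 1/4 * U" by (rule mult_right_mono[OF M(2) \<open>0 \<le> U\<close>])
    finally show "norm (A (t *\<^sub>R x) x (u (t *\<^sub>R x))) \<le> U / 4" by simp
  qed simp
  then show ?thesis by simp
qed

text \<open>Of the three terms of \<open>dpicard\<close>, the two that contain \<open>u\<close>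
  itself contribute \<open>M * U\<close> each, the first of them by \<open>r \<le> 1\<close>; the
  one with the derivative of \<open>u\<close> is contracted by 1/4.\<close>

lemma picard_derivative_bound:
  assumes u: "Ck_on (Suc 0) (ball 0 r) u" and x: "x \<in> ball 0 r" and M: "M \<ge> 0" "M * r \<le> 1/4" "r \<le> 1"
    and A: "\<And>x v w. x \<in> ball 0 r \<Longrightarrow> norm (A x v w) \<le> M * norm v * norm w"
    and dA: "\<And>x u v w. x \<in> ball 0 r \<Longrightarrow> norm (dA x u v w) \<le> M * norm u * norm v * norm w"
    and U: "\<And>y. y \<in> ball 0 r \<Longrightarrow> norm (u y) \<le> U"
    and V: "\<And>y v. y \<in> ball 0 r \<Longrightarrow> norm (frechet_derivative u (at y) v) \<le> V * norm v" "V \<ge> 0"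
  shows "norm (frechet_derivative (picard u) (at x) v) \<le> (2 * M * U + V / 4) * norm v"
proof -
  have "0 \<le> U" using U[OF x] norm_ge_zero order_trans by blast
  have nx: "norm x \<le> r" using x by simp
  have r0: "0 \<le> r" using nx norm_ge_zero[of x] by linarith
  have "norm (integral {0..1} (dpicard u x v)) \<le> (2 * M * U + V / 4) * norm v * (1 - 0)"
  proof (rule integral_bound[OF _ picard_derivative(2)[OF u x]])
    fix t :: real assume t: "t \<in> {0..1}"
    note y = ray[OF x t]
    have tv: "norm (t *\<^sub>R v) \<le> norm v" using t by (auto intro: mult_left_le_one_le)
    have "norm (dA (t *\<^sub>R x) (t *\<^sub>R v) x (u (t *\<^sub>R x))) \<le> M * norm (t *\<^sub>R v) * norm x * norm (u (t *\<^sub>R x))"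
      by (rule dA[OF y])
    also have "\<dots> \<le> M * norm v * 1 * U"
      using nx M \<open>0 \<le> U\<close> tv by (intro mult_mono mult_left_mono U y mult_nonneg_nonneg) auto
    finally have 1: "norm (dA (t *\<^sub>R x) (t *\<^sub>R v) x (u (t *\<^sub>R x))) \<le> M * U * norm v" by (simp add: mult_ac)
    have "norm (A (t *\<^sub>R x) v (u (t *\<^sub>R x))) \<le> M * norm v * norm (u (t *\<^sub>R x))" by (rule A[OF y])
    also have "\<dots> \<le> M * norm v * U" using M by (intro mult_left_mono U y) auto
    finally have 2: "norm (A (t *\<^sub>R x) v (u (t *\<^sub>R x))) \<le> M * U * norm v" by (simp add: mult_ac)
    have "norm (frechet_derivative u (at (t *\<^sub>R x)) (t *\<^sub>R v)) \<le> V * norm (t *\<^sub>R v)" by (rule V(1)[OF y])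
    also have "\<dots> \<le> V * norm v" by (rule mult_left_mono[OF tv V(2)])
    finally have d: "norm (frechet_derivative u (at (t *\<^sub>R x)) (t *\<^sub>R v)) \<le> V * norm v" .
    have "norm (A (t *\<^sub>R x) x (frechet_derivative u (at (t *\<^sub>R x)) (t *\<^sub>R v)))
        \<le> M * norm x * norm (frechet_derivative u (at (t *\<^sub>R x)) (t *\<^sub>R v))" by (rule A[OF y])
    also have "\<dots> \<le> (M * r) * (V * norm v)"
      using nx M V(2) r0 by (intro mult_mono mult_left_mono d) auto
    also have "\<dots> \<le> 1/4 * (V * norm v)" using V(2) by (intro mult_right_mono M(2)) auto
    finally have 3: "norm (A (t *\<^sub>R x) x (frechet_derivative u (at (t *\<^sub>R x)) (t *\<^sub>R v))) \<le> V / 4 * norm v" by simp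
    have "norm (dpicard u x v t) \<le> M * U * norm v + M * U * norm v + V / 4 * norm v"
      unfolding dpicard_def by (intro norm_add_rule_thm 1 2 3)
    also have "\<dots> = (2 * M * U + V / 4) * norm v" by (simp add: algebra_simps)
    finally show "norm (dpicard u x v t) \<le> (2 * M * U + V / 4) * norm v" .
  qed simp
  then show ?thesis by (simp add: frechet_derivative_eqI[OF picard_derivative(1)[OF u x]])
qed

section \<open>Convergence of the iteration and solution of the system\<close>

context
  fixes M :: real and w0 :: 'w
  assumes rpos: "r > 0" and M: "M \<ge> 0" "M * r \<le> 1/4" "r \<le> 1"
    and A_bound: "\<And>x v w. x \<in> ball 0 r \<Longrightarrow> norm (A x v w) \<le> M * norm v * norm w"
    and dA_bound: "\<And>x u v w. x \<in> ball 0 r \<Longrightarrow> norm (dA x u v w) \<le> M * norm u * norm v * norm w"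
begin

lemma Ck_on_iter: "Ck_on k (ball 0 r) (iter w0 n)"
  by (induction n) (simp_all add: Ck_on_const Ck_on_picard del: Ck_on.simps)

lemma iter_bound: "x \<in> ball 0 r \<Longrightarrow> norm (iter w0 n x) \<le> norm w0 * (1/2)^n"
proof (induction n arbitrary: x)
  case (Suc n)
  have "norm (iter w0 (Suc n) x) \<le> norm w0 * (1/2)^n / 4"
    unfolding iter.simps by (rule picard_bound[OF Ck_on_iter Suc.prems M(1,2) A_bound Suc.IH])
  also have "\<dots> \<le> norm w0 * (1/2)^(Suc n)" by simp
  finally show ?case .
qed simp

text \<open>With values bounded by \<open>norm w0 * (1/2)^n\<close>, a bound
  \<open>K * M * norm w0 * (1/2)^n\<close> for the derivatives reproduces itself if 2 + K/4 \<le>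
  K/2; \<open>K = 8\<close> is the smallest solution. The ratio is 1/2 and not 1/4 to leave room for
  the inhomogeneous term.\<close>

lemma diter_bound:
  "x \<in> ball 0 r \<Longrightarrow> norm (frechet_derivative (iter w0 n) (at x) v) \<le> 8 * M * norm w0 * (1/2)^n * norm v"
proof (induction n arbitrary: x v)
  case 0
  have "frechet_derivative (\<lambda>x. w0) (at x) = (\<lambda>v. 0)" by (rule frechet_derivative_eqI) simp
  then show ?case using M by simp
next
  case (Suc n)
  have "norm (frechet_derivative (iter w0 (Suc n)) (at x) v)
      \<le> (2 * M * (norm w0 * (1/2)^n) + (8 * M * norm w0 * (1/2)^n) / 4) * norm v"
    unfolding iter.simps
    by (rule picard_derivative_bound[OF Ck_on_iter Suc.prems M A_bound dA_bound iter_bound Suc.IH]) (use M in auto)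
  also have "\<dots> = 8 * M * norm w0 * (1/2)^(Suc n) * norm v" by simp
  finally show ?case .
qed

text \<open>The bounds on \<open>g\<close> and on its derivative are kept in the conclusion because
  the contraction argument for the defect starts from them.\<close>

lemma picard_fixed_point:
  obtains g where "Ck_on (Suc 0) (ball 0 r) g" "\<And>x. x \<in> ball 0 r \<Longrightarrow> g x = w0 + picard g x"
    "\<And>x. x \<in> ball 0 r \<Longrightarrow> norm (g x) \<le> 2 * norm w0"
    "\<And>x v. x \<in> ball 0 r \<Longrightarrow> norm (frechet_derivative g (at x) v) \<le> 16 * M * norm w0 * norm v"
proof -
  let ?B = "ball (0::'e) r" and ?u = "iter w0"
  let ?D = "8 * M * norm w0"
  define g' where "g' = (\<lambda>x v. \<Sum>n. frechet_derivative (?u n) (at x) v)"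
  have du: "norm (frechet_derivative (?u n) (at x) v) \<le> ?D * norm v * (1/2)^n" if "x \<in> ?B" for n x v
    using diter_bound[OF that, of n v] by (simp add: mult_ac)
  note tail = geometric_tail[OF iter_bound] and dtail = geometric_tail[OF du]
  have "\<exists>g. \<forall>x\<in>?B. (\<lambda>n. ?u n x) sums g x \<and> (g has_derivative g' x) (at x within ?B)"
  proof (rule has_derivative_series[OF convex_ball])
    show "(?u n has_derivative frechet_derivative (?u n) (at x)) (at x within ?B)" if "x \<in> ?B" for n x
      using Ck_on_Suc_derivative[OF Ck_on_iter that] by (rule has_derivative_at_withinI)
    show "0 \<in> ?B" using rpos by simp
    then show "(\<lambda>n. ?u n 0) sums suminf (\<lambda>n. ?u n 0)" by (intro summable_sums tail(1))
    fix e :: real assume e: "e > 0"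
    have "(\<lambda>n. 2 * ?D * (1/2)^n) \<longlonglongrightarrow> 0"
      by (intro tendsto_mult_right_zero LIMSEQ_power_zero) simp
    then have "\<forall>\<^sub>F n in sequentially. 2 * ?D * (1/2)^n < e" using e by (rule order_tendstoD)
    then show "\<forall>\<^sub>F n in sequentially. \<forall>x\<in>?B. \<forall>h. norm ((\<Sum>i<n. frechet_derivative (?u i) (at x) h) - g' x h) \<le> e * norm h"
    proof eventually_elim
      case (elim n)
      show ?case
      proof (intro ballI allI)
        fix x h assume x: "x \<in> ?B"
        have "norm ((\<Sum>i<n. frechet_derivative (?u i) (at x) h) - g' x h) \<le> 2 * (?D * norm h) * (1/2)^n"
          unfolding g'_def by (rule dtail(2)[OF x])
        also have "\<dots> = 2 * ?D * (1/2)^n * norm h" by simp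
        also have "\<dots> \<le> e * norm h" using elim by (intro mult_right_mono) auto
        finally show "norm ((\<Sum>i<n. frechet_derivative (?u i) (at x) h) - g' x h) \<le> e * norm h" .
      qed
    qed
  qed
  then obtain g where gs: "\<And>x. x \<in> ?B \<Longrightarrow> (\<lambda>n. ?u n x) sums g x"
    and gd: "\<And>x. x \<in> ?B \<Longrightarrow> (g has_derivative g' x) (at x)"
    using at_within_open[OF _ open_ball] by metis
  have g_eq: "g x = suminf (\<lambda>n. ?u n x)" if "x \<in> ?B" for x using gs[OF that] by (rule sums_unique)
  have g: "Ck_on (Suc 0) ?B g"
  proof (rule Ck_on_SucI[OF open_ball gd])
    fix v
    have "continuous_on ?B (\<lambda>x. g' x v)"
      unfolding g'_def
    proof (rule uniform_limit_theorem[OF _ Weierstrass_m_test])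
      show "norm (frechet_derivative (?u n) (at x) v) \<le> ?D * norm v * (1/2)^n" if "x \<in> ?B" for n x
        by (rule du[OF that])
      show "summable (\<lambda>n. ?D * norm v * (1/2)^n)" by (intro summable_mult summable_geometric) simp
      have "continuous_on ?B (\<lambda>x. frechet_derivative (?u i) (at x) v)" for i
        using Ck_on_iter[of "Suc 0" i] unfolding Ck_on.simps by blast
      then show "\<forall>\<^sub>F n in sequentially. continuous_on ?B (\<lambda>x. \<Sum>i<n. frechet_derivative (?u i) (at x) v)"
        by (intro always_eventually allI continuous_on_sum)
    qed simp
    then show "Ck_on 0 ?B (\<lambda>x. g' x v)" by simp
  qed
  have fix_g: "g x = w0 + picard g x" if x: "x \<in> ?B" for x
  proof -
    \<comment> \<open>\<open>picard\<close> is linear, so the shifted partial sum minus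
      \<open>picard g\<close> is \<open>picard\<close> of the partial sum minus \<open>g\<close>,
      and the contraction estimate applies to the tail of the series.\<close>
    have pN: "norm ((\<Sum>n<N. ?u (Suc n) x) - picard g x) \<le> (2 * norm w0 * (1/2)^N) / 4" for N
    proof -
      let ?h = "\<lambda>y. (\<Sum>n<N. ?u n y) - g y"
      have gc: "continuous_on ?B g" by (rule Ck_on_continuous[OF g])
      have uc: "continuous_on ?B (?u n)" for n by (rule Ck_on_continuous[OF Ck_on_iter])
      have h: "Ck_on 0 ?B ?h" unfolding Ck_on.simps by (intro continuous_intros gc uc)
      have int: "(\<lambda>t. A (t *\<^sub>R x) x (f (t *\<^sub>R x))) integrable_on {0..1}" if "continuous_on ?B f" for f
        by (rule integrable_continuous_real[OF picard_integrand_continuous[of 0, OF _ x]]) (simp add: that)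
      have "picard ?h x = integral {0..1} (\<lambda>t. (\<Sum>n<N. A (t *\<^sub>R x) x (?u n (t *\<^sub>R x))) - A (t *\<^sub>R x) x (g (t *\<^sub>R x)))"
        unfolding picard_def
      proof (rule integral_cong)
        fix t :: real assume "t \<in> {0..1}"
        then have "linear (A (t *\<^sub>R x) x)" using lin2 ray[OF x] r by blast
        then show "A (t *\<^sub>R x) x ((\<Sum>n<N. ?u n (t *\<^sub>R x)) - g (t *\<^sub>R x)) =
            (\<Sum>n<N. A (t *\<^sub>R x) x (?u n (t *\<^sub>R x))) - A (t *\<^sub>R x) x (g (t *\<^sub>R x))"
          by (simp add: linear_diff linear_sum)
      qed
      also have "\<dots> = (\<Sum>n<N. picard (?u n) x) - picard g x"
        unfolding picard_def
        by (subst integral_diff[OF integrable_sum[OF finite_lessThan int[OF uc]] int[OF gc]])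
          (simp add: integral_sum[OF finite_lessThan int[OF uc]])
      finally have eq: "picard ?h x = (\<Sum>n<N. ?u (Suc n) x) - picard g x" by simp
      have "norm (picard ?h x) \<le> (2 * norm w0 * (1/2)^N) / 4"
        by (rule picard_bound[OF h x M(1,2) A_bound]) (use tail(2) g_eq in auto)
      then show ?thesis unfolding eq .
    qed
    have "(\<lambda>N. (2 * norm w0 * (1/2)^N) / 4) \<longlonglongrightarrow> 0"
      by (intro tendsto_divide_zero tendsto_mult_right_zero LIMSEQ_power_zero) simp
    then have "(\<lambda>N. (\<Sum>n<N. ?u (Suc n) x) - picard g x) \<longlonglongrightarrow> 0"
      by (rule Lim_null_comparison[rotated]) (use pN in simp)
    then have "(\<lambda>n. ?u (Suc n) x) sums picard g x"
      unfolding sums_def using Lim_null by blast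
    \<comment> \<open>The series of \<open>g\<close> without its term of index 0, which is
      \<open>w0\<close>.\<close>
    moreover have "(\<lambda>n. ?u (Suc n) x) sums (g x - ?u 0 x)"
      using gs[OF x] sums_Suc_iff[of "\<lambda>n. ?u n x" "g x - ?u 0 x"] by (simp del: iter.simps)
    ultimately have "picard g x = g x - ?u 0 x" by (rule sums_unique2)
    then show ?thesis by simp
  qed
  show thesis
  proof (rule that[OF g fix_g])
    show "norm (g x) \<le> 2 * norm w0" if "x \<in> ?B" for x using tail(3)[OF that] g_eq[OF that] by simp
    show "norm (frechet_derivative g (at x) v) \<le> 16 * M * norm w0 * norm v" if "x \<in> ?B" for x v
      using dtail(3)[OF that, of v] frechet_derivative_eqI[OF gd[OF that]] by (simp add: g'_def mult_ac)
  qed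
qed

text \<open>The defect \<open>E x v\<close> of a solution of the integral equation vanishes for \<open>v = x\<close> by the fundamental
  theorem of calculus along the ray; flatness then turns the defect in a general direction into the
  solution of a homogeneous integral equation with contracting kernel.\<close>
lemma flat_solution:
  assumes flat: "\<And>y u v w. y \<in> S \<Longrightarrow> dA y u v w + A y v (A y u w) = dA y v u w + A y u (A y v w)"
  obtains g where "g 0 = w0" "\<And>x. x \<in> ball 0 r \<Longrightarrow> (g has_derivative (\<lambda>v. A x v (g x))) (at x)"
proof -
  let ?B = "ball (0::'e) r"
  obtain g where g: "Ck_on (Suc 0) ?B g" and fix_g: "\<And>x. x \<in> ?B \<Longrightarrow> g x = w0 + picard g x"
    and g_bound: "\<And>x. x \<in> ?B \<Longrightarrow> norm (g x) \<le> 2 * norm w0"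
    and dg_bound: "\<And>x v. x \<in> ?B \<Longrightarrow> norm (frechet_derivative g (at x) v) \<le> 16 * M * norm w0 * norm v"
    using picard_fixed_point by blast
  let ?g = "\<lambda>x. frechet_derivative g (at x)"
  define E where "E = (\<lambda>x v. ?g x v - A x v (g x))"
  have gd: "(g has_derivative ?g x) (at x)" if "x \<in> ?B" for x by (rule Ck_on_Suc_derivative[OF g that])
  have glin: "linear (?g x)" if "x \<in> ?B" for x using gd[OF that] has_derivative_linear by blast
  have g_int: "?g x v = integral {0..1} (dpicard g x v)" if x: "x \<in> ?B" for x v
  proof -
    have "((\<lambda>x. w0 + picard g x) has_derivative (\<lambda>v. integral {0..1} (dpicard g x v))) (at x)"
      using has_derivative_add[OF has_derivative_const picard_derivative(1)[OF g x]] by simp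
    then have "(g has_derivative (\<lambda>v. integral {0..1} (dpicard g x v))) (at x)"
      by (rule has_derivative_transform_within_open[OF _ open_ball x]) (rule fix_g[symmetric])
    from frechet_derivative_eqI[OF this] show ?thesis by simp
  qed
  \<comment> \<open>The function t -> t A(tx) v (g(tx)) vanishes at t = 0. Its derivative is
    integrated in order to write the second term of the defect as an integral over the ray as
    well.\<close>
  have int: "((\<lambda>t. A (t *\<^sub>R x) v (g (t *\<^sub>R x)) + t *\<^sub>R (dA (t *\<^sub>R x) x v (g (t *\<^sub>R x)) + A (t *\<^sub>R x) v (?g (t *\<^sub>R x) x)))
      has_integral A x v (g x)) {0..1}" if x: "x \<in> ?B" for x v
  proof -
    let ?T = "{t::real. t *\<^sub>R x \<in> ?B}"
    have "open ((\<lambda>t. t *\<^sub>R x) -` ?B)" by (intro open_vimage continuous_intros) auto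
    then have T: "open ?T" by (simp add: vimage_def)
    have "((\<lambda>t. t *\<^sub>R A (t *\<^sub>R x) v (g (t *\<^sub>R x))) has_vector_derivative
      (A (t *\<^sub>R x) v (g (t *\<^sub>R x)) + t *\<^sub>R (dA (t *\<^sub>R x) x v (g (t *\<^sub>R x)) + A (t *\<^sub>R x) v (?g (t *\<^sub>R x) x)))) (at t)"
      if t: "t \<in> {0..1}" for t
    proof -
      note tx = ray[OF x t]
      have y: "((\<lambda>t. t *\<^sub>R x) has_derivative (\<lambda>h. h *\<^sub>R x)) (at t)" by (auto intro!: derivative_eq_intros)
      have w: "((\<lambda>t. g (t *\<^sub>R x)) has_derivative (\<lambda>h. ?g (t *\<^sub>R x) (h *\<^sub>R x))) (at t)"
        by (rule has_derivative_compose[OF y gd[OF tx]])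
      have "((\<lambda>t. A (t *\<^sub>R x) v (g (t *\<^sub>R x))) has_derivative
         (\<lambda>h. dA (t *\<^sub>R x) (h *\<^sub>R x) v (g (t *\<^sub>R x)) + A (t *\<^sub>R x) 0 (g (t *\<^sub>R x)) + A (t *\<^sub>R x) v (?g (t *\<^sub>R x) (h *\<^sub>R x)))) (at t)"
        by (rule compose_derivative[OF T _ _ y has_derivative_const w]) (use tx r in auto)
      from has_derivative_scaleR[OF has_derivative_ident this]
      show ?thesis
        unfolding has_vector_derivative_def
        using linear_0[OF lin1[OF subsetD[OF r tx]]] linear_scale[OF dA_linear[OF subsetD[OF r tx]]]
          linear_scale[OF lin2[OF subsetD[OF r tx]]] linear_scale[OF glin[OF tx]]
        by (simp add: algebra_simps)
    qed
    from fundamental_theorem_of_calculus[of 0 1, OF _ has_vector_derivative_at_within[OF this]]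
    show ?thesis by simp
  qed
  have E_int: "E x v = integral {0..1} (\<lambda>t. t *\<^sub>R (dA (t *\<^sub>R x) v x (g (t *\<^sub>R x)) - dA (t *\<^sub>R x) x v (g (t *\<^sub>R x))
      + A (t *\<^sub>R x) x (?g (t *\<^sub>R x) v)) - A (t *\<^sub>R x) v (t *\<^sub>R ?g (t *\<^sub>R x) x))" if x: "x \<in> ?B" for x v
  proof -
    have "E x v = integral {0..1} (dpicard g x v) - integral {0..1}
      (\<lambda>t. A (t *\<^sub>R x) v (g (t *\<^sub>R x)) + t *\<^sub>R (dA (t *\<^sub>R x) x v (g (t *\<^sub>R x)) + A (t *\<^sub>R x) v (?g (t *\<^sub>R x) x)))"
      unfolding E_def g_int[OF x] integral_unique[OF int[OF x]] ..
    also have "\<dots> = integral {0..1} (\<lambda>t. dpicard g x v t -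
      (A (t *\<^sub>R x) v (g (t *\<^sub>R x)) + t *\<^sub>R (dA (t *\<^sub>R x) x v (g (t *\<^sub>R x)) + A (t *\<^sub>R x) v (?g (t *\<^sub>R x) x))))"
      by (rule integral_diff[symmetric, OF integrable_continuous_real[OF picard_derivative(2)[OF g x]]
            has_integral_integrable[OF int[OF x]]])
    also have "\<dots> = integral {0..1} (\<lambda>t. t *\<^sub>R (dA (t *\<^sub>R x) v x (g (t *\<^sub>R x)) - dA (t *\<^sub>R x) x v (g (t *\<^sub>R x))
      + A (t *\<^sub>R x) x (?g (t *\<^sub>R x) v)) - A (t *\<^sub>R x) v (t *\<^sub>R ?g (t *\<^sub>R x) x))"
    proof (rule integral_cong)
      fix t :: real assume t: "t \<in> {0..1}"
      note tx = ray[OF x t]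
      show "dpicard g x v t - (A (t *\<^sub>R x) v (g (t *\<^sub>R x)) + t *\<^sub>R (dA (t *\<^sub>R x) x v (g (t *\<^sub>R x)) + A (t *\<^sub>R x) v (?g (t *\<^sub>R x) x)))
        = t *\<^sub>R (dA (t *\<^sub>R x) v x (g (t *\<^sub>R x)) - dA (t *\<^sub>R x) x v (g (t *\<^sub>R x))
      + A (t *\<^sub>R x) x (?g (t *\<^sub>R x) v)) - A (t *\<^sub>R x) v (t *\<^sub>R ?g (t *\<^sub>R x) x)"
        using linear_scale[OF dA_linear[OF subsetD[OF r tx]]] linear_scale[OF lin2[OF subsetD[OF r tx]]] linear_scale[OF glin[OF tx]]
        by (simp add: dpicard_def algebra_simps)
    qed
    finally show ?thesis .
  qed
  \<comment> \<open>For \<open>v = x\<close> the terms of the integrand in \<open>E_int\<close>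
    cancel in pairs.\<close>
  have radial: "E x x = 0" if x: "x \<in> ?B" for x
  proof -
    have "E x x = integral {0..1::real} (\<lambda>t. 0)"
      unfolding E_int[OF x]
      by (rule integral_cong) (use linear_scale[OF lin2[OF subsetD[OF r ray[OF x]]]] in simp)
    then show ?thesis by simp
  qed
  have E_eq: "E x v = integral {0..1} (\<lambda>t. t *\<^sub>R A (t *\<^sub>R x) x (E (t *\<^sub>R x) v))" if x: "x \<in> ?B" for x v
    unfolding E_int[OF x]
  proof (rule integral_cong)
    fix t :: real assume t: "t \<in> {0..1}"
    note tx = ray[OF x t]
    note l2 = lin2[OF subsetD[OF r tx]]
    \<comment> \<open>The factor \<open>t\<close> is kept: the radial equation at
      \<open>t *\<^sub>R x\<close> concerns the direction \<open>t *\<^sub>R x\<close>, and in this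
      form \<open>t = 0\<close> is no exception.\<close>
    have 1: "t *\<^sub>R ?g (t *\<^sub>R x) x = t *\<^sub>R A (t *\<^sub>R x) x (g (t *\<^sub>R x))"
      using radial[OF tx] linear_scale[OF glin[OF tx]] linear_scale[OF lin1[OF subsetD[OF r tx]]] by (simp add: E_def)
    have 2: "dA (t *\<^sub>R x) v x (g (t *\<^sub>R x)) - dA (t *\<^sub>R x) x v (g (t *\<^sub>R x)) =
        A (t *\<^sub>R x) v (A (t *\<^sub>R x) x (g (t *\<^sub>R x))) - A (t *\<^sub>R x) x (A (t *\<^sub>R x) v (g (t *\<^sub>R x)))"
      using flat[OF subsetD[OF r tx], of v x "g (t *\<^sub>R x)"] by (simp add: algebra_simps)
    show "t *\<^sub>R (dA (t *\<^sub>R x) v x (g (t *\<^sub>R x)) - dA (t *\<^sub>R x) x v (g (t *\<^sub>R x))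
      + A (t *\<^sub>R x) x (?g (t *\<^sub>R x) v)) - A (t *\<^sub>R x) v (t *\<^sub>R ?g (t *\<^sub>R x) x) = t *\<^sub>R A (t *\<^sub>R x) x (E (t *\<^sub>R x) v)"
      unfolding 1 2 by (simp add: E_def linear_scale[OF l2] linear_diff[OF l2] algebra_simps)
  qed
  have E_zero: "E x v = 0" if x: "x \<in> ?B" for x v
  proof -
    have Ec: "Ck_on 0 ?B (\<lambda>x. E x v)"
    proof -
      have "Ck_on 0 ?B (\<lambda>x. A x v (g x))"
        by (rule Ck_on_A[OF open_ball subsetD[OF r] Ck_on_id[OF open_ball] Ck_on_const[OF open_ball] Ck_on_SucD[OF g]])
      moreover have "Ck_on 0 ?B (\<lambda>x. ?g x v)" using g unfolding Ck_on.simps by blast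
      ultimately show ?thesis unfolding E_def Ck_on.simps by (rule continuous_on_diff[rotated])
    qed
    \<comment> \<open>\<open>Z\<close> bounds the two terms of the defect; each use of
      \<open>E_eq\<close> gains a factor 1/4, so iteration forces the defect to vanish.\<close>
    define Z where "Z = 16 * M * norm w0 * norm v + M * norm v * (2 * norm w0)"
    have "norm (E x v) \<le> Z * (1/4)^n" for n
      using x
    proof (induction n arbitrary: x)
      case 0
      have "norm (A x v (g x)) \<le> M * norm v * (2 * norm w0)"
        by (rule order_trans[OF A_bound[OF 0]]) (intro mult_left_mono g_bound 0 mult_nonneg_nonneg M norm_ge_zero)
      then have "norm (E x v) \<le> Z"
        using norm_triangle_ineq4[of "?g x v" "A x v (g x)"] dg_bound[OF 0, of v]
        unfolding E_def Z_def by linarith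
      then show ?case by simp
    next
      case (Suc n)
      have "norm (integral {0..1} (\<lambda>t. t *\<^sub>R A (t *\<^sub>R x) x (E (t *\<^sub>R x) v))) \<le> Z * (1/4)^Suc n * (1 - 0)"
      proof (rule integral_bound)
        show "continuous_on {0..1} (\<lambda>t. t *\<^sub>R A (t *\<^sub>R x) x (E (t *\<^sub>R x) v))"
          by (intro continuous_intros picard_integrand_continuous[OF Ec Suc.prems])
        fix t :: real assume t: "t \<in> {0..1}"
        note tx = ray[OF Suc.prems t]
        have "norm (t *\<^sub>R A (t *\<^sub>R x) x (E (t *\<^sub>R x) v)) \<le> norm (A (t *\<^sub>R x) x (E (t *\<^sub>R x) v))"
          using t by (auto intro: mult_left_le_one_le)
        also have "\<dots> \<le> M * norm x * norm (E (t *\<^sub>R x) v)" by (rule A_bound[OF tx])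
        also have "\<dots> \<le> (M * r) * (Z * (1/4)^n)"
          using Suc.prems M(1) rpos by (intro mult_mono mult_left_mono Suc.IH tx) auto
        also have "\<dots> \<le> 1/4 * (Z * (1/4)^n)"
          using M(1) by (intro mult_right_mono M(2)) (simp add: Z_def)
        finally show "norm (t *\<^sub>R A (t *\<^sub>R x) x (E (t *\<^sub>R x) v)) \<le> Z * (1/4)^Suc n" by simp
      qed simp
      then show ?case by (simp add: E_eq[OF Suc.prems, symmetric])
    qed
    moreover have "(\<lambda>n. Z * (1/4)^n) \<longlonglongrightarrow> 0"
      by (intro tendsto_mult_right_zero LIMSEQ_power_zero) simp
    ultimately have "norm (E x v) \<le> 0" by (intro LIMSEQ_le_const) auto
    then show ?thesis by simp
  qed
  show thesis
  proof (rule that)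
    have "0 \<in> S" using subsetD[OF r, of 0] rpos by simp
    then have "picard g 0 = 0" using linear_0[OF lin1] by (simp add: picard_def)
    then show "g 0 = w0" using fix_g[of 0] rpos by simp
    show "(g has_derivative (\<lambda>v. A x v (g x))) (at x)" if "x \<in> ?B" for x
    proof -
      have "?g x = (\<lambda>v. A x v (g x))" using E_zero[OF that] by (simp add: E_def fun_eq_iff)
      then show ?thesis using gd[OF that] by simp
    qed
  qed
qed

end

end

text \<open>The system is linear, so the radius depends only on the coefficients and not on
  \<open>w0\<close>; solutions for all initial values share one ball.\<close>

theorem flat_system_solvable:
  assumes "0 \<in> S"
    and flat: "\<And>y u v w. y \<in> S \<Longrightarrow> dA y u v w + A y v (A y u w) = dA y v u w + A y u (A y v w)"
  obtains r where "r > 0" "ball 0 r \<subseteq> S"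
    "\<And>w0. \<exists>g. g 0 = w0 \<and> (\<forall>x\<in>ball 0 r. (g has_derivative (\<lambda>v. A x v (g x))) (at x))"
proof -
  obtain s where s: "s > 0" "cball 0 s \<subseteq> S" using S assms(1) open_contains_cball by blast
  obtain M where M: "M \<ge> 0" "\<And>x v w. x \<in> cball 0 s \<Longrightarrow> norm (A x v w) \<le> M * norm v * norm w"
    "\<And>x u v w. x \<in> cball 0 s \<Longrightarrow> norm (dA x u v w) \<le> M * norm u * norm v * norm w"
    using local_bound[OF compact_cball s(2)] by blast
  \<comment> \<open>The bounds keep the ball inside the compact set, give \<open>r \<le> 1\<close>,
    and give \<open>M * r \<le> 1/4\<close>; \<open>M + 1\<close> avoids a zero denominator.\<close>
  define r where "r = min s (min 1 (1 / (4 * (M + 1))))"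
  have sub: "ball 0 r \<subseteq> cball (0::'e) s" by (auto simp: r_def)
  have r: "r > 0" using s M by (auto simp: r_def)
  have r1: "r \<le> 1" unfolding r_def by linarith
  have "M * r \<le> M * (1 / (4 * (M + 1)))" using M(1) by (intro mult_left_mono) (auto simp: r_def)
  also have "\<dots> \<le> 1/4" using M(1) by (simp add: field_simps)
  finally have Mr: "M * r \<le> 1/4" .
  have rS: "ball 0 r \<subseteq> S" using sub s by blast
  show thesis
  proof (rule that[OF r rS])
    fix w0
    obtain g where "g 0 = w0" "\<And>x. x \<in> ball 0 r \<Longrightarrow> (g has_derivative (\<lambda>v. A x v (g x))) (at x)"
      using flat_solution[OF rS r M(1) Mr r1 M(2,3)[OF subsetD[OF sub]] flat] by metis
    then show "\<exists>g. g 0 = w0 \<and> (\<forall>x\<in>ball 0 r. (g has_derivative (\<lambda>v. A x v (g x))) (at x))" by blast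
  qed
qed

end

section \<open>Affine coordinates of a flat torsion-free connection\<close>

lemma (in linear_system) smooth_on_solution:
  assumes B: "open B" "B \<subseteq> S" and f: "\<And>x. x \<in> B \<Longrightarrow> (f has_derivative (\<lambda>v. A x v (f x))) (at x)"
  shows "smooth_on B f"
proof (rule smooth_on_ODE[OF B(1) f])
  fix k v assume "Ck_on k B f"
  then show "Ck_on k B (\<lambda>x. A x v (f x))"
    using B by (intro Ck_on_A Ck_on_id Ck_on_const) auto
qed

text \<open>A flat torsion-free connection in coordinates: \<open>sym\<close> is vanishing torsion
  and \<open>curv\<close> vanishing curvature. The base point is the origin, since the systems are
  solved along rays from 0.\<close>

locale flat_christoffel =
  fixes V :: "'e::euclidean_space set" and \<Gamma> :: "'e \<Rightarrow> 'e \<Rightarrow> 'e \<Rightarrow> 'e" and D\<Gamma> :: "'e \<Rightarrow> 'e \<Rightarrow> 'e \<Rightarrow> 'e \<Rightarrow> 'e"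
  assumes V: "open V" "0 \<in> V"
    and lin1: "\<And>x w. x \<in> V \<Longrightarrow> linear (\<lambda>v. \<Gamma> x v w)" and lin2: "\<And>x v. x \<in> V \<Longrightarrow> linear (\<Gamma> x v)"
    and smooth: "\<And>v w. smooth_on V (\<lambda>x. \<Gamma> x v w)"
    and sym: "\<And>x v w. x \<in> V \<Longrightarrow> \<Gamma> x v w = \<Gamma> x w v"
    and D: "\<And>x v w. x \<in> V \<Longrightarrow> ((\<lambda>x. \<Gamma> x v w) has_derivative (\<lambda>u. D\<Gamma> x u v w)) (at x)"
    and curv: "\<And>x u v w. x \<in> V \<Longrightarrow> D\<Gamma> x u v w + \<Gamma> x u (\<Gamma> x v w) = D\<Gamma> x v u w + \<Gamma> x v (\<Gamma> x u w)"
begin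

text \<open>The solutions of this system are the pairs \<open>(f, df)\<close> with parallel \<open>df\<close>.\<close>
definition A1 :: "'e \<Rightarrow> 'e \<Rightarrow> real \<times> 'e \<Rightarrow> real \<times> 'e" where
  "A1 x v s = (snd s \<bullet> v, \<Sum>b\<in>Basis. (snd s \<bullet> \<Gamma> x v b) *\<^sub>R b)"

lemma A1_inner: "snd (A1 x v s) \<bullet> w = snd s \<bullet> \<Gamma> x v w" if "x \<in> V"
proof -
  have "snd s \<bullet> \<Gamma> x v w = (\<Sum>b\<in>Basis. (w \<bullet> b) * (snd s \<bullet> \<Gamma> x v b))"
    by (subst linear_expand_Basis[OF lin2[OF that], of v w]) (simp add: inner_sum_right)
  then show ?thesis by (simp add: A1_def inner_sum_left inner_sum_right inner_commute[of _ w] mult.commute)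
qed

lemma system1: "linear_system A1 V"
proof (rule linear_system.intro)
  show "linear (\<lambda>v. A1 x v w)" if "x \<in> V" for x w
    using linear_add[OF lin1[OF that]] linear_scale[OF lin1[OF that]]
    by (intro linearI) (simp_all add: A1_def inner_add_right scaleR_add_left sum.distrib scaleR_sum_right)
  show "linear (A1 x v)" if "x \<in> V" for x v
    by (intro linearI) (simp_all add: A1_def inner_add_left scaleR_add_left sum.distrib scaleR_sum_right)
  show "smooth_on V (\<lambda>x. A1 x v w)" for v w
    unfolding A1_def
    by (intro smooth_on_Pair smooth_on_const smooth_on_sum smooth_on_scaleR smooth_on_inner smooth V)
qed (rule V)

interpretation s1: linear_system A1 V by (rule system1)

lemma dA1: "x \<in> V \<Longrightarrow> s1.dA x u v s = (0, \<Sum>b\<in>Basis. (snd s \<bullet> D\<Gamma> x u v b) *\<^sub>R b)"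
proof -
  assume x: "x \<in> V"
  have "((\<lambda>x. A1 x v s) has_derivative (\<lambda>u. (0, \<Sum>b\<in>Basis. (snd s \<bullet> D\<Gamma> x u v b) *\<^sub>R b))) (at x)"
    unfolding A1_def
    by (intro has_derivative_Pair has_derivative_const has_derivative_sum has_derivative_scaleR_left
        has_derivative_inner_right D x)
  from frechet_derivative_eqI[OF this] show ?thesis by (simp add: s1.dA_def)
qed

text \<open>Equality of mixed derivatives for the function component is the symmetry of \<Gamma>,
  that is vanishing torsion; for the covector component it is vanishing curvature.\<close>

lemma flat1: "x \<in> V \<Longrightarrow> s1.dA x u v s + A1 x v (A1 x u s) = s1.dA x v u s + A1 x u (A1 x v s)"
proof -
  assume x: "x \<in> V"
  have "snd s \<bullet> D\<Gamma> x u v b + snd s \<bullet> \<Gamma> x u (\<Gamma> x v b) = snd s \<bullet> D\<Gamma> x v u b + snd s \<bullet> \<Gamma> x v (\<Gamma> x u b)" for b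
    using curv[OF x, of u v b] by (metis inner_add_right)
  then have "(\<Sum>b\<in>Basis. (snd s \<bullet> D\<Gamma> x u v b + snd s \<bullet> \<Gamma> x u (\<Gamma> x v b)) *\<^sub>R b) =
    (\<Sum>b\<in>Basis. (snd s \<bullet> D\<Gamma> x v u b + snd s \<bullet> \<Gamma> x v (\<Gamma> x u b)) *\<^sub>R b)" by (simp only:)
  moreover have A: "A1 x v (A1 x u s) = (snd s \<bullet> \<Gamma> x u v, \<Sum>b\<in>Basis. (snd s \<bullet> \<Gamma> x u (\<Gamma> x v b)) *\<^sub>R b)" for u v
    by (subst A1_def) (simp add: A1_inner[OF x])
  ultimately show ?thesis
    unfolding A dA1[OF x] by (simp add: sum.distrib scaleR_add_left sym[OF x, of u v])
qed

text \<open>The solutions of this system are the parallel vector fields.\<close>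
definition A2 :: "'e \<Rightarrow> 'e \<Rightarrow> 'e \<Rightarrow> 'e" where "A2 x v w = - \<Gamma> x v w"

lemma system2: "linear_system A2 V"
proof (rule linear_system.intro)
  show "linear (\<lambda>v. A2 x v w)" if "x \<in> V" for x w
    unfolding A2_def using lin1[OF that] by (rule linear_compose_neg)
  show "linear (A2 x v)" if "x \<in> V" for x v
    unfolding A2_def[abs_def] using lin2[OF that] by (rule linear_compose_neg)
  show "smooth_on V (\<lambda>x. A2 x v w)" for v w
    unfolding A2_def by (intro smooth_on_minus smooth V)
qed (rule V)

interpretation s2: linear_system A2 V by (rule system2)

text \<open>The curvature identity with -\<Gamma> in place of \<Gamma>: the derivative terms change
  sign, the quadratic terms do not.\<close>

lemma flat2: "x \<in> V \<Longrightarrow> s2.dA x u v w + A2 x v (A2 x u w) = s2.dA x v u w + A2 x u (A2 x v w)"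
proof -
  assume x: "x \<in> V"
  have "((\<lambda>x. A2 x v w) has_derivative (\<lambda>u. - D\<Gamma> x u v w)) (at x)" for v
    unfolding A2_def by (intro has_derivative_minus D x)
  from frechet_derivative_eqI[OF this] have "s2.dA x u v w = - D\<Gamma> x u v w" for u v by (simp add: s2.dA_def)
  then show ?thesis
    using curv[OF x, of u v w] by (simp add: A2_def linear_neg[OF lin2[OF x]] algebra_simps)
qed

text \<open>The last two conclusions say that the coordinate fields of the new chart, expressed in
  the old one, are parallel; vanishing of the new Christoffel symbols is deduced from them.\<close>

lemma affine_coordinates:
  obtains W :: "'e set" and \<phi> \<psi> :: "'e \<Rightarrow> 'e" and Q :: "'e \<Rightarrow> 'e \<Rightarrow> 'e"
  where "open W" "connected W" "0 \<in> W" "W \<subseteq> V" "open (\<phi> ` W)"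
    "smooth_on W \<phi>" "smooth_on (\<phi> ` W) \<psi>" "\<And>x. x \<in> W \<Longrightarrow> \<psi> (\<phi> x) = x"
    "\<And>x. x \<in> W \<Longrightarrow> (\<psi> has_derivative Q x) (at (\<phi> x))"
    "\<And>x w. x \<in> W \<Longrightarrow> ((\<lambda>x. Q x w) has_derivative (\<lambda>v. - \<Gamma> x v (Q x w))) (at x)"
proof -
  obtain r1 where r1: "r1 > 0" "ball 0 r1 \<subseteq> V"
    "\<And>w0. \<exists>g. g 0 = w0 \<and> (\<forall>x\<in>ball 0 r1. (g has_derivative (\<lambda>v. A1 x v (g x))) (at x))"
    using s1.flat_system_solvable[OF V(2) flat1] by blast
  obtain r2 where r2: "r2 > 0" "ball 0 r2 \<subseteq> V"
    "\<And>w0. \<exists>g. g 0 = w0 \<and> (\<forall>x\<in>ball 0 r2. (g has_derivative (\<lambda>v. A2 x v (g x))) (at x))"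
    using s2.flat_system_solvable[OF V(2) flat2] by blast
  define B where "B = ball (0::'e) (min r1 r2)"
  have B: "open B" "convex B" "0 \<in> B" "B \<subseteq> V" using r1 r2 by (auto simp: B_def)
  have "\<forall>b. \<exists>g. g 0 = (0, b) \<and> (\<forall>x\<in>B. (g has_derivative (\<lambda>v. A1 x v (g x))) (at x))"
    using r1(3) by (fastforce simp: B_def)
  then obtain h where h: "\<And>b. h b 0 = (0, b)"
    "\<And>b x. x \<in> B \<Longrightarrow> (h b has_derivative (\<lambda>v. A1 x v (h b x))) (at x)" by metis
  have "\<forall>b. \<exists>g. g 0 = b \<and> (\<forall>x\<in>B. (g has_derivative (\<lambda>v. A2 x v (g x))) (at x))"
    using r2(3) by (fastforce simp: B_def)
  then obtain q where q: "\<And>b. q b 0 = b"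
    "\<And>b x. x \<in> B \<Longrightarrow> (q b has_derivative (\<lambda>v. A2 x v (q b x))) (at x)" by metis
  have hs: "smooth_on B (h b)" for b by (rule s1.smooth_on_solution[OF B(1,4) h(2)])
  have qs: "smooth_on B (q b)" for b by (rule s2.smooth_on_solution[OF B(1,4) q(2)])
  have pd: "((\<lambda>x. snd (h b x)) has_derivative (\<lambda>v. snd (A1 x v (h b x)))) (at x)" if "x \<in> B" for b x
    by (rule has_derivative_snd[OF h(2)[OF that]])
  \<comment> \<open>The components of \<open>\<phi>\<close> have parallel differentials that form
    the dual basis at 0. \<open>P\<close> is the derivative of \<open>\<phi>\<close>, and
    \<open>Q\<close> is the frame of parallel fields that is the identity at 0.\<close>
  define \<phi> where "\<phi> = (\<lambda>x. \<Sum>b\<in>Basis. fst (h b x) *\<^sub>R b)"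
  define P where "P = (\<lambda>x v. \<Sum>b\<in>Basis. (snd (h b x) \<bullet> v) *\<^sub>R b)"
  define Q where "Q = (\<lambda>x w. \<Sum>b\<in>Basis. (w \<bullet> b) *\<^sub>R q b x)"
  have Q: "((\<lambda>x. Q x w) has_derivative (\<lambda>v. - \<Gamma> x v (Q x w))) (at x)" if x: "x \<in> B" for x w
  proof -
    have "((\<lambda>x. Q x w) has_derivative (\<lambda>v. \<Sum>b\<in>Basis. (w \<bullet> b) *\<^sub>R A2 x v (q b x))) (at x)"
      unfolding Q_def by (intro has_derivative_sum has_derivative_scaleR_right q(2) x)
    moreover have "(\<Sum>b\<in>Basis. (w \<bullet> b) *\<^sub>R A2 x v (q b x)) = - \<Gamma> x v (Q x w)" for v
      using lin2[OF subsetD[OF B(4) x], of v]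
      by (simp add: A2_def Q_def linear_sum linear_scale sum_negf)
    ultimately show ?thesis by simp
  qed
  have PQ: "P x (Q x w) = w" if x: "x \<in> B" for x w
  proof -
    \<comment> \<open>Covector and field are both parallel, so the \<Gamma>-terms cancel in the
      derivative and the pairing keeps its value at 0.\<close>
    have "snd (h a x) \<bullet> q b x = snd (h a 0) \<bullet> q b 0" for a b
    proof (rule has_derivative_zero_unique[OF B(2) _ x B(3)])
      fix y assume y: "y \<in> B"
      have "((\<lambda>x. snd (h a x) \<bullet> q b x) has_derivative
        (\<lambda>v. snd (h a y) \<bullet> A2 y v (q b y) + snd (A1 y v (h a y)) \<bullet> q b y)) (at y)"
        by (rule has_derivative_inner[OF pd[OF y] q(2)[OF y]])
      then show "((\<lambda>x. snd (h a x) \<bullet> q b x) has_derivative (\<lambda>v. 0)) (at y within B)"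
        using A1_inner[OF subsetD[OF B(4) y]] by (simp add: A2_def has_derivative_at_withinI)
    qed
    then have "snd (h a x) \<bullet> Q x w = a \<bullet> w" for a
    proof -
      assume "\<And>a b. snd (h a x) \<bullet> q b x = snd (h a 0) \<bullet> q b 0"
      then have "snd (h a x) \<bullet> Q x w = (\<Sum>b\<in>Basis. (w \<bullet> b) * (a \<bullet> b))"
        by (simp add: Q_def inner_sum_right h(1) q(1))
      then show ?thesis by (simp add: euclidean_inner[of a w] mult.commute)
    qed
    then have "P x (Q x w) = (\<Sum>b\<in>Basis. (w \<bullet> b) *\<^sub>R b)" by (simp add: P_def inner_commute)
    then show ?thesis by (simp add: euclidean_representation)
  qed
  have \<phi>P: "(\<phi> has_derivative P x) (at x)" if x: "x \<in> B" for x
  proof -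
    have "(\<phi> has_derivative (\<lambda>v. \<Sum>b\<in>Basis. fst (A1 x v (h b x)) *\<^sub>R b)) (at x)"
      unfolding \<phi>_def by (intro has_derivative_sum has_derivative_scaleR_left has_derivative_fst h(2) x)
    then show ?thesis by (simp add: A1_def P_def[abs_def])
  qed
  have \<phi>s: "smooth_on B \<phi>"
    unfolding \<phi>_def by (intro smooth_on_sum smooth_on_scaleR smooth_on_fst smooth_on_const hs B)
  have Plin: "bounded_linear (P x)" if "x \<in> B" for x using \<phi>P[OF that] has_derivative_bounded_linear by blast
  have Qlin: "bounded_linear (Q x)" for x
    unfolding Q_def by (intro bounded_linear_sum bounded_linear_scaleR_const bounded_linear_inner_left)
  have QP: "Q x (P x w) = w" if x: "x \<in> B" for x w
  proof -
    have "P x \<circ> Q x = id" using PQ[OF x] by auto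
    then have "Q x \<circ> P x = id"
      using linear_inverse_left[of "P x" "Q x"] Plin[OF x] Qlin[of x] by (simp add: bounded_linear.linear)
    then show ?thesis by (metis comp_apply id_apply)
  qed
  have bP: "blinfun_apply (Blinfun (P x)) = P x" if "x \<in> B" for x
    by (rule bounded_linear_Blinfun_apply[OF Plin[OF that]])
  have c: "continuous_on B (\<lambda>x. Blinfun (P x))"
  proof (rule continuous_on_blinfun_componentwise)
    fix i :: 'e
    have "smooth_on B (\<lambda>x. P x i)"
      unfolding P_def by (intro smooth_on_sum smooth_on_scaleR smooth_on_inner smooth_on_snd smooth_on_const hs B)
    then have "continuous_on B (\<lambda>x. P x i)" by (rule smooth_on_continuous)
    then show "continuous_on B (\<lambda>x. blinfun_apply (Blinfun (P x)) i)"
      by (rule continuous_on_eq) (simp add: bP)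
  qed
  have d: "(\<phi> has_derivative blinfun_apply (Blinfun (P x))) (at x)" if "x \<in> B" for x
    using \<phi>P[OF that] by (simp add: bP[OF that])
  have i: "Blinfun (Q 0) o\<^sub>L Blinfun (P 0) = id_blinfun"
    by (rule blinfun_eqI) (simp add: bP[OF B(3)] bounded_linear_Blinfun_apply[OF Qlin] QP[OF B(3)])
  obtain U' V' g where U': "open U'" "U' \<subseteq> B" "0 \<in> U'" and hom: "homeomorphism U' V' \<phi> g"
    using inverse_function_theorem[OF B(1) d c B(3) i] by metis
  obtain r where r: "r > 0" "ball 0 r \<subseteq> U'" using U' open_contains_ball by blast
  \<comment> \<open>A ball, so that the coordinate domain is connected; constancy of the matrix of
    \<omega> will rest on this.\<close>
  let ?W = "ball (0::'e) r"
  have WB: "?W \<subseteq> B" using r U' by blast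
  have g: "g (\<phi> x) = x" if "x \<in> ?W" for x using hom r(2) that by (auto simp: homeomorphism_def)
  have \<phi>c: "continuous_on ?W \<phi>" using smooth_on_continuous[OF \<phi>s] WB by (rule continuous_on_subset)
  have inj: "inj_on \<phi> ?W" using g by (metis inj_onI)
  have oW: "open (\<phi> ` ?W)" by (rule invariance_of_domain[OF \<phi>c open_ball inj])
  have gd: "(g has_derivative Q x) (at (\<phi> x))" if x: "x \<in> ?W" for x
  proof (rule has_derivative_inverse_strong[OF open_ball x \<phi>c g \<phi>P])
    show "P x \<circ> Q x = id" using PQ subsetD[OF WB x] by auto
  qed (use x WB in auto)
  \<comment> \<open>The derivative of \<open>g\<close> at \<open>y\<close> is
    \<open>Q (g y)\<close>, and \<open>Q\<close> is smooth in its base point, so bootstrapping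
    applies.\<close>
  have gs: "smooth_on (\<phi> ` ?W) g"
  proof (rule smooth_on_ODE[OF oW, where F="\<lambda>y. Q (g y)"])
    show "(g has_derivative Q (g y)) (at y)" if "y \<in> \<phi> ` ?W" for y using that gd g by auto
    fix k v assume "Ck_on k (\<phi> ` ?W) g"
    then have "Ck_on k (\<phi> ` ?W) (\<lambda>y. q b (g y))" for b
      by (rule Ck_on_compose[OF oW B(1) _ _ smooth_on_Ck[OF qs], rotated]) (use g WB in force)
    then show "Ck_on k (\<phi> ` ?W) (\<lambda>y. Q (g y) v)"
      unfolding Q_def by (intro Ck_on_sum Ck_on_scaleR Ck_on_const oW)
  qed
  show thesis
  proof (rule that[where W="?W" and \<phi>=\<phi> and \<psi>=g and Q=Q])
    show "connected ?W" by (rule convex_connected[OF convex_ball])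
    show "0 \<in> ?W" using r(1) by simp
    show "?W \<subseteq> V" using WB B(4) by (rule subset_trans)
    show "smooth_on ?W \<phi>" by (rule smooth_on_subset[OF \<phi>s WB])
    show "((\<lambda>x. Q x w) has_derivative (\<lambda>v. - \<Gamma> x v (Q x w))) (at x)" if "x \<in> ?W" for x w
      by (rule Q[OF subsetD[OF WB that]])
  qed (use oW gs g gd in auto)
qed

end

section \<open>Charts obtained by coordinate changes, and structures with constant
  coefficients\<close>

context smooth_atlas_on
begin

lemma smooth_vfield_cong:
  assumes U: "openin (manifold_topology A) U" and X: "smooth_vfield A U X" and eq: "\<And>q. q \<in> U \<Longrightarrow> X' q = X q"
  shows "smooth_vfield A U X'"
  unfolding smooth_vfield_def
proof (intro conjI ballI)
  show "X' p \<in> tangent_space A p" if "p \<in> U" for p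
    using smooth_vfield_tangent[OF X that] eq[OF that] by simp
  fix c assume "c \<in> A"
  then have c: "c \<in> max_atlas A" by (rule atlas_in_max)
  show "smooth_on (snd c ` (U \<inter> fst c)) (\<lambda>x. X' (chart_inv c x) c)"
    by (rule smooth_on_eqI[OF open_chart_image[OF U c] smooth_vfieldD[OF U X c]]) (use eq c in auto)
qed

context
  fixes c :: "('a, 'e) chart" and \<phi> \<psi> :: "'e \<Rightarrow> 'e"
  assumes c: "c \<in> max_atlas A" and o: "open (\<phi> ` (snd c ` fst c))"
    and \<phi>: "smooth_on (snd c ` fst c) \<phi>" and \<psi>: "smooth_on (\<phi> ` (snd c ` fst c)) \<psi>"
    and inv: "\<And>x. x \<in> snd c ` fst c \<Longrightarrow> \<psi> (\<phi> x) = x"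
begin

lemma compose_max: "(fst c, \<phi> \<circ> snd c) \<in> max_atlas A"
  by (rule compose_chart[OF c subset_refl o \<phi> \<psi> inv])

lemma compose_apply:
  assumes q: "q \<in> fst c" and v: "v \<in> tangent_space A q"
  shows "v (fst c, \<phi> \<circ> snd c) = frechet_derivative \<phi> (at (snd c q)) (v c)"
proof -
  let ?d = "(fst c, \<phi> \<circ> snd c)"
  have at: "c \<in> charts_at A q" "?d \<in> charts_at A q" using q c compose_max by (auto simp: charts_at_iff)
  have "frechet_derivative (snd ?d \<circ> chart_inv c) (at (snd c q)) = frechet_derivative \<phi> (at (snd c q))"
    by (rule frechet_derivative_cong_open[OF open_chart[OF c]]) (use q c in auto)
  with tangent_change[OF v at] show ?thesis by simp
qed

lemma compose_coord_tvec:
  assumes q: "q \<in> fst c"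
  shows "coord_tvec A (fst c, \<phi> \<circ> snd c) q w c = frechet_derivative \<psi> (at (\<phi> (snd c q))) w"
proof -
  let ?d = "(fst c, \<phi> \<circ> snd c)"
  have at: "c \<in> charts_at A q" "?d \<in> charts_at A q" using q c compose_max by (auto simp: charts_at_iff)
  have "frechet_derivative (snd c \<circ> chart_inv ?d) (at (\<phi> (snd c q))) = frechet_derivative \<psi> (at (\<phi> (snd c q)))"
  proof (rule frechet_derivative_cong_open[OF o])
    show "\<phi> (snd c q) \<in> \<phi> ` (snd c ` fst c)" using q by blast
    fix y assume "y \<in> \<phi> ` (snd c ` fst c)"
    then obtain q' where q': "q' \<in> fst c" "y = \<phi> (snd c q')" by blast
    then have "chart_inv ?d y = q'" using chart_left[OF compose_max, of q'] by simp
    then show "(snd c \<circ> chart_inv ?d) y = \<psi> y" using q' inv by simp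
  qed
  then show ?thesis by (simp add: coord_tvec_apply[OF at(1)])
qed

end

lemma linear_chart:
  assumes c: "c \<in> max_atlas A" and L: "linear L" "linear L'" "\<And>x. L' (L x) = x" "\<And>x. L (L' x) = x"
  shows "(fst c, L \<circ> snd c) \<in> max_atlas A"
    and "\<And>q v. q \<in> fst c \<Longrightarrow> v \<in> tangent_space A q \<Longrightarrow> v (fst c, L \<circ> snd c) = L (v c)"
proof -
  have bl: "bounded_linear L" "bounded_linear L'" using L(1,2) by (simp_all add: linear_conv_bounded_linear)
  have "L ` S = L' -` S" for S using L(3,4) by (auto simp: image_iff) metis
  moreover have "open (L' -` (snd c ` fst c))"
    using open_chart[OF c] bl(2) by (intro open_vimage linear_continuous_on)
  ultimately have o: "open (L ` (snd c ` fst c))" by simp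
  have s: "smooth_on (snd c ` fst c) L" by (rule smooth_on_linear[OF open_chart[OF c] bl(1) smooth_on_id[OF open_chart[OF c]]])
  have s': "smooth_on (L ` (snd c ` fst c)) L'" by (rule smooth_on_linear[OF o bl(2) smooth_on_id[OF o]])
  show "(fst c, L \<circ> snd c) \<in> max_atlas A" by (rule compose_max[OF c o s s' L(3)])
  fix q v assume "q \<in> fst c" "v \<in> tangent_space A q"
  from compose_apply[OF c o s s' L(3) this] frechet_derivative_eqI[OF bounded_linear_imp_has_derivative[OF bl(1)]]
  show "v (fst c, L \<circ> snd c) = L (v c)" by simp
qed

lemma restrict_apply:
  assumes c: "c \<in> max_atlas A" and W: "openin (manifold_topology A) W" "W \<subseteq> fst c"
    and q: "q \<in> W" and v: "v \<in> tangent_space A q"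
  shows "v (W, snd c) = v c"
proof -
  let ?d = "(W, snd c)"
  have d: "?d \<in> max_atlas A" by (rule restrict_chart[OF c W])
  have at: "c \<in> charts_at A q" "?d \<in> charts_at A q" using q c d W by (auto simp: charts_at_iff)
  have "frechet_derivative (snd ?d \<circ> chart_inv c) (at (snd c q)) = frechet_derivative (\<lambda>x. x) (at (snd c q))"
    by (rule frechet_derivative_cong_open[OF open_chart[OF c]]) (use q W c in auto)
  with tangent_change[OF v at] show ?thesis by simp
qed

text \<open>A structure that is one fixed endomorphism in a chart around each point inherits
  linearity, square -1 and smoothness from that endomorphism. What remains for a given structure is
  to find such charts.\<close>

lemma complex_structureI:
  assumes i: "linear i\<^sub>0" "\<And>x. i\<^sub>0 (i\<^sub>0 x) = - x"
    and K: "\<And>p v. p \<in> mcarrier A \<Longrightarrow> v \<in> tangent_space A p \<Longrightarrow> K p v \<in> tangent_space A p"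
    and ch: "\<And>p. p \<in> mcarrier A \<Longrightarrow> \<exists>c\<in>charts_at A p. \<forall>q\<in>fst c. \<forall>v\<in>tangent_space A q. K q v c = i\<^sub>0 (v c)"
  shows "almost_complex A K" "integrable_structure i\<^sub>0 A K"
proof -
  show "integrable_structure i\<^sub>0 A K" using ch by (simp add: integrable_structure_def)
  show "almost_complex A K"
    unfolding almost_complex_def linear_between_def
  proof (intro conjI ballI allI impI)
    fix p assume p: "p \<in> mcarrier A"
    obtain c where c: "c \<in> charts_at A p" and Kc: "\<And>v. v \<in> tangent_space A p \<Longrightarrow> K p v c = i\<^sub>0 (v c)"
      using ch[OF p] charts_at_iff by blast
    note t = tangent_add[OF c] tangent_scaleR[OF c] tangent_minus[OF c] K[OF p]
    show "K p v \<in> tangent_space A p" if "v \<in> tangent_space A p" for v by (rule K[OF p that])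
    show "K p (v + w) = K p v + K p w" if "v \<in> tangent_space A p" "w \<in> tangent_space A p" for v w
      by (rule tangent_eqI[OF _ _ c]) (simp_all add: that t Kc linear_add[OF i(1)])
    show "K p (r *\<^sub>R v) = r *\<^sub>R K p v" if "v \<in> tangent_space A p" for r v
      by (rule tangent_eqI[OF _ _ c]) (simp_all add: that t Kc linear_scale[OF i(1)])
    show "K p (K p v) = - v" if "v \<in> tangent_space A p" for v
    proof (rule tangent_eqI[OF _ _ c])
      show "K p (K p v) c = (- v) c"
        using Kc[OF that] Kc[OF K[OF p that]] i(2) by (simp add: fun_Compl_def)
    qed (simp_all add: that t)
  next
    fix U X assume U: "openin (manifold_topology A) U" and X: "smooth_vfield A U X"
    show "smooth_vfield A U (\<lambda>p. K p (X p))"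
    proof (rule smooth_vfieldI[OF U])
      fix p assume p: "p \<in> U"
      then have pm: "p \<in> mcarrier A" using U openin_manifold by blast
      show "K p (X p) \<in> tangent_space A p" by (rule K[OF pm smooth_vfield_tangent[OF X p]])
      obtain c where c: "c \<in> charts_at A p" and Kc: "\<And>q v. q \<in> fst c \<Longrightarrow> v \<in> tangent_space A q \<Longrightarrow> K q v c = i\<^sub>0 (v c)"
        using ch[OF pm] by blast
      then have cm: "c \<in> max_atlas A" by (simp add: charts_at_iff)
      note o = open_chart_image[OF U cm]
      have "smooth_on (snd c ` (U \<inter> fst c)) (\<lambda>x. i\<^sub>0 (X (chart_inv c x) c))"
        by (rule smooth_on_linear[OF o _ smooth_vfieldD[OF U X cm]])
          (use i(1) in \<open>simp add: linear_conv_bounded_linear\<close>)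
      then have "smooth_on (snd c ` (U \<inter> fst c)) (\<lambda>x. K (chart_inv c x) (X (chart_inv c x)) c)"
        by (rule smooth_on_eqI[OF o]) (use Kc smooth_vfield_tangent[OF X] cm in auto)
      then show "\<exists>e\<in>charts_at A p. smooth_on (snd e ` (U \<inter> fst e)) (\<lambda>x. K (chart_inv e x) (X (chart_inv e x)) e)"
        using c by blast
    qed
  qed
qed

end

section \<open>Christoffel symbols of a flat torsion-free connection\<close>

locale flat_connection_on = connection_on A nabla for A :: "('a, 'e::euclidean_space) chart set" and nabla +
  assumes flat: "flat A nabla" and torsion: "torsion_free A nabla"
begin

lemma coord_field_frechet:
  assumes c: "c \<in> charts_at A p"
  shows "frechet_derivative (\<lambda>x. coord_tvec A c (chart_inv c x) w c) (at (snd c p)) = (\<lambda>_. 0)"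
proof -
  have cm: "c \<in> max_atlas A" "p \<in> fst c" using c by (auto simp: charts_at_iff)
  have "frechet_derivative (\<lambda>x. coord_tvec A c (chart_inv c x) w c) (at (snd c p)) = frechet_derivative (\<lambda>x. w) (at (snd c p))"
    by (rule frechet_derivative_cong_open[OF open_chart[OF cm(1)]]) (use cm coord_const_field in auto)
  then show ?thesis by simp
qed

lemma bracket_coord:
  assumes c: "c \<in> charts_at A p"
  shows "lie_bracket A (\<lambda>q. coord_tvec A c q v) (\<lambda>q. coord_tvec A c q w) p c = 0"
  using c by (simp add: lie_bracket_def coord_field_frechet)

lemma torsionD:
  assumes "openin (manifold_topology A) U" "smooth_vfield A U X" "smooth_vfield A U Y" "p \<in> U"
  shows "lie_bracket A X Y p = nabla X Y p - nabla Y X p"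
proof -
  have "nabla X Y p - nabla Y X p - lie_bracket A X Y p = 0"
    using torsion assms unfolding torsion_free_def by blast
  then show ?thesis by (simp only: right_minus_eq)
qed

context
  fixes c :: "('a, 'e) chart"
  assumes cm: "c \<in> max_atlas A"
begin

lemmas domain_open = openin_chart[OF cm]

lemma coord_field: "smooth_vfield A (fst c) (\<lambda>q. coord_tvec A c q v)"
  by (rule smooth_coord_const[OF cm domain_open subset_refl])

text \<open>Coordinate fields commute, so vanishing torsion equates their two covariant
  derivatives.\<close>

lemma chris_sym:
  assumes "p \<in> fst c" shows "chris c p v w = chris c p w v"
proof -
  have c: "c \<in> charts_at A p" using cm assms by (simp add: charts_at_iff)
  have "lie_bracket A (\<lambda>q. coord_tvec A c q v) (\<lambda>q. coord_tvec A c q w) p c = chris c p v w - chris c p w v"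
    using torsionD[OF domain_open coord_field coord_field assms, of v w] by (simp add: chris_def)
  then show ?thesis using bracket_coord[OF c] by simp
qed

lemma bracket_zero:
  assumes "p \<in> fst c" shows "lie_bracket A (\<lambda>q. coord_tvec A c q v) (\<lambda>q. coord_tvec A c q w) p = 0"
proof -
  have c: "c \<in> charts_at A p" using cm assms by (simp add: charts_at_iff)
  note t = smooth_vfield_tangent[OF nabla_smooth[OF domain_open coord_field coord_field] assms]
  have "lie_bracket A (\<lambda>q. coord_tvec A c q v) (\<lambda>q. coord_tvec A c q w) p \<in> tangent_space A p"
    unfolding torsionD[OF domain_open coord_field coord_field assms] by (rule tangent_diff[OF c t t])
  then show ?thesis
    by (rule tangent_eqI[OF _ tangent_zero[OF c] c]) (simp add: bracket_coord[OF c])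
qed

lemma chris_curvature:
  assumes p: "p \<in> fst c"
  shows "frechet_derivative (\<lambda>x. chris c (chart_inv c x) v w) (at (snd c p)) u + chris c p u (chris c p v w) =
    frechet_derivative (\<lambda>x. chris c (chart_inv c x) u w) (at (snd c p)) v + chris c p v (chris c p u w)"
proof -
  have c: "c \<in> charts_at A p" using cm p by (simp add: charts_at_iff)
  let ?X = "\<lambda>v q. coord_tvec A c q v"
  have z: "nabla (\<lambda>q. 0) (?X w) p = 0"
    using nabla_add1[OF domain_open smooth_vfield_zero[OF domain_open] coord_field smooth_vfield_zero[OF domain_open] p] by simp
  \<comment> \<open>As a total function the bracket is known to vanish only on \<open>fst c\<close>;
    being smooth there, it may be replaced by zero through locality of \<open>nabla\<close>.\<close>
  have "smooth_vfield A (fst c) (lie_bracket A (?X u) (?X v))"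
    by (rule smooth_vfield_cong[OF domain_open smooth_vfield_zero[OF domain_open]]) (rule bracket_zero)
  from nabla_cong[OF domain_open smooth_vfield_zero[OF domain_open] coord_field this coord_field bracket_zero refl p] z
  have b: "nabla (lie_bracket A (?X u) (?X v)) (?X w) p = 0" by simp
  have f: "nabla (?X u) (nabla (?X v) (?X w)) p - nabla (?X v) (nabla (?X u) (?X w)) p
      - nabla (lie_bracket A (?X u) (?X v)) (?X w) p = 0"
    using flat domain_open coord_field p unfolding flat_def by blast
  then have "nabla (?X u) (nabla (?X v) (?X w)) p = nabla (?X v) (nabla (?X u) (?X w)) p"
    unfolding b by (simp only: diff_zero right_minus_eq)
  then have "nabla (?X u) (nabla (?X v) (?X w)) p c = nabla (?X v) (nabla (?X u) (?X w)) p c" by simp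
  moreover have "nabla (?X u) (nabla (?X v) (?X w)) p c =
     frechet_derivative (\<lambda>x. chris c (chart_inv c x) v w) (at (snd c p)) u + chris c p u (chris c p v w)" for u v
    using nabla_chart[OF c domain_open p coord_field nabla_smooth[OF domain_open coord_field coord_field], of u v w] c by (simp add: chris_def)
  ultimately show ?thesis by simp
qed

lemma flat_christoffel:
  assumes "0 \<in> snd c ` fst c"
  shows "flat_christoffel (snd c ` fst c) (\<lambda>x. chris c (chart_inv c x))
    (\<lambda>x u v w. frechet_derivative (\<lambda>x. chris c (chart_inv c x) v w) (at x) u)"
proof (rule flat_christoffel.intro)
  have at: "c \<in> charts_at A (chart_inv c x)" "chart_inv c x \<in> fst c" if "x \<in> snd c ` fst c" for x
    using that cm by (auto simp: charts_at_iff)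
  show "linear (\<lambda>v. chris c (chart_inv c x) v w)" "linear (chris c (chart_inv c x) v)" if "x \<in> snd c ` fst c" for x v w
    using chris_linear1[OF at(1)[OF that]] chris_linear2[OF at(1)[OF that]] .
  show "smooth_on (snd c ` fst c) (\<lambda>x. chris c (chart_inv c x) v w)" for v w by (rule smooth_chris[OF cm])
  then show "((\<lambda>x. chris c (chart_inv c x) v w) has_derivative
      (\<lambda>u. frechet_derivative (\<lambda>x. chris c (chart_inv c x) v w) (at x) u)) (at x)" if "x \<in> snd c ` fst c" for x v w
    using that smooth_on_derivative by blast
  show "chris c (chart_inv c x) v w = chris c (chart_inv c x) w v" if "x \<in> snd c ` fst c" for x v w
    by (rule chris_sym[OF at(2)[OF that]])
  show "frechet_derivative (\<lambda>x. chris c (chart_inv c x) v w) (at x) u + chris c (chart_inv c x) u (chris c (chart_inv c x) v w) =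
    frechet_derivative (\<lambda>x. chris c (chart_inv c x) u w) (at x) v + chris c (chart_inv c x) v (chris c (chart_inv c x) u w)"
    if "x \<in> snd c ` fst c" for x u v w
    using chris_curvature[OF at(2)[OF that], of v w u] chart_right[OF that] by simp
qed (use open_chart[OF cm] assms in auto)

end

lemma affine_chart:
  assumes p: "p \<in> mcarrier A"
  obtains f where "f \<in> charts_at A p" "connected (snd f ` fst f)" "\<And>q v w. q \<in> fst f \<Longrightarrow> chris f q v w = 0"
proof -
  obtain c0 where c0: "c0 \<in> max_atlas A" "p \<in> fst c0" using some_chart_at[OF p] charts_at_iff by blast
  \<comment> \<open>The systems are solved around the origin, so \<open>p\<close> is translated
    there.\<close>
  define \<tau> where "\<tau> = (\<lambda>y::'e. y - snd c0 p)"
  define c where "c = (fst c0, \<tau> \<circ> snd c0)"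
  have o\<tau>: "open (\<tau> ` (snd c0 ` fst c0))"
    unfolding \<tau>_def using open_translation_subtract[OF open_chart[OF c0(1)], of "snd c0 p"] by simp
  have c: "c \<in> max_atlas A"
    unfolding c_def
  proof (rule compose_max[OF c0(1) o\<tau>])
    show "smooth_on (snd c0 ` fst c0) \<tau>"
      unfolding \<tau>_def by (intro smooth_on_diff smooth_on_id smooth_on_const open_chart c0)
    show "smooth_on (\<tau> ` (snd c0 ` fst c0)) (\<lambda>y. y + snd c0 p)"
      by (intro smooth_on_add smooth_on_id smooth_on_const o\<tau>)
  qed (simp add: \<tau>_def)
  have pc: "p \<in> fst c" "snd c p = 0" using c0 by (auto simp: c_def \<tau>_def)
  then have "0 \<in> snd c ` fst c" by force
  then interpret flat_christoffel "snd c ` fst c" "\<lambda>x. chris c (chart_inv c x)"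
    "\<lambda>x u v w. frechet_derivative (\<lambda>x. chris c (chart_inv c x) v w) (at x) u"
    by (rule flat_christoffel[OF c])
  obtain W :: "'e set" and \<phi> \<psi> :: "'e \<Rightarrow> 'e" and Q where W: "open W" "connected W" "0 \<in> W" "W \<subseteq> snd c ` fst c" "open (\<phi> ` W)"
    and \<phi>: "smooth_on W \<phi>" and \<psi>: "smooth_on (\<phi> ` W) \<psi>" and inv: "\<And>x. x \<in> W \<Longrightarrow> \<psi> (\<phi> x) = x"
    and D\<psi>: "\<And>x. x \<in> W \<Longrightarrow> (\<psi> has_derivative Q x) (at (\<phi> x))"
    and Q: "\<And>x w. x \<in> W \<Longrightarrow> ((\<lambda>x. Q x w) has_derivative (\<lambda>v. - chris c (chart_inv c x) v (Q x w))) (at x)"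
    by (rule affine_coordinates) (rule that)
  define Wm where "Wm = {q \<in> fst c. snd c q \<in> W}"
  have Wm: "openin (manifold_topology A) Wm" "Wm \<subseteq> fst c"
    using openin_chart_preimage[OF c W(1)] by (auto simp: Wm_def)
  have im: "snd c ` Wm = W" using W(4) by (auto simp: Wm_def)
  define c' where "c' = (Wm, snd c)"
  have c': "c' \<in> max_atlas A" "fst c' = Wm" "snd c' = snd c" using restrict_chart[OF c Wm] by (auto simp: c'_def)
  have im': "snd c' ` fst c' = W" by (simp add: c' im)
  define f where "f = (Wm, \<phi> \<circ> snd c)"
  note hyps = c'(1) W(5)[folded im'] \<phi>[folded im'] \<psi>[folded im'] inv[folded im']
  have f_eq: "f = (fst c', \<phi> \<circ> snd c')" by (simp add: f_def c')
  have f: "f \<in> max_atlas A" unfolding f_eq by (rule compose_max[OF hyps])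
  have fW: "fst f = Wm" by (simp add: f_def)
  \<comment> \<open>The coordinate fields of the new chart, read in \<open>c\<close>, are the
    parallel frame \<open>Q\<close>.\<close>
  have coord: "coord_tvec A f q w c = Q (snd c q) w" if q: "q \<in> Wm" for q w
  proof -
    have "f \<in> charts_at A q" using f q by (simp add: charts_at_iff fW)
    then have "coord_tvec A f q w c = coord_tvec A f q w c'"
      unfolding c'_def by (intro restrict_apply[OF c Wm q, symmetric] coord_tvec_tangent)
    also have "\<dots> = frechet_derivative \<psi> (at (\<phi> (snd c q))) w"
      unfolding f_eq by (subst compose_coord_tvec[OF hyps]) (use q in \<open>simp_all add: c'\<close>)
    also have "\<dots> = Q (snd c q) w" using frechet_derivative_eqI[OF D\<psi>[of "snd c q"]] q by (simp add: Wm_def)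
    finally show ?thesis .
  qed
  have zero: "chris f q v w = 0" if q: "q \<in> Wm" for q v w
  proof -
    have at: "f \<in> charts_at A q" "c \<in> charts_at A q" using f c q Wm(2) by (auto simp: charts_at_iff fW)
    have qW: "snd c q \<in> W" "q \<in> fst c" using q by (auto simp: Wm_def)
    let ?X = "\<lambda>q. coord_tvec A f q v" and ?Y = "\<lambda>q. coord_tvec A f q w"
    have X: "smooth_vfield A Wm (\<lambda>q. coord_tvec A f q v)" for v
      by (rule smooth_coord_const[OF f Wm(1)]) (simp add: fW)
    \<comment> \<open>This derivative cancels the Christoffel term in \<open>nabla_chart\<close>.
      The covariant derivative thus has zero coordinates in \<open>c\<close>, hence is zero, and its
      coordinates in \<open>f\<close> vanish too.\<close>
    have "((\<lambda>x. ?Y (chart_inv c x) c) has_derivative (\<lambda>v. - chris c (chart_inv c (snd c q)) v (Q (snd c q) w))) (at (snd c q))"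
    proof (rule has_derivative_transform_within_open[OF Q[OF qW(1)] W(1) qW(1)])
      fix x assume x: "x \<in> W"
      then have x': "x \<in> snd c ` fst c" using W(4) by blast
      note e = chart_right[OF x'] chart_inv_in[OF max_atlas_is_chart[OF c] x']
      then have "chart_inv c x \<in> Wm" using x by (simp add: Wm_def)
      with e show "Q x w = ?Y (chart_inv c x) c" by (simp add: coord)
    qed
    from frechet_derivative_eqI[OF this]
    have "nabla ?X ?Y q c = 0"
      using nabla_chart[OF at(2) Wm(1) q X X, of v w] c qW(2) by (simp add: coord q)
    then have "nabla ?X ?Y q = 0"
      by (intro tangent_eqI[OF smooth_vfield_tangent[OF nabla_smooth[OF Wm(1) X X] q] tangent_zero[OF at(2)] at(2)]) simp
    then show ?thesis by (simp add: chris_def)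
  qed
  show thesis
  proof (rule that)
    show "f \<in> charts_at A p" using f pc W(3) by (simp add: charts_at_iff fW Wm_def)
    have "snd f ` fst f = \<phi> ` (snd c ` Wm)" by (simp add: f_def image_comp)
    then show "connected (snd f ` fst f)"
      using connected_continuous_image[OF smooth_on_continuous[OF \<phi>] W(2)] by (simp add: im)
    show "chris f q v w = 0" if "q \<in> fst f" for q v w using zero that by (simp add: fW)
  qed
qed

end

section \<open>Special symplectic manifolds\<close>

text \<open>The forms in question are bilinear only on a tangent or cotangent space inside a larger
  function space, so homogeneity is asked just for the vectors that occur in the
  projections.\<close>

lemma form_types:
  assumes "\<And>x y r s. x \<in> {v, I v} \<Longrightarrow> y \<in> {w, I w} \<Longrightarrow> B (r *\<^sub>R x) (s *\<^sub>R y) = r * s * B x y"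
  shows "form11 I B v w = (B v w + B (I v) (I w)) / 2" "form' I B v w = (B v w - B (I v) (I w)) / 2"
  using assms by (simp_all add: form11_def form'_def part11_def part20_def part02_def complexify_def
      type10_def type01_def scaleR_minus_left[symmetric] del: scaleR_minus_left)

text \<open>Multiplication by \<i> is skew for the real inner product, which is where the sign in
  the dual structure comes from.\<close>

lemma imult_inner: "e \<bullet> imult b = - imult e \<bullet> b"
  by (simp add: inner_vec_def imult_def inner_complex_def sum_negf[symmetric] algebra_simps)

lemma linear_imult: "linear imult"
  by (rule linearI) (simp_all add: imult_def vec_eq_iff algebra_simps scaleR_conv_of_real)

lemma imult_imult: "imult (imult x) = - x"
  by (simp add: imult_def vec_eq_iff mult.assoc[symmetric])

lemma imult2_eq: "imult2 z = (imult (fst z), imult (snd z))"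
  by (simp add: imult2_def imult_def split_beta)

lemma linear_imult2: "linear imult2"
  by (rule linearI) (simp_all add: imult2_eq linear_add[OF linear_imult] linear_scale[OF linear_imult])

lemma imult2_imult2: "imult2 (imult2 x) = - x"
  by (simp add: imult2_eq imult_imult prod_eq_iff)

locale special_symplectic_on = flat_connection_on A nabla
  for A :: "('a, complex^'m::finite) chart set" and nabla +
  fixes J :: "'a \<Rightarrow> ('a, complex^'m) tvec \<Rightarrow> ('a, complex^'m) tvec"
    and \<omega> :: "'a \<Rightarrow> ('a, complex^'m) tvec \<Rightarrow> ('a, complex^'m) tvec \<Rightarrow> real"
  assumes complex_J: "complex_manifold imult A J" and special: "special_endo A nabla J"
    and symplectic: "symplectic_form A \<omega>" and parallel: "parallel_form A nabla \<omega>"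
begin

interpretation N: smooth_atlas_on "cotangent_atlas A" by (rule smooth_atlas_cotangent)

lemma almost_complex_J: "almost_complex A J" using complex_J by (simp add: complex_manifold_def)

section \<open>Linear algebra on a single tangent space\<close>

context
  fixes p assumes p: "p \<in> mcarrier A"
begin

abbreviation "T \<equiv> tangent_space A p"
abbreviation "C \<equiv> cotangent_space A p"
abbreviation "finv \<equiv> form_inverse A p (\<omega> p)"
abbreviation "fmap \<equiv> form_map A p (\<omega> p)"
abbreviation "dual \<equiv> dual_map A p (J p)"

lemma base_chart: "some_chart A p \<in> charts_at A p" by (rule some_chart_at[OF p])

lemmas T_closed = tangent_add[OF base_chart] tangent_scaleR[OF base_chart] tangent_minus[OF base_chart] tangent_diff[OF base_chart]
lemmas C_sub = subspace_cotangent[OF base_chart]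
lemmas C_closed = subspace_add[OF C_sub] subspace_scale[OF C_sub] subspace_neg[OF C_sub] subspace_diff[OF C_sub]

lemma J_in: "v \<in> T \<Longrightarrow> J p v \<in> T"
  and J_add: "v \<in> T \<Longrightarrow> w \<in> T \<Longrightarrow> J p (v + w) = J p v + J p w"
  and J_scaleR: "v \<in> T \<Longrightarrow> J p (r *\<^sub>R v) = r *\<^sub>R J p v"
  and J_J: "v \<in> T \<Longrightarrow> J p (J p v) = - v"
  using almost_complex_J p unfolding almost_complex_def linear_between_def by blast+

lemma J_minus: "v \<in> T \<Longrightarrow> J p (- v) = - J p v"
  using J_scaleR[of v "-1"] by simp

lemmas symplectic_at = symplectic[unfolded symplectic_form_def, THEN conjunct1, THEN bspec, OF p]

lemmas \<omega>_linear = symplectic_at[THEN conjunct1, THEN bspec, unfolded linear_between_def]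
  and \<omega>_skew = symplectic_at[THEN conjunct2, THEN conjunct1, rule_format]
  and \<omega>_nondeg = symplectic_at[THEN conjunct2, THEN conjunct2, rule_format]

lemma \<omega>_add_right: "u \<in> T \<Longrightarrow> v \<in> T \<Longrightarrow> w \<in> T \<Longrightarrow> \<omega> p u (v + w) = \<omega> p u v + \<omega> p u w"
  using \<omega>_linear[of u] by simp

lemma \<omega>_scaleR_right: "u \<in> T \<Longrightarrow> v \<in> T \<Longrightarrow> \<omega> p u (r *\<^sub>R v) = r * \<omega> p u v"
  using \<omega>_linear[of u] by simp

lemma \<omega>_add_left: "u \<in> T \<Longrightarrow> v \<in> T \<Longrightarrow> w \<in> T \<Longrightarrow> \<omega> p (u + v) w = \<omega> p u w + \<omega> p v w"
  using \<omega>_skew[of "u + v" w] \<omega>_skew[of u w] \<omega>_skew[of v w] \<omega>_add_right[of w u v] T_closed(1)[of u v] by linarith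

lemma \<omega>_scaleR_left: "u \<in> T \<Longrightarrow> w \<in> T \<Longrightarrow> \<omega> p (r *\<^sub>R u) w = r * \<omega> p u w"
  using \<omega>_skew[of "r *\<^sub>R u" w] \<omega>_skew[of u w] \<omega>_scaleR_right[of w u r] T_closed(2)[of u r] by simp

lemma \<omega>_minus_left: "u \<in> T \<Longrightarrow> w \<in> T \<Longrightarrow> \<omega> p (- u) w = - \<omega> p u w"
  and \<omega>_minus_right: "u \<in> T \<Longrightarrow> w \<in> T \<Longrightarrow> \<omega> p w (- u) = - \<omega> p w u"
  using \<omega>_scaleR_left[of u w "-1"] \<omega>_scaleR_right[of w u "-1"] by simp_all

lemma C_add: "\<xi> \<in> C \<Longrightarrow> u \<in> T \<Longrightarrow> w \<in> T \<Longrightarrow> \<xi> (u + w) = \<xi> u + \<xi> w"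
  and C_scaleR: "\<xi> \<in> C \<Longrightarrow> u \<in> T \<Longrightarrow> \<xi> (r *\<^sub>R u) = r * \<xi> u"
  unfolding cotangent_space_def linear_between_def by simp_all

lemma C_I:
  assumes "\<And>u w. u \<in> T \<Longrightarrow> w \<in> T \<Longrightarrow> \<xi> (u + w) = \<xi> u + \<xi> w" "\<And>u r. u \<in> T \<Longrightarrow> \<xi> (r *\<^sub>R u) = r * \<xi> u"
    "\<And>u. u \<notin> T \<Longrightarrow> \<xi> u = 0"
  shows "\<xi> \<in> C"
  using assms by (simp add: cotangent_space_def linear_between_def)

lemma form_map_in:
  assumes "\<And>u w r. u \<in> T \<Longrightarrow> w \<in> T \<Longrightarrow> B v (u + w) = B v u + B v w" "\<And>u r. u \<in> T \<Longrightarrow> B v (r *\<^sub>R u) = r * B v u"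
  shows "form_map A p B v \<in> C"
  by (rule C_I) (simp_all add: form_map_def T_closed assms)

lemma fmap_in: "v \<in> T \<Longrightarrow> fmap v \<in> C"
  by (rule form_map_in) (simp_all add: \<omega>_add_right \<omega>_scaleR_right)

lemma dual_in: assumes \<xi>: "\<xi> \<in> C" shows "dual \<xi> \<in> C"
  by (rule C_I) (simp_all add: dual_map_def T_closed J_in J_add J_scaleR C_add[OF \<xi>] C_scaleR[OF \<xi>])

lemma dual_apply: "v \<in> T \<Longrightarrow> dual \<xi> v = \<xi> (J p v)"
  by (simp add: dual_map_def)

lemma C_eqI:
  assumes "\<xi> \<in> C" "\<eta> \<in> C" "\<And>u. u \<in> T \<Longrightarrow> \<xi> u = \<eta> u"
  shows "\<xi> = \<eta>"
proof
  fix u show "\<xi> u = \<eta> u"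
    using assms cotangent_outside[OF assms(1)] cotangent_outside[OF assms(2)] by (cases "u \<in> T") simp_all
qed

text \<open>Covectors with prescribed components recover all coordinates of a vector. This gives
  uniqueness in the description of \<open>map_of_bivector\<close>.\<close>

lemma T_eqI:
  assumes "v \<in> T" "w \<in> T" "\<And>\<eta>. \<eta> \<in> C \<Longrightarrow> \<eta> v = \<eta> w"
  shows "v = w"
proof (rule tangent_eqI[OF assms(1,2) base_chart])
  have "e \<bullet> v (some_chart A p) = e \<bullet> w (some_chart A p)" for e
    using assms(3)[OF covec_in[OF base_chart, of e]] assms(1,2) by (simp add: covec_def)
  then show "v (some_chart A p) = w (some_chart A p)" by (metis inner_commute vector_eq_rdot)
qed

lemma dual_dual: "\<xi> \<in> C \<Longrightarrow> dual (dual \<xi>) = - \<xi>"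
proof (rule C_eqI)
  fix u assume \<xi>: "\<xi> \<in> C" and u: "u \<in> T"
  then show "dual (dual \<xi>) u = (- \<xi>) u"
    using C_scaleR[OF \<xi> u, of "-1"] by (simp add: dual_apply J_in J_J)
qed (simp_all add: dual_in C_closed)

lemma fmap_inj:
  assumes v: "v \<in> T" "w \<in> T" "fmap v = fmap w"
  shows "v = w"
proof -
  have "\<omega> p (v + - w) u = 0" if u: "u \<in> T" for u
  proof -
    have "\<omega> p v u = \<omega> p w u" using fun_cong[OF v(3), of u] u by (simp add: form_map_def)
    with u v show ?thesis by (simp only: \<omega>_add_left \<omega>_minus_left T_closed)
  qed
  then have "v + - w = 0" by (intro \<omega>_nondeg T_closed v)
  then show ?thesis by (simp only: add_eq_0_iff2 minus_minus)
qed

lemma fmap_add: "v \<in> T \<Longrightarrow> w \<in> T \<Longrightarrow> fmap (v + w) = fmap v + fmap w"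
  and fmap_scaleR: "v \<in> T \<Longrightarrow> fmap (r *\<^sub>R v) = r *\<^sub>R fmap v"
  by (auto simp: fun_eq_iff form_map_def \<omega>_add_left \<omega>_scaleR_left)

text \<open>The matrix of \<omega> in the chart \<open>c\<close>: the inner product with
  \<open>b\<close> is \<omega> on the coordinate vectors of \<open>a\<close> and
  \<open>b\<close>.\<close>

definition gram :: "('a, complex^'m) chart \<Rightarrow> complex^'m \<Rightarrow> complex^'m" where
  "gram c a = covec_coords A c p (fmap (coord_tvec A c p a))"

lemma gram_linear: "c \<in> charts_at A p \<Longrightarrow> linear (gram c)"
  by (rule linearI) (simp_all add: gram_def coord_tvec_add coord_tvec_scaleR coord_tvec_tangent fmap_add fmap_scaleR
      linear_add[OF covec_coords_linear] linear_scale[OF covec_coords_linear])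

lemma gram_inj:
  assumes c: "c \<in> charts_at A p" shows "inj (gram c)"
proof (rule injI)
  fix a b assume "gram c a = gram c b"
  then have "fmap (coord_tvec A c p a) = fmap (coord_tvec A c p b)"
    unfolding gram_def by (intro cotangent_eqI[OF _ _ c] fmap_in coord_tvec_tangent c)
  then have "coord_tvec A c p a = coord_tvec A c p b" by (intro fmap_inj coord_tvec_tangent c)
  then show "a = b" using coord_tvec_self[OF c] by metis
qed

text \<open>Nondegeneracy makes the matrix of \<omega> injective, and finite dimension turns this
  into surjectivity; so \<open>form_inverse\<close> is a genuine inverse.\<close>

lemma finv: assumes "\<xi> \<in> C" shows finv_in: "finv \<xi> \<in> T" and fmap_finv: "fmap (finv \<xi>) = \<xi>"
proof -
  have "surj (gram (some_chart A p))" by (rule linear_inj_imp_surj[OF gram_linear[OF base_chart] gram_inj[OF base_chart]])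
  then obtain a where "gram (some_chart A p) a = covec_coords A (some_chart A p) p \<xi>" by (metis surjD)
  then have "fmap (coord_tvec A (some_chart A p) p a) = \<xi>"
    unfolding gram_def by (intro cotangent_eqI[OF _ _ base_chart] fmap_in coord_tvec_tangent base_chart assms)
  then have "\<exists>!v. v \<in> T \<and> fmap v = \<xi>"
    using coord_tvec_tangent[OF base_chart] fmap_inj by blast
  from theI'[OF this] show "finv \<xi> \<in> T" "fmap (finv \<xi>) = \<xi>" by (simp_all add: form_inverse_def)
qed

lemma finv_scaleR: "\<xi> \<in> C \<Longrightarrow> finv (r *\<^sub>R \<xi>) = r *\<^sub>R finv \<xi>"
  by (rule fmap_inj) (simp_all add: finv_in C_closed T_closed fmap_finv fmap_scaleR)

lemma finv_minus: "\<xi> \<in> C \<Longrightarrow> finv (- \<xi>) = - finv \<xi>"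
  using finv_scaleR[of \<xi> "-1"] by simp

lemma form_\<omega>:
  assumes "v \<in> T" "w \<in> T"
  shows form11_\<omega>: "form11 (J p) (\<omega> p) v w = (\<omega> p v w + \<omega> p (J p v) (J p w)) / 2"
    and form'_\<omega>: "form' (J p) (\<omega> p) v w = (\<omega> p v w - \<omega> p (J p v) (J p w)) / 2"
  by (rule form_types; use assms in \<open>auto simp: \<omega>_scaleR_left \<omega>_scaleR_right T_closed J_in\<close>)+

text \<open>The types of the bivector refer to \<open>dual\<close>. Pairing
  \<open>dual \<eta>\<close> with a vector moves \<open>J\<close> onto that vector, so the second
  summand comes from J \<omega>^-1 applied to \<open>dual \<xi>\<close>.\<close>

lemma form_bivector:
  assumes "\<xi> \<in> C" "\<eta> \<in> C"
  shows "form11 dual (bivector_of_map finv) \<xi> \<eta> = (\<eta> (finv \<xi>) + \<eta> (J p (finv (dual \<xi>)))) / 2"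
    and "form' dual (bivector_of_map finv) \<xi> \<eta> = (\<eta> (finv \<xi>) - \<eta> (J p (finv (dual \<xi>)))) / 2"
proof -
  have "bivector_of_map finv (r *\<^sub>R x) (s *\<^sub>R y) = r * s * bivector_of_map finv x y"
    if "x \<in> {\<xi>, dual \<xi>}" "y \<in> {\<eta>, dual \<eta>}" for x y r s
  proof -
    have xy: "x \<in> C" "y \<in> C" using that assms dual_in by auto
    then show ?thesis by (simp add: bivector_of_map_def finv_scaleR C_scaleR[OF xy(2)] finv_in T_closed)
  qed
  note B = form_types[of \<xi> dual \<eta> "bivector_of_map finv", OF this]
  have "dual \<eta> (finv (dual \<xi>)) = \<eta> (J p (finv (dual \<xi>)))"
    by (rule dual_apply[OF finv_in[OF dual_in[OF assms(1)]]])
  with B show "form11 dual (bivector_of_map finv) \<xi> \<eta> = (\<eta> (finv \<xi>) + \<eta> (J p (finv (dual \<xi>)))) / 2"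
    "form' dual (bivector_of_map finv) \<xi> \<eta> = (\<eta> (finv \<xi>) - \<eta> (J p (finv (dual \<xi>)))) / 2"
    by (simp_all add: bivector_of_map_def)
qed

lemma map_of_bivectorI:
  assumes "v \<in> T" "\<And>\<eta>. \<eta> \<in> C \<Longrightarrow> \<eta> v = P \<xi> \<eta>"
  shows "map_of_bivector A p P \<xi> = v"
  unfolding map_of_bivector_def
  by (rule the_equality) (use assms T_eqI in \<open>auto\<close>)

lemma C_half: "\<eta> \<in> C \<Longrightarrow> v \<in> T \<Longrightarrow> w \<in> T \<Longrightarrow> \<eta> ((1/2) *\<^sub>R (v + w)) = (\<eta> v + \<eta> w) / 2"
  and C_minus: "\<eta> \<in> C \<Longrightarrow> v \<in> T \<Longrightarrow> \<eta> (- v) = - \<eta> v"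
  using C_add[of \<eta> v w] C_scaleR[of \<eta> "v + w" "1/2"] C_scaleR[of \<eta> v "-1"] T_closed(1)[of v w] by simp_all

lemma biv11: "\<xi> \<in> C \<Longrightarrow> map_of_bivector A p (form11 dual (bivector_of_map finv)) \<xi> =
    (1/2) *\<^sub>R (finv \<xi> + J p (finv (dual \<xi>)))"
  by (rule map_of_bivectorI)
    (simp_all only: form_bivector C_half T_closed finv_in dual_in J_in)

lemma biv': "\<xi> \<in> C \<Longrightarrow> map_of_bivector A p (form' dual (bivector_of_map finv)) \<xi> =
    (1/2) *\<^sub>R (finv \<xi> + - J p (finv (dual \<xi>)))"
  by (rule map_of_bivectorI)
    (simp_all only: form_bivector C_half C_minus T_closed finv_in dual_in J_in diff_conv_add_uminus)

abbreviation "f11 \<equiv> form_map A p (form11 (J p) (\<omega> p))"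
abbreviation "f' \<equiv> form_map A p (form' (J p) (\<omega> p))"

lemma f11_in: "v \<in> T \<Longrightarrow> f11 v \<in> C" and f'_in: "v \<in> T \<Longrightarrow> f' v \<in> C"
  by (rule form_map_in; simp add: form_\<omega> T_closed J_in J_add J_scaleR \<omega>_add_right \<omega>_scaleR_right field_simps)+

text \<open>The lower left blocks of the four relations. Evaluated on \<open>w\<close>, both sides
  are \<omega>(v, Jw) - \<omega>(Jv, w) in the first two and \<omega>(v, Jw) + \<omega>(Jv, w) in
  the last two.\<close>

lemma cov_identities:
  assumes v: "v \<in> T"
  shows "dual (fmap v) - fmap (J p v) = 2 *\<^sub>R dual (f11 v)"
    and "dual (fmap v) - fmap (J p v) = (- 2) *\<^sub>R f11 (J p v)"
    and "dual (fmap v) + fmap (J p v) = 2 *\<^sub>R dual (f' v)"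
    and "dual (fmap v) + fmap (J p v) = 2 *\<^sub>R f' (J p v)"
proof -
  have m: "dual (fmap v) - fmap (J p v) \<in> C" "dual (fmap v) + fmap (J p v) \<in> C"
    "2 *\<^sub>R dual (f11 v) \<in> C" "(- 2) *\<^sub>R f11 (J p v) \<in> C" "2 *\<^sub>R dual (f' v) \<in> C" "2 *\<^sub>R f' (J p v) \<in> C"
    by (intro C_closed dual_in fmap_in f11_in f'_in J_in v)+
  note r = v J_in dual_apply form_map_def form_\<omega> J_J \<omega>_minus_left \<omega>_minus_right
  show "dual (fmap v) - fmap (J p v) = 2 *\<^sub>R dual (f11 v)"
    by (rule C_eqI[OF m(1,3)]) (simp add: r)
  show "dual (fmap v) - fmap (J p v) = (- 2) *\<^sub>R f11 (J p v)"
    by (rule C_eqI[OF m(1,4)]) (simp add: r field_simps)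
  show "dual (fmap v) + fmap (J p v) = 2 *\<^sub>R dual (f' v)"
    by (rule C_eqI[OF m(2,5)]) (simp add: r)
  show "dual (fmap v) + fmap (J p v) = 2 *\<^sub>R f' (J p v)"
    by (rule C_eqI[OF m(2,6)]) (simp add: r)
qed

text \<open>The upper right blocks of the same relations. In the second and fourth, the dual
  structure is applied twice and returns minus the inverse of \<omega>.\<close>

lemma vec_identities:
  assumes "\<eta> \<in> C"
  shows "J p (- finv \<eta>) - - finv (dual \<eta>) = 2 *\<^sub>R J p (- ((1/2) *\<^sub>R (finv \<eta> + J p (finv (dual \<eta>)))))"
    and "J p (- finv \<eta>) - - finv (dual \<eta>) = (- 2) *\<^sub>R - ((1/2) *\<^sub>R (finv (dual \<eta>) + J p (finv (dual (dual \<eta>)))))"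
    and "J p (- finv \<eta>) + - finv (dual \<eta>) = 2 *\<^sub>R J p (- ((1/2) *\<^sub>R (finv \<eta> + - J p (finv (dual \<eta>)))))"
    and "J p (- finv \<eta>) + - finv (dual \<eta>) = 2 *\<^sub>R - ((1/2) *\<^sub>R (finv (dual \<eta>) + - J p (finv (dual (dual \<eta>)))))"
proof -
  have t: "finv \<eta> \<in> T" "finv (dual \<eta>) \<in> T" "J p (finv \<eta>) \<in> T" "J p (finv (dual \<eta>)) \<in> T"
    using assms by (simp_all add: finv_in dual_in J_in)
  have d: "finv (dual (dual \<eta>)) = - finv \<eta>" using assms by (simp add: dual_dual finv_minus)
  note r = t d T_closed J_minus J_scaleR J_add J_J
  show "J p (- finv \<eta>) - - finv (dual \<eta>) = 2 *\<^sub>R J p (- ((1/2) *\<^sub>R (finv \<eta> + J p (finv (dual \<eta>)))))"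
    "J p (- finv \<eta>) - - finv (dual \<eta>) = (- 2) *\<^sub>R - ((1/2) *\<^sub>R (finv (dual \<eta>) + J p (finv (dual (dual \<eta>)))))"
    "J p (- finv \<eta>) + - finv (dual \<eta>) = 2 *\<^sub>R J p (- ((1/2) *\<^sub>R (finv \<eta> + - J p (finv (dual \<eta>)))))"
    "J p (- finv \<eta>) + - finv (dual \<eta>) = 2 *\<^sub>R - ((1/2) *\<^sub>R (finv (dual \<eta>) + - J p (finv (dual (dual \<eta>)))))"
    by (simp_all only: r) (simp_all add: fun_eq_iff)
qed

end

section \<open>The operators on pairs and their commutation relations\<close>

context
  fixes x assumes x: "x \<in> mcarrier (cotangent_atlas A)"
begin

lemma base_point: "fst x \<in> mcarrier A" using x by (simp add: mcarrier_cotangent)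

abbreviation "T' \<equiv> tangent_space A (fst x)"
abbreviation "C' \<equiv> cotangent_space A (fst x)"

lemma J1_lift:
  assumes "v \<in> T'" "\<eta> \<in> C'"
  shows "J_nabla A J nabla x (lift x v \<eta>) = lift x (J (fst x) v) (dual_map A (fst x) (J (fst x)) \<eta>)"
  by (simp add: J_nabla_def block_op_lift[OF x assms])

lemma J2_lift:
  assumes "v \<in> T'" "\<eta> \<in> C'"
  shows "J_omega A nabla \<omega> x (lift x v \<eta>) =
    lift x (- form_inverse A (fst x) (\<omega> (fst x)) \<eta>) (form_map A (fst x) (\<omega> (fst x)) v)"
  by (simp add: J_omega_def block_op_lift[OF x assms])

lemma B_lift:
  assumes "v \<in> T'" "\<eta> \<in> C'"
  shows "block_omega11 A J nabla \<omega> x (lift x v \<eta>) =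
    lift x (- ((1/2) *\<^sub>R (form_inverse A (fst x) (\<omega> (fst x)) \<eta> + J (fst x) (form_inverse A (fst x) (\<omega> (fst x)) (dual_map A (fst x) (J (fst x)) \<eta>)))))
      (form_map A (fst x) (form11 (J (fst x)) (\<omega> (fst x))) v)"
  by (simp add: block_omega11_def block_op_lift[OF x assms] Let_def biv11[OF base_point assms(2)])

lemma C_lift:
  assumes "v \<in> T'" "\<eta> \<in> C'"
  shows "block_omega' A J nabla \<omega> x (lift x v \<eta>) =
    lift x (- ((1/2) *\<^sub>R (form_inverse A (fst x) (\<omega> (fst x)) \<eta> + - J (fst x) (form_inverse A (fst x) (\<omega> (fst x)) (dual_map A (fst x) (J (fst x)) \<eta>)))))
      (form_map A (fst x) (form' (J (fst x)) (\<omega> (fst x))) v)"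
  by (simp add: block_omega'_def block_op_lift[OF x assms] Let_def biv'[OF base_point assms(2)])

lemma lift_diff:
  assumes "v \<in> T'" "\<eta> \<in> C'" "v' \<in> T'" "\<eta>' \<in> C'"
  shows "lift x v \<eta> - lift x v' \<eta>' = lift x (v - v') (\<eta> - \<eta>')"
proof -
  note c = T_closed[OF base_point] C_closed[OF base_point]
  have "lift x (v - v') (\<eta> - \<eta>') + lift x v' \<eta>' = lift x v \<eta>"
    using lift_add[OF x, of "v - v'" "\<eta> - \<eta>'" v' \<eta>'] assms by (simp add: c)
  then show ?thesis by (simp only: eq_diff_eq[symmetric])
qed

text \<open>Every tangent vector is a lift, and on lifts all operators act by their matrices;
  vertical components are settled by \<open>cov_identities\<close>, horizontal ones by
  \<open>vec_identities\<close>.\<close>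

lemma commutators:
  assumes w: "w \<in> tangent_space (cotangent_atlas A) x"
  shows "J_nabla A J nabla x (J_omega A nabla \<omega> x w) - J_omega A nabla \<omega> x (J_nabla A J nabla x w) =
      2 *\<^sub>R J_nabla A J nabla x (block_omega11 A J nabla \<omega> x w)"
    and "J_nabla A J nabla x (J_omega A nabla \<omega> x w) - J_omega A nabla \<omega> x (J_nabla A J nabla x w) =
      (-2) *\<^sub>R block_omega11 A J nabla \<omega> x (J_nabla A J nabla x w)"
    and "J_nabla A J nabla x (J_omega A nabla \<omega> x w) + J_omega A nabla \<omega> x (J_nabla A J nabla x w) =
      2 *\<^sub>R J_nabla A J nabla x (block_omega' A J nabla \<omega> x w)"
    and "J_nabla A J nabla x (J_omega A nabla \<omega> x w) + J_omega A nabla \<omega> x (J_nabla A J nabla x w) =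
      2 *\<^sub>R block_omega' A J nabla \<omega> x (J_nabla A J nabla x w)"
proof -
  obtain v \<eta> where v: "v \<in> T'" and \<eta>: "\<eta> \<in> C'" and w: "w = lift x v \<eta>" by (rule lift_surj[OF x w])
  note i = v \<eta> J_in[OF base_point] dual_in[OF base_point] fmap_in[OF base_point] finv_in[OF base_point] f11_in[OF base_point] f'_in[OF base_point] T_closed[OF base_point]
  note l = J1_lift J2_lift B_lift C_lift lift_diff lift_add[OF x] lift_scaleR[OF x] i
  note e = cov_identities[OF base_point v] vec_identities[OF base_point \<eta>]
  show "J_nabla A J nabla x (J_omega A nabla \<omega> x w) - J_omega A nabla \<omega> x (J_nabla A J nabla x w) =
      2 *\<^sub>R J_nabla A J nabla x (block_omega11 A J nabla \<omega> x w)"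
    unfolding w by (simp only: l e(1,5))
  show "J_nabla A J nabla x (J_omega A nabla \<omega> x w) - J_omega A nabla \<omega> x (J_nabla A J nabla x w) =
      (-2) *\<^sub>R block_omega11 A J nabla \<omega> x (J_nabla A J nabla x w)"
    unfolding w by (simp only: l e(2,6))
  show "J_nabla A J nabla x (J_omega A nabla \<omega> x w) + J_omega A nabla \<omega> x (J_nabla A J nabla x w) =
      2 *\<^sub>R J_nabla A J nabla x (block_omega' A J nabla \<omega> x w)"
    unfolding w by (simp only: l e(3,7))
  show "J_nabla A J nabla x (J_omega A nabla \<omega> x w) + J_omega A nabla \<omega> x (J_nabla A J nabla x w) =
      2 *\<^sub>R block_omega' A J nabla \<omega> x (J_nabla A J nabla x w)"
    unfolding w by (simp only: l e(4,8))
qed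

lemma J1_in: "w \<in> tangent_space (cotangent_atlas A) x \<Longrightarrow> J_nabla A J nabla x w \<in> tangent_space (cotangent_atlas A) x"
  and J2_in: "w \<in> tangent_space (cotangent_atlas A) x \<Longrightarrow> J_omega A nabla \<omega> x w \<in> tangent_space (cotangent_atlas A) x"
proof -
  assume "w \<in> tangent_space (cotangent_atlas A) x"
  then obtain v \<eta> where *: "v \<in> T'" "\<eta> \<in> C'" and w: "w = lift x v \<eta>" by (rule lift_surj[OF x])
  show "J_nabla A J nabla x w \<in> tangent_space (cotangent_atlas A) x"
    unfolding w J1_lift[OF *] by (intro lift_tangent x J_in base_point dual_in *)
  show "J_omega A nabla \<omega> x w \<in> tangent_space (cotangent_atlas A) x"
    unfolding w J2_lift[OF *] by (intro lift_tangent x T_closed(3) base_point finv_in fmap_in *)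
qed

end

section \<open>Holomorphic charts for \<open>J_nabla\<close>\<close>

lemma chris_imult:
  assumes c: "c \<in> charts_at A p" and Jc: "\<And>q v. q \<in> fst c \<Longrightarrow> v \<in> tangent_space A q \<Longrightarrow> J q v c = imult (v c)"
  shows "chris c p (imult v) w = chris c p v (imult w)"
proof -
  have cm: "c \<in> max_atlas A" "p \<in> fst c" using c by (auto simp: charts_at_iff)
  have pm: "p \<in> mcarrier A" by (rule charts_at_carrier[OF c])
  let ?X = "\<lambda>v q. coord_tvec A c q v"
  note U = openin_chart[OF cm(1)] and X = coord_field[OF cm(1)]
  have JX: "J q (?X v q) = ?X (imult v) q" if q: "q \<in> fst c" for q v
  proof -
    have cq: "c \<in> charts_at A q" using q cm by (simp add: charts_at_iff)
    note t = coord_tvec_tangent[OF cq]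
    show ?thesis
      by (rule tangent_eqI[OF J_in[OF charts_at_carrier[OF cq] t] t cq]) (simp add: Jc[OF q t] cq)
  qed
  have n: "nabla (?X v) (\<lambda>q. J q (?X w q)) p = nabla (?X v) (?X (imult w)) p" for v w
    by (rule nabla_cong[OF U X X X smooth_vfield_cong[OF U X JX] refl JX cm(2)])
  \<comment> \<open>\<open>J\<close> is constant in the chart, so only Christoffel terms survive in
    its covariant derivative.\<close>
  have e: "nabla_endo nabla J (?X v) (?X w) p c = chris c p v (imult w) - imult (chris c p v w)" for v w
    using Jc[OF cm(2) smooth_vfield_tangent[OF nabla_smooth[OF U X X] cm(2)], of v w]
    by (simp add: nabla_endo_def n chris_def)
  have "nabla_endo nabla J (?X v) (?X w) p = nabla_endo nabla J (?X w) (?X v) p"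
    using special U X cm(2) unfolding special_endo_def by blast
  then have "chris c p v (imult w) - imult (chris c p v w) = chris c p w (imult v) - imult (chris c p w v)"
    using e[of v w] e[of w v] by simp
  \<comment> \<open>The terms with \<i> outside agree by symmetry of \<Gamma> and cancel; symmetry
    once more exchanges the arguments on the right.\<close>
  then have "chris c p v (imult w) = chris c p w (imult v)" by (simp add: chris_sym[OF cm, of v w])
  then show ?thesis by (simp add: chris_sym[OF cm, of "imult v" w])
qed

definition vcnj :: "complex^'m \<Rightarrow> complex^'m" where "vcnj s = (\<chi> k. cnj (s $ k))"

lemma linear_vcnj: "linear vcnj"
  by (rule linearI) (simp_all add: vcnj_def vec_eq_iff)

lemma imult_vcnj: "vcnj (- imult s) = imult (vcnj s)"
  by (simp add: vcnj_def imult_def vec_eq_iff)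

text \<open>In a holomorphic chart \<open>J_nabla\<close> is the standard complex structure of the cotangent bundle. The
  conjugation appears since the components of a covector are taken with respect to the real inner
  product, so that the dual of multiplication by \<open>\<i>\<close> is multiplication by \<open>-\<i>\<close>.\<close>
lemma J1_chart:
  assumes x: "x \<in> mcarrier (cotangent_atlas A)"
  shows "\<exists>d\<in>charts_at (cotangent_atlas A) x. \<forall>y\<in>fst d. \<forall>w\<in>tangent_space (cotangent_atlas A) y.
    J_nabla A J nabla y w d = imult2 (w d)"
proof -
  have "integrable_structure imult A J" using complex_J by (simp add: complex_manifold_def)
  then obtain c where c: "c \<in> charts_at A (fst x)"
    and Jc: "\<And>q v. q \<in> fst c \<Longrightarrow> v \<in> tangent_space A q \<Longrightarrow> J q v c = imult (v c)"
    using base_point[OF x] unfolding integrable_structure_def by blast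
  have cmax: "c \<in> max_atlas A" using c by (simp add: charts_at_iff)
  let ?L = "\<lambda>z. (fst z, vcnj (snd z))"
  have L: "linear ?L" by (rule linearI) (simp_all add: linear_add[OF linear_vcnj] linear_scale[OF linear_vcnj])
  have LL: "?L (?L z) = z" for z by (simp add: vcnj_def prod_eq_iff vec_eq_iff)
  note lc = N.linear_chart[OF cot_chart_max[OF cmax] L L LL LL]
  let ?d = "(fst (cot_chart c), ?L \<circ> snd (cot_chart c))"
  have "x \<in> fst (cot_chart c)" using cot_chart_at[OF c x] by (simp add: N.charts_at_iff)
  then have "?d \<in> charts_at (cotangent_atlas A) x" using lc(1) by (simp add: N.charts_at_iff)
  moreover have "J_nabla A J nabla y w ?d = imult2 (w ?d)"
    if y: "y \<in> fst ?d" and w: "w \<in> tangent_space (cotangent_atlas A) y" for y w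
  proof -
    have yc: "y \<in> fst (cot_chart c)" using y by simp
    have ym: "y \<in> mcarrier (cotangent_atlas A)"
      by (rule N.max_atlas_carrier[OF cot_chart_max[OF cmax] yc])
    have cy: "c \<in> charts_at A (fst y)" using yc cmax by (simp add: mem_cot_chart charts_at_iff)
    note at = cot_chart_at[OF cy ym]
    obtain v \<eta> where v: "v \<in> tangent_space A (fst y)" and \<eta>: "\<eta> \<in> cotangent_space A (fst y)" and we: "w = lift y v \<eta>"
      by (rule lift_surj[OF ym w])
    note pm = base_point[OF ym]
    have qc: "fst y \<in> fst c" using cy by (simp add: charts_at_iff)
    let ?\<eta> = "dual_map A (fst y) (J (fst y)) \<eta>"
    have "covec_coords A c (fst y) ?\<eta> \<bullet> b = - imult (covec_coords A c (fst y) \<eta>) \<bullet> b" for b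
    proof -
      note t = coord_tvec_tangent[OF cy, of b]
      have "covec_coords A c (fst y) ?\<eta> \<bullet> b = ?\<eta> (coord_tvec A c (fst y) b)"
        using cotangent_apply[OF dual_in[OF pm \<eta>] cy t] cy by simp
      also have "\<dots> = covec_coords A c (fst y) \<eta> \<bullet> imult b"
        using cotangent_apply[OF \<eta> cy J_in[OF pm t]] by (simp add: dual_apply[OF pm t] Jc[OF qc t] cy)
      finally show ?thesis by (simp add: imult_inner)
    qed
    then have 1: "covec_coords A c (fst y) ?\<eta> = - imult (covec_coords A c (fst y) \<eta>)" by (metis vector_eq_rdot)
    \<comment> \<open>The factor \<i> passes from the horizontal direction to the other argument of
      \<Gamma>, and from there by skewness to the covector; this is where the symmetry of the
      derivative of \<open>J\<close> enters.\<close>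
    have "hor c y (imult a) \<bullet> b = - imult (hor c y a) \<bullet> b" for a b
      by (simp only: inner_hor[OF cy] chris_imult[OF cy Jc] imult_inner[symmetric])
    then have 2: "hor c y (imult a) = - imult (hor c y a)" for a by (metis vector_eq_rdot)
    have "J_nabla A J nabla y w (cot_chart c) = (imult (v c), - imult (hor c y (v c) + covec_coords A c (fst y) \<eta>))"
      using at by (simp add: we J1_lift[OF ym v \<eta>] lift_chart[OF cy ym J_in[OF pm v] dual_in[OF pm \<eta>]]
          Jc[OF qc v] 1 2 linear_add[OF linear_imult])
    moreover have "w (cot_chart c) = (v c, hor c y (v c) + covec_coords A c (fst y) \<eta>)"
      using at by (simp add: we lift_chart[OF cy ym v \<eta>])
    ultimately show ?thesis
      unfolding lc(2)[OF yc w] lc(2)[OF yc J1_in[OF ym w]] imult2_eq by (simp only: fst_conv snd_conv imult_vcnj)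
  qed
  ultimately show ?thesis by blast
qed

section \<open>Affine charts for \<open>J_omega\<close>\<close>

lemmas symplectic_smooth = symplectic[unfolded symplectic_form_def, THEN conjunct2, THEN conjunct1, rule_format]
  and parallelD = parallel[unfolded parallel_form_def, rule_format]

text \<open>The coordinate fields of an affine chart are parallel and so is \<omega>, hence \<omega>
  on two of them has derivative zero; connectedness of the coordinate image makes it
  constant.\<close>

lemma gram_constant:
  assumes f: "f \<in> max_atlas A" "connected (snd f ` fst f)" "\<And>q v w. q \<in> fst f \<Longrightarrow> chris f q v w = 0"
    and pq: "p \<in> fst f" "q \<in> fst f"
  shows "gram p f a = gram q f a"
proof -
  let ?X = "\<lambda>v q. coord_tvec A f q v"
  note U = openin_chart[OF f(1)] and X = coord_field[OF f(1)]
  have at: "f \<in> charts_at A q" if "q \<in> fst f" for q using f(1) that by (simp add: charts_at_iff)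
  have nz: "nabla (?X u) (?X v) q = 0" if q: "q \<in> fst f" for u v q
    by (rule tangent_eqI[OF smooth_vfield_tangent[OF nabla_smooth[OF U X X] q] tangent_zero[OF at[OF q]] at[OF q]])
      (use f(3)[OF q, of u v] in \<open>simp add: chris_def\<close>)
  have inner: "gram q f a \<bullet> b = \<omega> q (?X a q) (?X b q)" if q: "q \<in> fst f" for q a b
  proof -
    note t = coord_tvec_tangent[OF at[OF q]]
    note pm = charts_at_carrier[OF at[OF q]]
    have "gram q f a \<bullet> b = form_map A q (\<omega> q) (?X a q) (?X b q)"
      using cotangent_apply[OF fmap_in[OF pm t] at[OF q] t, of a b] at[OF q] by (simp add: gram_def[OF pm])
    then show ?thesis by (simp add: form_map_def t)
  qed
  have "gram p f a \<bullet> b = gram q f a \<bullet> b" for b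
  proof -
    let ?g = "(\<lambda>q. \<omega> q (?X a q) (?X b q)) \<circ> chart_inv f"
    have "smooth_fun A (fst f) (\<lambda>q. \<omega> q (?X a q) (?X b q))"
      by (rule symplectic_smooth[OF U X X])
    from smooth_funD[OF U this f(1)] have s: "smooth_on (snd f ` fst f) ?g" by simp
    have "(?g has_derivative (\<lambda>u. 0)) (at y)" if y: "y \<in> snd f ` fst f" for y
    proof -
      obtain q where q: "q \<in> fst f" "y = snd f q" using y by blast
      note pm = charts_at_carrier[OF at[OF q(1)]]
      have "frechet_derivative ?g (at y) u = 0" for u
      proof -
        have d: "dir_deriv A q (?X u q) (\<lambda>q. \<omega> q (?X a q) (?X b q)) - \<omega> q (nabla (?X u) (?X a) q) (?X b q)
            - \<omega> q (?X a q) (nabla (?X u) (?X b) q) = 0"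
          by (rule parallelD[OF U X X X q(1)])
        have "\<omega> q 0 (?X b q) = 0" "\<omega> q (?X a q) 0 = 0"
          using \<omega>_scaleR_left[OF pm, of 0 "?X b q" 0] \<omega>_scaleR_right[OF pm, of "?X a q" 0 0]
            tangent_zero[OF at[OF q(1)]] coord_tvec_tangent[OF at[OF q(1)]] by simp_all
        with d have "dir_deriv A q (?X u q) (\<lambda>q. \<omega> q (?X a q) (?X b q)) = 0" by (simp add: nz[OF q(1)])
        moreover have "?g differentiable (at (snd f q))" by (rule smooth_on_differentiable[OF s]) (use q in blast)
        ultimately show ?thesis
          using dir_deriv_chart[OF at[OF q(1)] coord_tvec_tangent[OF at[OF q(1)]], of "\<lambda>q. \<omega> q (?X a q) (?X b q)" u]
            at[OF q(1)] q(2) by simp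
      qed
      then have "frechet_derivative ?g (at y) = (\<lambda>u. 0)" by (rule ext)
      then show ?thesis using smooth_on_derivative[OF s y] by simp
    qed
    from has_derivative_zero_unique_connected[OF open_chart[OF f(1)] f(2) this imageI[OF pq(1)] imageI[OF pq(2)]]
    show ?thesis using pq f(1) by (simp add: inner)
  qed
  then show ?thesis by (metis vector_eq_rdot)
qed

text \<open>The identification of \<open>\<complex>\<^sup>m \<otimes> \<complex>\<close>, the second factor acting through the pairs \<open>(a, u) = a + \<i> u\<close>, with
  \<open>\<complex>\<^sup>m \<times> \<complex>\<^sup>m\<close>.\<close>
definition regroup :: "(complex^'m) \<times> (complex^'m) \<Rightarrow> (complex^'m) \<times> (complex^'m)" where
  "regroup z = (\<chi> k. Complex (Re (fst z $ k)) (Re (snd z $ k)), \<chi> k. Complex (Im (fst z $ k)) (Im (snd z $ k)))"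

lemma linear_regroup: "linear regroup"
  by (rule linearI) (simp_all add: regroup_def prod_eq_iff vec_eq_iff complex_eq_iff)

lemma regroup_regroup: "regroup (regroup z) = z"
  by (simp add: regroup_def prod_eq_iff vec_eq_iff)

lemma regroup_imult2: "regroup (- u, a) = imult2 (regroup (a, u))"
  by (simp add: regroup_def imult2_def vec_eq_iff complex_eq_iff)

text \<open>In an affine chart the matrix \<open>\<Omega>\<close> of \<open>\<omega>\<close> is constant and \<open>J_omega\<close> is the constant structure
  \<open>(a, e) \<mapsto> (-\<Omega>\<^sup>-\<^sup>1 e, \<Omega> a)\<close>.\<close>
lemma J2_chart:
  assumes x: "x \<in> mcarrier (cotangent_atlas A)"
  shows "\<exists>d\<in>charts_at (cotangent_atlas A) x. \<forall>y\<in>fst d. \<forall>w\<in>tangent_space (cotangent_atlas A) y.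
    J_omega A nabla \<omega> y w d = imult2 (w d)"
proof -
  obtain f where f: "f \<in> charts_at A (fst x)" "connected (snd f ` fst f)"
    and f0: "\<And>q v w. q \<in> fst f \<Longrightarrow> chris f q v w = 0"
    by (rule affine_chart[OF base_point[OF x]]) (rule that)
  have fm: "f \<in> max_atlas A" "fst x \<in> fst f" using f by (auto simp: charts_at_iff)
  \<comment> \<open>Taken at the base point of \<open>x\<close>; by \<open>gram_constant\<close> it
    is the matrix of \<omega> at every point of the chart domain.\<close>
  define G where "G = gram (fst x) f"
  have G: "linear G" "inj G" unfolding G_def by (rule gram_linear[OF base_point[OF x] f(1)], rule gram_inj[OF base_point[OF x] f(1)])
  obtain G' where G': "linear G'" "\<And>a. G' (G a) = a" "\<And>a. G (G' a) = a"
    using linear_injective_isomorphism[OF G] by blast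
  \<comment> \<open>With u = \<Omega>^-1 e the structure reads (a, u) -> (-u, a), which is
    multiplication by \<i> on a + \<i>u; \<open>regroup\<close> carries it to
    \<open>imult2\<close>.\<close>
  define L where "L = (\<lambda>z. regroup (fst z, G' (snd z)))"
  define L' where "L' = (\<lambda>z. (fst (regroup z), G (snd (regroup z))))"
  have L: "linear L"
    by (rule linearI) (simp_all add: L_def linear_add[OF G'(1)] linear_scale[OF G'(1)]
       linear_add[OF linear_regroup, symmetric] linear_scale[OF linear_regroup, symmetric])
  have L': "linear L'"
    by (rule linearI) (simp_all add: L'_def linear_add[OF G(1)] linear_scale[OF G(1)]
       linear_add[OF linear_regroup] linear_scale[OF linear_regroup])
  have LL: "L' (L z) = z" "L (L' z) = z" for z
    by (simp_all add: L_def L'_def regroup_regroup G' prod_eq_iff)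
  note lc = N.linear_chart[OF cot_chart_max[OF fm(1)] L L' LL]
  let ?d = "(fst (cot_chart f), L \<circ> snd (cot_chart f))"
  have "x \<in> fst (cot_chart f)" using cot_chart_at[OF f(1) x] by (simp add: N.charts_at_iff)
  then have "?d \<in> charts_at (cotangent_atlas A) x" using lc(1) by (simp add: N.charts_at_iff)
  moreover have "J_omega A nabla \<omega> y w ?d = imult2 (w ?d)"
    if y: "y \<in> fst ?d" and w: "w \<in> tangent_space (cotangent_atlas A) y" for y w
  proof -
    have yc: "y \<in> fst (cot_chart f)" using y by simp
    have ym: "y \<in> mcarrier (cotangent_atlas A)"
      by (rule N.max_atlas_carrier[OF cot_chart_max[OF fm(1)] yc])
    have fy: "f \<in> charts_at A (fst y)" using yc fm by (simp add: mem_cot_chart charts_at_iff)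
    then have qf: "fst y \<in> fst f" by (simp add: charts_at_iff)
    note at = cot_chart_at[OF fy ym]
    note pm = base_point[OF ym]
    obtain v \<eta> where v: "v \<in> tangent_space A (fst y)" and \<eta>: "\<eta> \<in> cotangent_space A (fst y)" and we: "w = lift y v \<eta>"
      by (rule lift_surj[OF ym w])
    let ?fmap = "form_map A (fst y) (\<omega> (fst y))" and ?finv = "form_inverse A (fst y) (\<omega> (fst y)) \<eta>"
    have hor0: "hor f y a = 0" for a by (simp add: hor_def f0[OF qf])
    have "covec_coords A f (fst y) (?fmap u) = G (u f)" if u: "u \<in> tangent_space A (fst y)" for u
      using tangent_eq_coord_tvec[OF u fy] gram_constant[OF fm(1) f(2) f0 fm(2) qf, of "u f"]
      by (simp add: G_def gram_def[OF pm])
    from this[OF v] this[OF finv_in[OF pm \<eta>]]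
    have G_v: "covec_coords A f (fst y) (?fmap v) = G (v f)" and G_\<eta>: "?finv f = G' (covec_coords A f (fst y) \<eta>)"
      using fmap_finv[OF pm \<eta>] G' by simp_all
    have "J_omega A nabla \<omega> y w (cot_chart f) = (- G' (covec_coords A f (fst y) \<eta>), G (v f))"
      using at by (simp add: we J2_lift[OF ym v \<eta>] lift_chart[OF fy ym T_closed(3)[OF pm finv_in[OF pm \<eta>]] fmap_in[OF pm v]]
          hor0 G_v G_\<eta>)
    moreover have "w (cot_chart f) = (v f, covec_coords A f (fst y) \<eta>)"
      using at by (simp add: we lift_chart[OF fy ym v \<eta>] hor0)
    ultimately show ?thesis
      unfolding lc(2)[OF yc w] lc(2)[OF yc J2_in[OF ym w]] by (simp add: L_def G' regroup_imult2)
  qed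
  ultimately show ?thesis by blast
qed

lemma cotangent_complex_manifolds:
  "complex_manifold imult2 (cotangent_atlas A) (J_nabla A J nabla)"
  "complex_manifold imult2 (cotangent_atlas A) (J_omega A nabla \<omega>)"
proof -
  have "smooth_manifold A" using complex_J unfolding complex_manifold_def by (rule conjunct1)
  then have N: "smooth_manifold (cotangent_atlas A)"
    unfolding smooth_manifold_def
    by (intro conjI N.atlas Hausdorff_cotangent second_countable_cotangent; elim conjE)
  note i = N.complex_structureI[OF linear_imult2 imult2_imult2]
  show "complex_manifold imult2 (cotangent_atlas A) (J_nabla A J nabla)"
    unfolding complex_manifold_def by (intro conjI N i[OF J1_in J1_chart])
  show "complex_manifold imult2 (cotangent_atlas A) (J_omega A nabla \<omega>)"
    unfolding complex_manifold_def by (intro conjI N i[OF J2_in J2_chart])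
qed

end

theorem theorem10:
  fixes A :: "('a, complex^'m::finite) chart set"
    and J :: "'a \<Rightarrow> ('a, complex^'m) tvec \<Rightarrow> ('a, complex^'m) tvec"
    and nabla :: "('a, complex^'m) vfield \<Rightarrow> ('a, complex^'m) vfield \<Rightarrow> ('a, complex^'m) vfield"
    and \<omega> :: "'a \<Rightarrow> ('a, complex^'m) tvec \<Rightarrow> ('a, complex^'m) tvec \<Rightarrow> real"
  assumes "special_symplectic_manifold A J nabla \<omega>"
  shows "let N = cotangent_atlas A;
             J\<^sub>1 = J_nabla A J nabla;
             J\<^sub>2 = J_omega A nabla \<omega>;
             B = block_omega11 A J nabla \<omega>;
             C = block_omega' A J nabla \<omega>
         in complex_manifold imult2 N J\<^sub>1 \<and>
            complex_manifold imult2 N J\<^sub>2 \<and>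
            (\<forall>x\<in>mcarrier N. \<forall>w\<in>tangent_space N x.
               J\<^sub>1 x (J\<^sub>2 x w) - J\<^sub>2 x (J\<^sub>1 x w) = 2 *\<^sub>R J\<^sub>1 x (B x w) \<and>
               J\<^sub>1 x (J\<^sub>2 x w) - J\<^sub>2 x (J\<^sub>1 x w) = (-2) *\<^sub>R B x (J\<^sub>1 x w) \<and>
               J\<^sub>1 x (J\<^sub>2 x w) + J\<^sub>2 x (J\<^sub>1 x w) = 2 *\<^sub>R J\<^sub>1 x (C x w) \<and>
               J\<^sub>1 x (J\<^sub>2 x w) + J\<^sub>2 x (J\<^sub>1 x w) = 2 *\<^sub>R C x (J\<^sub>1 x w))"
proof -
  interpret special_symplectic_on A nabla J \<omega>
    using assms by unfold_locales
      (simp_all add: special_symplectic_manifold_def complex_manifold_def smooth_manifold_def)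
  show ?thesis
    unfolding Let_def using cotangent_complex_manifolds commutators by blast
qed

end
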